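(* Let $(\check M,\check\omega,\check\Omega)$ be the complex parallelizable Nakamura manifold. The symplectic side of its semi-flat non-Kähler supersymmetric mirror pair (with respect to the special Lagrangian torus fibration $\check M\to B=L_{0,0,0}$) is the symplectic manifold $(M,\omega,\Omega)$, where $M=\Gamma'\backslash\big(\mathbb C\times\mathbb C^2/(P\mathbb Z^2\oplus iP^{-T}\mathbb Z^2)\big)$, $\omega=\theta^1\wedge\theta^4+\theta^3\wedge\theta^5-\theta^2\wedge\theta^6$, and $\Omega$ is the Fourier-Mukai transform of $e^{2\check\omega}$.
   Context: Let $M_0\in SL(2,\mathbb Z)$, $P\in GL(2,\mathbb R)$ and $\lambda\neq0$ with $PM_0P^{-1}=D=\mathrm{diag}(e^\lambda,e^{-\lambda})$, and let $\tau\in\mathbb R\setminus\{0\}$. Coordinates on $\mathbb C\times\mathbb C^2$: $(z_1,z_2,z_3)$. Complex side: $\check M=\langle T_1,T_2\rangle\backslash\big(\mathbb C\times\mathbb C^2/(P\mathbb Z^2\oplus iP\mathbb Z^2)\big)$, $T_1(z_1,[z_2,z_3])=(z_1+\lambda,[e^\lambda z_2,e^{-\lambda}z_3])$, $T_2(z_1,[z_2,z_3])=(z_1+i\tau,[z_2,z_3])$. Put $\phi^1=dz_1$, $\phi^2=e^{-z_1}dz_2$, $\phi^3=e^{z_1}dz_3$, $\phi^k=\theta^k+i\theta^{3+k}$, $\check\omega=\frac i2\sum_k\phi^k\wedge\bar\phi^k$, $\check\Omega=\phi^1\wedge\phi^2\wedge\phi^3$. Symplectic side: $\Gamma'=\langle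 T_1',T_2'\rangle$ acting on $\mathbb C\times\mathbb C^2/(P\mathbb Z^2\oplus iP^{-T}\mathbb Z^2)$, $P^{-T}=(P^{-1})^T$, by $T_1'(z_1,[z_2,z_3])=(z_1+\lambda,[e^\lambda z_2,e^{-\lambda}z_3])$, $T_2'(z_1,[z_2,z_3])=(z_1+i\tau^{-1},[z_2,z_3])$; the $\theta^k$ are given by the formulas $\theta^1+i\theta^4=dz_1$, $\theta^2+i\theta^5=e^{-z_1}dz_2$, $\theta^3+i\theta^6=e^{z_1}dz_3$. Fibration: $L_{0,0,0}$ is the compact special Lagrangian submanifold of $\check M$ which is the image of $\{\mathrm{Im}\,z_1=\mathrm{Im}\,z_2=\mathrm{Im}\,z_3=0\}$ and $\check M\to B=L_{0,0,0}$ is the Lagrangian fibration with fiber $T=\mathbb R^3/\Lambda$, $\Lambda=\tau\mathbb Z\oplus P\mathbb Z^2$ (base affine coordinates $r_j=\mathrm{Re}\,z_j$, fiber coordinates $\check\theta_j$ given up to sign by $\mathrm{Im}\,z_j$). $\Lambda^*$ denotes the dual lattice, $\theta_j$ (with lower index) the dual fiber coordinates on $T^*B/\Lambda^*$. Semi-flat mirror pair: $(X,\omega)$ is a symplectic manifold with a Lagrangian torus bundle $X\to B$, locally symplectomorphic to $(T^*U/\Lambda^*,\sum d\theta_j\wedge dr_j)$; the dual torus bundle $\check X\to B$ is locally $TU/\Lambda$ with complex structure having holomorphic coordinates $\check\theta_j+ir_j$ and holomorphic volume form $\bigwedge_j(d\check\theta_j+i\,dr_j)$ (here up to a constant phase);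 $X$ is the symplectic side and $\check X$ the complex side. It is supersymmetric when $d\check\Omega=0$, $d\check\omega^2=0$ (type IIB) on $\check X$ and $d\omega=0$, $d\,\mathrm{Re}\,\Omega=0$ (type IIA) on $X$, with $\Omega=\mathrm{FT}(e^{2\check\omega})$. Fourier-Mukai transform: $\mathrm{FT}(\check\alpha)=\check\pi_*\big(\pi^*(\mathcal P\cdot\check\alpha)\wedge e^{\sum_jd\check\theta_j\wedge d\theta_j}\big)$, with $\pi,\check\pi$ the projections of $(TB/\Lambda)\times_B(T^*B/\Lambda^* )$ to $TB/\Lambda$, $T^*B/\Lambda^*$, and $\mathcal P$ the polarization switch operator replacing $d\check\theta_j+i\,dr_j$ by $d\check\theta_j$ and $d\check\theta_j-i\,dr_j$ by $dr_j$.
   Formalization: In M the summand iP^{-T}Z^2 is replaced by iJP^{-T}Z^2, J(a,b)=(-b,a), i.e. P^{-T}Z^2 is read in the dual fibre coordinates (Im z_3, -Im z_2) fixed by ω; with iP^{-T}Z^2 taken verbatim in (Im z_2, Im z_3) the claim fails for general P. *)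

theory Defs
  imports "HOL-Analysis.Analysis" "HOL-Library.Function_Algebras"
begin

type_synonym R3 = "real^3"
type_synonym C3 = "complex^3"


section \<open>Smooth maps and differential forms on Euclidean spaces\<close>

primrec Ck :: "nat \<Rightarrow> ('a::real_normed_vector \<Rightarrow> 'b::real_normed_vector) \<Rightarrow> bool" where
  "Ck 0 f \<longleftrightarrow> continuous_on UNIV f"
| "Ck (Suc n) f \<longleftrightarrow> (\<forall>x. f differentiable (at x)) \<and> (\<forall>v. Ck n (\<lambda>x. frechet_derivative f (at x) v))"

definition smooth :: "('a::real_normed_vector \<Rightarrow> 'b::real_normed_vector) \<Rightarrow> bool" where
  "smooth f \<longleftrightarrow> (\<forall>n. Ck n f)"

text \<open>A complex-valued form of mixed degree sends a point and a list of k tangent vectors to the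
  value of its degree-k component on them. Sums and differences of forms are pointwise.\<close>

type_synonym 'a form = "'a \<Rightarrow> 'a list \<Rightarrow> complex"

definition diff_form :: "nat \<Rightarrow> 'a::real_normed_vector form \<Rightarrow> bool" where
  "diff_form k \<alpha> \<longleftrightarrow>
     (\<forall>vs. smooth (\<lambda>x. \<alpha> x vs)) \<and>
     (\<forall>x vs. length vs \<noteq> k \<longrightarrow> \<alpha> x vs = 0) \<and>
     (\<forall>x us ws. linear (\<lambda>v. \<alpha> x (us @ v # ws))) \<and>
     (\<forall>x us v ws zs. \<alpha> x (us @ v # ws @ v # zs) = 0)"

definition real_form :: "'a form \<Rightarrow> bool" where
  "real_form \<alpha> \<longleftrightarrow> (\<forall>x vs. Im (\<alpha> x vs) = 0)"

definition fun_form :: "('a \<Rightarrow> complex) \<Rightarrow> 'a form" where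
  "fun_form f x vs = (if vs = [] then f x else 0)"

definition fscale :: "complex \<Rightarrow> 'a form \<Rightarrow> 'a form" where
  "fscale c \<alpha> x vs = c * \<alpha> x vs"

definition cnj_form :: "'a form \<Rightarrow> 'a form" where
  "cnj_form \<alpha> x vs = cnj (\<alpha> x vs)"

definition Re_form :: "'a form \<Rightarrow> 'a form" where
  "Re_form \<alpha> x vs = complex_of_real (Re (\<alpha> x vs))"

definition Im_form :: "'a form \<Rightarrow> 'a form" where
  "Im_form \<alpha> x vs = complex_of_real (Im (\<alpha> x vs))"

text \<open>The exterior product at a point, normalised by (a wedge b)(v, w) = a(v) b(w) - a(w) b(v) for
  1-forms. The recursion says that contraction with a vector is an antiderivation; unfolding it
  gives the signed sum over all shuffles.\<close>

fun alt_wedge :: "('v list \<Rightarrow> complex) \<Rightarrow> ('v list \<Rightarrow> complex) \<Rightarrow> 'v list \<Rightarrow> complex" where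
  "alt_wedge a b [] = a [] * b []"
| "alt_wedge a b (v # vs) =
     alt_wedge (\<lambda>ws. a (v # ws)) b vs
     + alt_wedge (\<lambda>ws. (-1) ^ length ws * a ws) (\<lambda>ws. b (v # ws)) vs"

definition wedge :: "'a form \<Rightarrow> 'a form \<Rightarrow> 'a form" (infixr "\<and>\<^sub>d" 75) where
  "(\<alpha> \<and>\<^sub>d \<beta>) x = alt_wedge (\<alpha> x) (\<beta> x)"

primrec fpow :: "'a form \<Rightarrow> nat \<Rightarrow> 'a form" where
  "fpow \<alpha> 0 = fun_form (\<lambda>_. 1)"
| "fpow \<alpha> (Suc n) = \<alpha> \<and>\<^sub>d fpow \<alpha> n"

text \<open>The exponential is only applied to 2-forms; all terms beyond the cut-off are then zero.\<close>

definition fexp :: "'a form \<Rightarrow> 'a form" where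
  "fexp \<alpha> x vs = (\<Sum>k\<le>length vs. fpow \<alpha> k x vs / fact k)"

definition ext_d :: "'a::real_normed_vector form \<Rightarrow> 'a form" where
  "ext_d \<alpha> x vs = (\<Sum>i<length vs. (-1) ^ i *
     frechet_derivative (\<lambda>y. \<alpha> y (take i vs @ drop (Suc i) vs)) (at x) (vs ! i))"

definition closed_form :: "'a::real_normed_vector form \<Rightarrow> bool" where
  "closed_form \<alpha> \<longleftrightarrow> ext_d \<alpha> = 0"

definition pullback ::
    "('a::real_normed_vector \<Rightarrow> 'b::real_normed_vector) \<Rightarrow> 'b form \<Rightarrow> 'a form" where
  "pullback f \<alpha> x vs = \<alpha> (f x) (map (frechet_derivative f (at x)) vs)"

definition dfun :: "('a::real_normed_vector \<Rightarrow> complex) \<Rightarrow> 'a form" where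
  "dfun f = ext_d (fun_form f)"


section \<open>Manifolds as quotients of a Euclidean space by a group of diffeomorphisms\<close>

inductive_set generated_group :: "('a \<Rightarrow> 'a) set \<Rightarrow> ('a \<Rightarrow> 'a) set" for S where
  "id \<in> generated_group S"
| "s \<in> S \<Longrightarrow> g \<in> generated_group S \<Longrightarrow> s \<circ> g \<in> generated_group S"
| "s \<in> S \<Longrightarrow> g \<in> generated_group S \<Longrightarrow> inv s \<circ> g \<in> generated_group S"

definition orbit :: "('a \<Rightarrow> 'a) set \<Rightarrow> 'a \<Rightarrow> 'a set" where
  "orbit \<Gamma> x = (\<lambda>g. g x) ` \<Gamma>"

text \<open>Free and properly discontinuous action; the last clause makes the quotient Hausdorff. The
  points of the quotient manifold are the orbits, its forms are the invariant forms.\<close>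

definition deck_group :: "('a::euclidean_space \<Rightarrow> 'a) set \<Rightarrow> bool" where
  "deck_group \<Gamma> \<longleftrightarrow>
     id \<in> \<Gamma> \<and> (\<forall>g\<in>\<Gamma>. \<forall>h\<in>\<Gamma>. g \<circ> h \<in> \<Gamma>) \<and>
     (\<forall>g\<in>\<Gamma>. bij g \<and> smooth g \<and> inv g \<in> \<Gamma>) \<and>
     (\<forall>x. \<exists>U. open U \<and> x \<in> U \<and> (\<forall>g\<in>\<Gamma>. g \<noteq> id \<longrightarrow> g ` U \<inter> U = {})) \<and>
     (\<forall>x y. y \<notin> orbit \<Gamma> x \<longrightarrow>
        (\<exists>U V. open U \<and> open V \<and> x \<in> U \<and> y \<in> V \<and> (\<forall>g\<in>\<Gamma>. g ` U \<inter> V = {})))"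

definition compact_quotient :: "('a::euclidean_space \<Rightarrow> 'a) set \<Rightarrow> bool" where
  "compact_quotient \<Gamma> \<longleftrightarrow> (\<exists>K. compact K \<and> (\<forall>x. orbit \<Gamma> x \<inter> K \<noteq> {}))"

definition form_on_quotient ::
    "('a::euclidean_space \<Rightarrow> 'a) set \<Rightarrow> nat \<Rightarrow> 'a form \<Rightarrow> bool" where
  "form_on_quotient \<Gamma> k \<alpha> \<longleftrightarrow> diff_form k \<alpha> \<and> (\<forall>g\<in>\<Gamma>. pullback g \<alpha> = \<alpha>)"

text \<open>Diffeomorphism of covers that descends to a diffeomorphism of the quotients.\<close>

definition quotient_diffeo ::
    "('a::euclidean_space \<Rightarrow> 'a) set \<Rightarrow> ('b::euclidean_space \<Rightarrow> 'b) set \<Rightarrow> ('a \<Rightarrow> 'b) \<Rightarrow> bool" where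
  "quotient_diffeo \<Gamma> \<Gamma>' F \<longleftrightarrow>
     bij F \<and> smooth F \<and> smooth (inv F) \<and>
     (\<forall>x y. y \<in> orbit \<Gamma> x \<longleftrightarrow> F y \<in> orbit \<Gamma>' (F x))"

definition symplectic_manifold ::
    "('a::euclidean_space \<Rightarrow> 'a) set \<Rightarrow> 'a form \<Rightarrow> bool" where
  "symplectic_manifold \<Gamma> \<omega> \<longleftrightarrow>
     deck_group \<Gamma> \<and> form_on_quotient \<Gamma> 2 \<omega> \<and> real_form \<omega> \<and> closed_form \<omega> \<and>
     (\<forall>x v. v \<noteq> 0 \<longrightarrow> (\<exists>w. \<omega> x [v, w] \<noteq> 0))"

text \<open>Complex threefold with a Hermitian form and a holomorphic volume form; \<open>\<i> *s v\<close> is the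
  standard complex structure. Holomorphy of \<open>\<Omega>\<close> as a (3,0)-form is its closedness.\<close>

definition hermitian_cy_manifold ::
    "(C3 \<Rightarrow> C3) set \<Rightarrow> C3 form \<Rightarrow> C3 form \<Rightarrow> bool" where
  "hermitian_cy_manifold \<Gamma> \<omega> \<Omega> \<longleftrightarrow>
     deck_group \<Gamma> \<and>
     (\<forall>g\<in>\<Gamma>. \<forall>z v. frechet_derivative g (at z) (\<i> *s v) = \<i> *s frechet_derivative g (at z) v) \<and>
     form_on_quotient \<Gamma> 2 \<omega> \<and> real_form \<omega> \<and>
     (\<forall>z v w. \<omega> z [\<i> *s v, \<i> *s w] = \<omega> z [v, w]) \<and>
     (\<forall>z v. v \<noteq> 0 \<longrightarrow> 0 < Re (\<omega> z [v, \<i> *s v])) \<and>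
     form_on_quotient \<Gamma> 3 \<Omega> \<and> closed_form \<Omega> \<and>
     (\<forall>z u v w. \<Omega> z [\<i> *s u, v, w] = \<i> * \<Omega> z [u, v, w]) \<and>
     (\<forall>z. \<exists>vs. \<Omega> z vs \<noteq> 0)"

text \<open>An immersion (or any parametrisation) along which \<open>\<omega>\<close> and the imaginary part of
  \<open>c \<Omega>\<close> vanish: special Lagrangian of phase determined by \<open>c\<close>.\<close>

definition special_lagrangian ::
    "complex \<Rightarrow> (R3 \<Rightarrow> C3) \<Rightarrow> C3 form \<Rightarrow> C3 form \<Rightarrow> bool" where
  "special_lagrangian c f \<omega> \<Omega> \<longleftrightarrow>
     pullback f \<omega> = 0 \<and> Im_form (fscale c (pullback f \<Omega>)) = 0"


section \<open>Affine base, TB/Lambda and its dual\<close>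

definition integer_vectors :: "(real^'n) set" where
  "integer_vectors = {v. \<forall>i. v $ i \<in> \<int>}"

definition lattice :: "real^'n^'n \<Rightarrow> (real^'n) set" where
  "lattice A = (\<lambda>v. A *v v) ` integer_vectors"

definition dual_lattice :: "(real^'n) set \<Rightarrow> (real^'n) set" where
  "dual_lattice L = {w. \<forall>v\<in>L. v \<bullet> w \<in> \<int>}"

text \<open>The base is the quotient of \<open>real^3\<close> by a group of affine maps; the lattice is a locally
  constant family in the tangent spaces.\<close>

definition affine_lattice_base :: "(R3 \<Rightarrow> R3) set \<Rightarrow> real^3^3 \<Rightarrow> bool" where
  "affine_lattice_base G A \<longleftrightarrow>
     deck_group G \<and> invertible A \<and>
     (\<forall>g\<in>G. \<exists>L b. linear L \<and> g = (\<lambda>r. L r + b) \<and> L ` lattice A = lattice A)"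

definition tangent_lift ::
    "(R3 \<Rightarrow> R3) \<Rightarrow> R3 \<times> R3 \<Rightarrow> R3 \<times> R3" where
  "tangent_lift g = (\<lambda>(r, s). (g r, frechet_derivative g (at r) s))"

definition cotangent_lift ::
    "(R3 \<Rightarrow> R3) \<Rightarrow> R3 \<times> R3 \<Rightarrow> R3 \<times> R3" where
  "cotangent_lift g = (\<lambda>(r, t). (g r, adjoint (frechet_derivative (inv g) (at (g r))) t))"

definition fibre_translation :: "R3 \<Rightarrow> R3 \<times> R3 \<Rightarrow> R3 \<times> R3" where
  "fibre_translation a = (\<lambda>(r, s). (r, s + a))"

definition tangent_group ::
    "(R3 \<Rightarrow> R3) set \<Rightarrow> real^3^3 \<Rightarrow> (R3 \<times> R3 \<Rightarrow> R3 \<times> R3) set" where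
  "tangent_group G A =
     {fibre_translation a \<circ> tangent_lift g |a g. a \<in> lattice A \<and> g \<in> G}"

definition cotangent_group ::
    "(R3 \<Rightarrow> R3) set \<Rightarrow> real^3^3 \<Rightarrow> (R3 \<times> R3 \<Rightarrow> R3 \<times> R3) set" where
  "cotangent_group G A =
     {fibre_translation a \<circ> cotangent_lift g |a g. a \<in> dual_lattice (lattice A) \<and> g \<in> G}"

text \<open>Coordinate 1-forms: on pairs (r, s) the fibre coordinate s is the one of TB or of T*B; on
  triples (r, s, t) over the fibre product, s belongs to TB and t to T*B.\<close>

definition d_base :: "3 \<Rightarrow> (R3 \<times> R3) form" where
  "d_base j = dfun (\<lambda>(r, s). complex_of_real (r $ j))"

definition d_fibre :: "3 \<Rightarrow> (R3 \<times> R3) form" where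
  "d_fibre j = dfun (\<lambda>(r, s). complex_of_real (s $ j))"

definition canonical_symplectic :: "(R3 \<times> R3) form" where
  "canonical_symplectic = (\<Sum>j\<in>UNIV. d_fibre j \<and>\<^sub>d d_base j)"

definition semiflat_volume :: "(R3 \<times> R3) form" where
  "semiflat_volume =
     (d_fibre 1 + fscale \<i> (d_base 1)) \<and>\<^sub>d (d_fibre 2 + fscale \<i> (d_base 2))
       \<and>\<^sub>d (d_fibre 3 + fscale \<i> (d_base 3))"

text \<open>\<open>J (u, w) = (w, - u)\<close> is the complex structure on TB with holomorphic coordinates
  \<open>s $ j + \<i> * r $ j\<close>.\<close>

definition semiflat_J :: "R3 \<times> R3 \<Rightarrow> R3 \<times> R3" where
  "semiflat_J = (\<lambda>(u, w). (w, - u))"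

definition semiflat_complex_side ::
    "(R3 \<Rightarrow> R3) set \<Rightarrow> real^3^3 \<Rightarrow> (C3 \<Rightarrow> C3) set \<Rightarrow> C3 form
      \<Rightarrow> (R3 \<times> R3 \<Rightarrow> C3) \<Rightarrow> bool" where
  "semiflat_complex_side G A \<Gamma> \<Omega> F \<longleftrightarrow>
     quotient_diffeo (tangent_group G A) \<Gamma> F \<and>
     (\<forall>p v. frechet_derivative F (at p) (semiflat_J v) = \<i> *s frechet_derivative F (at p) v) \<and>
     (\<exists>c. cmod c = 1 \<and> pullback F \<Omega> = fscale c semiflat_volume)"

definition semiflat_symplectic_side ::
    "(R3 \<Rightarrow> R3) set \<Rightarrow> real^3^3 \<Rightarrow> (C3 \<Rightarrow> C3) set \<Rightarrow> C3 form
      \<Rightarrow> (R3 \<times> R3 \<Rightarrow> C3) \<Rightarrow> bool" where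
  "semiflat_symplectic_side G A \<Gamma> \<omega> F \<longleftrightarrow>
     quotient_diffeo (cotangent_group G A) \<Gamma> F \<and> pullback F \<omega> = canonical_symplectic"


section \<open>Fourier-Mukai transform\<close>

text \<open>Complex multilinear extension of a real multilinear function; the pair (u, v) stands for the
  complexified vector \<open>u + \<i> v\<close>.\<close>

fun complex_ext :: "('v list \<Rightarrow> complex) \<Rightarrow> ('v \<times> 'v) list \<Rightarrow> complex" where
  "complex_ext a [] = a []"
| "complex_ext a ((u, v) # ws) =
     complex_ext (\<lambda>vs. a (u # vs)) ws + \<i> * complex_ext (\<lambda>vs. a (v # vs)) ws"

text \<open>The complex linear map on complexified tangent vectors whose transpose sends
  \<open>d_fibre j + \<i> d_base j\<close> to \<open>d_fibre j\<close> and \<open>d_fibre j - \<i> d_base j\<close> to \<open>d_base j\<close>, i.e.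
  \<open>d_fibre j\<close> to \<open>(d_base j + d_fibre j) / 2\<close> and \<open>d_base j\<close> to \<open>\<i> (d_base j - d_fibre j) / 2\<close>.\<close>

definition pol_vec ::
    "R3 \<times> R3 \<Rightarrow> (R3 \<times> R3) \<times> (R3 \<times> R3)" where
  "pol_vec = (\<lambda>(u, w). ((0, (1/2) *\<^sub>R (u + w)), ((1/2) *\<^sub>R (u - w), 0)))"

definition pol_switch :: "(R3 \<times> R3) form \<Rightarrow> (R3 \<times> R3) form" where
  "pol_switch \<alpha> x vs = complex_ext (\<alpha> x) (map pol_vec vs)"

lemma complex_ext_add: "complex_ext (\<lambda>vs. a vs + b vs) ws = complex_ext a ws + complex_ext b ws"
  by (induction ws arbitrary: a b rule: list.induct) (auto simp: algebra_simps split: prod.splits)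

lemma complex_ext_mult: "complex_ext (\<lambda>vs. c * a vs) ws = c * complex_ext a ws"
  by (induction ws arbitrary: a) (auto simp: algebra_simps)

lemma complex_ext_sign:
  "complex_ext (\<lambda>vs. (-1) ^ length vs * a vs) ws = (-1) ^ length ws * complex_ext a ws"
proof (induction ws arbitrary: a)
  case (Cons w ws)
  have "complex_ext (\<lambda>vs. - ((-1) ^ length vs * b vs)) ws = - ((-1) ^ length ws * complex_ext b ws)" for b
    using complex_ext_mult[of "-1" "\<lambda>vs. (-1) ^ length vs * b vs" ws] Cons.IH[of b] by simp
  then show ?case by (cases w) (simp add: algebra_simps)
qed simp

lemma alt_wedge_add_left: "alt_wedge (\<lambda>vs. a vs + a' vs) b ws = alt_wedge a b ws + alt_wedge a' b ws"
  by (induction ws arbitrary: a a' b) (auto simp: algebra_simps)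

lemma alt_wedge_add_right: "alt_wedge a (\<lambda>vs. b vs + b' vs) ws = alt_wedge a b ws + alt_wedge a b' ws"
  by (induction ws arbitrary: a b b') (auto simp: algebra_simps)

lemma alt_wedge_mult_left: "alt_wedge (\<lambda>vs. c * a vs) b ws = c * alt_wedge a b ws"
proof (induction ws arbitrary: a b)
  case (Cons w ws)
  have "(\<lambda>ws. (-1) ^ length ws * (c * a ws)) = (\<lambda>ws. c * ((-1) ^ length ws * a ws))"
    by (simp add: fun_eq_iff algebra_simps)
  then show ?case by (simp add: Cons.IH algebra_simps)
qed simp

lemma alt_wedge_mult_right: "alt_wedge a (\<lambda>vs. c * b vs) ws = c * alt_wedge a b ws"
  by (induction ws arbitrary: a b) (auto simp: algebra_simps)

lemma complex_ext_alt_wedge: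
  "complex_ext (alt_wedge a b) ws = alt_wedge (complex_ext a) (complex_ext b) ws"
proof (induction ws arbitrary: a b)
  case (Cons w ws)
  obtain u v where w: "w = (u, v)" by (cases w)
  have sgn: "complex_ext (\<lambda>vs. (-1) ^ length vs * a vs) = (\<lambda>vs. (-1) ^ length vs * complex_ext a vs)"
    by (rule ext) (rule complex_ext_sign)
  show ?case
    by (simp add: w complex_ext_add sgn Cons.IH alt_wedge_add_left alt_wedge_add_right
        alt_wedge_mult_left alt_wedge_mult_right distrib_left)
qed simp

lemma alt_wedge_map: "alt_wedge a b (map f ws) = alt_wedge (\<lambda>vs. a (map f vs)) (\<lambda>vs. b (map f vs)) ws"
  by (induction ws arbitrary: a b) auto

lemma pol_switch_wedge: "pol_switch (\<alpha> \<and>\<^sub>d \<beta>) = pol_switch \<alpha> \<and>\<^sub>d pol_switch \<beta>"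
proof (intro ext)
  fix x vs
  show "pol_switch (\<alpha> \<and>\<^sub>d \<beta>) x vs = (pol_switch \<alpha> \<and>\<^sub>d pol_switch \<beta>) x vs"
    by (simp add: pol_switch_def[abs_def] wedge_def complex_ext_alt_wedge[abs_def] alt_wedge_map)
qed

lemma dfun_linear:
  fixes l :: "'a::euclidean_space \<Rightarrow> complex"
  assumes "linear l"
  shows "dfun l x vs = (case vs of [v] \<Rightarrow> l v | _ \<Rightarrow> 0)"
proof -
  have "frechet_derivative l (at x) = l"
    using assms by (metis frechet_derivative_at has_derivative_linear linear_conv_bounded_linear
        bounded_linear_imp_has_derivative)
  moreover have "vs = [] \<or> (\<exists>v. vs = [v]) \<or> (\<exists>v w us. vs = v # w # us)"
    by (metis list.exhaust)
  ultimately show ?thesis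
    by (auto simp: dfun_def ext_d_def fun_form_def take_Cons split: nat.splits intro!: sum.neutral)
qed

lemma d_base_eq: "d_base j x vs = (case vs of [v] \<Rightarrow> complex_of_real (fst v $ j) | _ \<Rightarrow> 0)"
proof -
  have "linear (\<lambda>v::R3 \<times> R3. complex_of_real (fst v $ j))"
    by (rule linearI) (auto simp: complex_eq_iff)
  from dfun_linear[OF this] show ?thesis by (simp add: d_base_def case_prod_unfold)
qed

lemma d_fibre_eq: "d_fibre j x vs = (case vs of [v] \<Rightarrow> complex_of_real (snd v $ j) | _ \<Rightarrow> 0)"
proof -
  have "linear (\<lambda>v::R3 \<times> R3. complex_of_real (snd v $ j))"
    by (rule linearI) (auto simp: complex_eq_iff)
  from dfun_linear[OF this] show ?thesis by (simp add: d_fibre_def case_prod_unfold)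
qed

lemma complex_ext_0: "complex_ext (\<lambda>_. 0) ws = 0"
  by (induction ws) auto

lemma pol_switch_generators:
  "pol_switch (d_fibre j + fscale \<i> (d_base j)) = d_fibre j"
  "pol_switch (d_fibre j - fscale \<i> (d_base j)) = d_base j"
proof -
  have "pol_switch (d_fibre j + fscale \<i> (d_base j)) x vs = d_fibre j x vs \<and>
        pol_switch (d_fibre j - fscale \<i> (d_base j)) x vs = d_base j x vs" for x vs
  proof -
    consider "vs = []" | u w where "vs = [(u, w)]" | v v' us where "vs = v # v' # us"
      by (metis list.exhaust surj_pair)
    then show ?thesis
      by cases (auto simp: pol_switch_def pol_vec_def d_base_eq d_fibre_eq fscale_def
          complex_ext_0 complex_eq_iff field_simps split: prod.splits)
  qed
  then show "pol_switch (d_fibre j + fscale \<i> (d_base j)) = d_fibre j"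
    "pol_switch (d_fibre j - fscale \<i> (d_base j)) = d_base j" by blast+
qed

definition poincare_two_form :: "(R3 \<times> R3 \<times> R3) form" where
  "poincare_two_form = (\<Sum>j\<in>UNIV.
     dfun (\<lambda>(r, s, t). complex_of_real (s $ j)) \<and>\<^sub>d dfun (\<lambda>(r, s, t). complex_of_real (t $ j)))"

text \<open>Integration along the fibre \<open>real^3 / lattice A\<close>, oriented by its coordinates, with fibre
  directions in the last slots, i.e. \<open>\<beta> \<and>\<^sub>d ds1 \<and>\<^sub>d ds2 \<and>\<^sub>d ds3\<close> integrates to \<open>\<beta>\<close> times the
  volume of the fibre if \<open>\<beta>\<close> comes from \<open>T*B\<close>.\<close>

definition fibre_integral ::
    "real^3^3 \<Rightarrow> (R3 \<times> R3 \<times> R3) form \<Rightarrow> (R3 \<times> R3) form" where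
  "fibre_integral A \<beta> = (\<lambda>(r, t) vs.
     integral ((\<lambda>v. A *v v) ` cbox 0 (\<chi> i. 1))
       (\<lambda>s. \<beta> (r, s, t) (map (\<lambda>(u, w). (u, 0, w)) vs
                          @ [(0, axis 1 1, 0), (0, axis 2 1, 0), (0, axis 3 1, 0)])))"

definition FT :: "real^3^3 \<Rightarrow> (R3 \<times> R3) form \<Rightarrow> (R3 \<times> R3) form" where
  "FT A \<alpha> = fibre_integral A
     (pullback (\<lambda>(r, s, t). (r, s)) (pol_switch \<alpha>) \<and>\<^sub>d fexp poincare_two_form)"


section \<open>Semi-flat supersymmetric mirror pairs over the real slice\<close>

definition cvec :: "R3 \<Rightarrow> C3" where
  "cvec r = (\<chi> j. complex_of_real (r $ j))"

text \<open>The deck group of the image \<open>L\<^sub>0\<^sub>0\<^sub>0\<close> of \<open>range cvec\<close> in the quotient by \<open>\<Gamma>\<close>.\<close>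

definition real_slice_group :: "(C3 \<Rightarrow> C3) set \<Rightarrow> (R3 \<Rightarrow> R3) set" where
  "real_slice_group \<Gamma> = {g. \<exists>\<gamma>\<in>\<Gamma>. \<forall>r. \<gamma> (cvec r) = cvec (g r)}"

text \<open>Base coordinates \<open>r = Re z\<close> and fibre coordinates \<open>s = - Im z\<close>; this sign makes
  \<open>s + \<i> r = \<i> z\<close> holomorphic. The zero section is \<open>cvec\<close>.\<close>

definition slice_chart :: "R3 \<times> R3 \<Rightarrow> C3" where
  "slice_chart = (\<lambda>(r, s). \<chi> j. Complex (r $ j) (- s $ j))"

text \<open>The quotient of \<open>real^3\<close> by \<open>real_slice_group \<Gamma>\<close> embeds as a compact special Lagrangian,
  and \<open>Re\<close> induces a special Lagrangian fibration onto it with fibre \<open>real^3 / lattice A\<close>.\<close>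

definition special_lagrangian_slice_fibration ::
    "(C3 \<Rightarrow> C3) set \<Rightarrow> C3 form \<Rightarrow> C3 form \<Rightarrow> real^3^3 \<Rightarrow> bool" where
  "special_lagrangian_slice_fibration \<Gamma> \<omega> \<Omega> A \<longleftrightarrow>
     affine_lattice_base (real_slice_group \<Gamma>) A \<and>
     compact_quotient (real_slice_group \<Gamma>) \<and>
     (\<forall>r r'. r' \<in> orbit (real_slice_group \<Gamma>) r \<longleftrightarrow> cvec r' \<in> orbit \<Gamma> (cvec r)) \<and>
     special_lagrangian 1 cvec \<omega> \<Omega> \<and>
     quotient_diffeo (tangent_group (real_slice_group \<Gamma>) A) \<Gamma> slice_chart \<and>
     (\<exists>c. cmod c = 1 \<and> (\<forall>r. special_lagrangian c (\<lambda>s. slice_chart (r, s)) \<omega> \<Omega>))"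

text \<open>The pair is formed with respect to the fibration induced by \<open>Re\<close> on the complex side
  \<open>(\<Gamma>c, \<omega>c, \<Omega>c)\<close>. The Lagrangian torus bundle on the symplectic side \<open>(\<Gamma>s, \<omega>s, \<Omega>s)\<close> is the
  projection of \<open>T*B\<close> to \<open>B\<close>, transported along \<open>F\<close>. Non-Kaehler: \<open>\<omega>c\<close> is not closed.\<close>

definition semiflat_susy_mirror_pair ::
    "(C3 \<Rightarrow> C3) set \<Rightarrow> C3 form \<Rightarrow> C3 form \<Rightarrow> real^3^3
      \<Rightarrow> (C3 \<Rightarrow> C3) set \<Rightarrow> C3 form \<Rightarrow> C3 form \<Rightarrow> bool" where
  "semiflat_susy_mirror_pair \<Gamma>c \<omega>c \<Omega>c A \<Gamma>s \<omega>s \<Omega>s \<longleftrightarrow>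
     hermitian_cy_manifold \<Gamma>c \<omega>c \<Omega>c \<and> \<not> closed_form \<omega>c \<and>
     special_lagrangian_slice_fibration \<Gamma>c \<omega>c \<Omega>c A \<and>
     semiflat_complex_side (real_slice_group \<Gamma>c) A \<Gamma>c \<Omega>c slice_chart \<and>
     symplectic_manifold \<Gamma>s \<omega>s \<and> form_on_quotient \<Gamma>s 3 \<Omega>s \<and>
     (\<exists>F. semiflat_symplectic_side (real_slice_group \<Gamma>c) A \<Gamma>s \<omega>s F \<and>
          pullback F \<Omega>s = FT A (pullback slice_chart (fexp (fscale 2 \<omega>c)))) \<and>
     closed_form \<Omega>c \<and> closed_form (\<omega>c \<and>\<^sub>d \<omega>c) \<and>
     closed_form \<omega>s \<and> closed_form (Re_form \<Omega>s)"


section \<open>The Nakamura manifold and its mirror\<close>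

text \<open>Lifts to the universal cover of the two affine generators; \<open>tau\<close> is replaced by its inverse
  on the symplectic side. Quotienting first by a lattice of translations of \<open>(z\<^sub>2, z\<^sub>3)\<close> and
  then by the generators is the same as quotienting by the group they generate together.\<close>

definition nak_T1 :: "real \<Rightarrow> C3 \<Rightarrow> C3" where
  "nak_T1 lam z = vector [z $ 1 + complex_of_real lam,
     complex_of_real (exp lam) * z $ 2, complex_of_real (exp (- lam)) * z $ 3]"

definition nak_T2 :: "real \<Rightarrow> C3 \<Rightarrow> C3" where
  "nak_T2 tau z = vector [z $ 1 + \<i> * complex_of_real tau, z $ 2, z $ 3]"

definition translation23 :: "complex^2 \<Rightarrow> C3 \<Rightarrow> C3" where
  "translation23 w z = vector [z $ 1, z $ 2 + w $ 1, z $ 3 + w $ 2]"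

text \<open>The lattice \<open>K \<oplus> \<i> K'\<close>.\<close>

definition complex_lattice :: "(real^2) set \<Rightarrow> (real^2) set \<Rightarrow> (complex^2) set" where
  "complex_lattice K K' = {\<chi> j. Complex (a $ j) (b $ j) |a b. a \<in> K \<and> b \<in> K'}"

definition nak_type_group ::
    "real \<Rightarrow> real \<Rightarrow> (complex^2) set \<Rightarrow> (C3 \<Rightarrow> C3) set" where
  "nak_type_group lam tau L =
     generated_group ({nak_T1 lam, nak_T2 tau} \<union> translation23 ` L)"

definition nakamura_group ::
    "real \<Rightarrow> real \<Rightarrow> real^2^2 \<Rightarrow> (C3 \<Rightarrow> C3) set" where
  "nakamura_group lam tau P =
     nak_type_group lam tau (complex_lattice (lattice P) (lattice P))"

text \<open>On the symplectic side the imaginary summand is the dual lattice \<open>P\<^sup>-\<^sup>T \<int>\<^sup>2\<close>, written in the dual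
  fibre coordinates \<open>(\<theta>\<^sub>2, \<theta>\<^sub>3)\<close> determined by the symplectic form below. As this form restricts to
  \<open>d(Im z\<^sub>3) \<and> d(Re z\<^sub>2) - d(Im z\<^sub>2) \<and> d(Re z\<^sub>3)\<close> in these variables, they are
  \<open>(\<theta>\<^sub>2, \<theta>\<^sub>3) = (Im z\<^sub>3, - Im z\<^sub>2)\<close>, hence \<open>(Im z\<^sub>2, Im z\<^sub>3) = (- \<theta>\<^sub>3, \<theta>\<^sub>2)\<close>.\<close>

definition imag_of_dual :: "real^2 \<Rightarrow> real^2" where
  "imag_of_dual b = vector [- b $ 2, b $ 1]"

definition mirror_group ::
    "real \<Rightarrow> real \<Rightarrow> real^2^2 \<Rightarrow> (C3 \<Rightarrow> C3) set" where
  "mirror_group lam tau P =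
     nak_type_group lam (inverse tau)
       (complex_lattice (lattice P) (imag_of_dual ` lattice (transpose (matrix_inv P))))"

definition diag2 :: "real \<Rightarrow> real \<Rightarrow> real^2^2" where
  "diag2 a b = vector [vector [a, 0], vector [0, b]]"

text \<open>Column basis of \<open>tau \<int> \<oplus> P \<int>\<^sup>2\<close>.\<close>

definition fibre_lattice_basis :: "real \<Rightarrow> real^2^2 \<Rightarrow> real^3^3" where
  "fibre_lattice_basis tau P =
     vector [vector [tau, 0, 0], vector [0, P $ 1 $ 1, P $ 1 $ 2], vector [0, P $ 2 $ 1, P $ 2 $ 2]]"

text \<open>Only combinations such as those below descend to the quotients: for general \<open>tau\<close> the
  1-forms \<open>phi2\<close> and \<open>phi3\<close> are not invariant under \<open>nak_T2\<close>.\<close>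

definition phi1 :: "C3 form" where
  "phi1 = dfun (\<lambda>z. z $ 1)"

definition phi2 :: "C3 form" where
  "phi2 = fun_form (\<lambda>z. exp (- z $ 1)) \<and>\<^sub>d dfun (\<lambda>z. z $ 2)"

definition phi3 :: "C3 form" where
  "phi3 = fun_form (\<lambda>z. exp (z $ 1)) \<and>\<^sub>d dfun (\<lambda>z. z $ 3)"

definition nakamura_omega :: "C3 form" where
  "nakamura_omega = fscale (\<i> / 2)
     (phi1 \<and>\<^sub>d cnj_form phi1 + phi2 \<and>\<^sub>d cnj_form phi2 + phi3 \<and>\<^sub>d cnj_form phi3)"

definition nakamura_Omega :: "C3 form" where
  "nakamura_Omega = phi1 \<and>\<^sub>d phi2 \<and>\<^sub>d phi3"

text \<open>\<open>\<theta>\<^sup>1 \<and> \<theta>\<^sup>4 + \<theta>\<^sup>3 \<and> \<theta>\<^sup>5 - \<theta>\<^sup>2 \<and> \<theta>\<^sup>6\<close>, where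
  \<open>\<theta>\<^sup>k\<close> and \<open>\<theta>\<^sup>3\<^sup>+\<^sup>k\<close> are the real and imaginary parts of \<open>phi\<close>-\<open>k\<close>.\<close>

definition mirror_omega :: "C3 form" where
  "mirror_omega = Re_form phi1 \<and>\<^sub>d Im_form phi1 + Re_form phi3 \<and>\<^sub>d Im_form phi2
     - Re_form phi2 \<and>\<^sub>d Im_form phi3"

end

theory Submission
  imports Defs
begin

text \<open>The forms become explicit on the universal covers. Since \<open>\<bar>exp (\<mp> z\<^sub>1)\<bar>\<^sup>2 = exp (\<mp> 2 Re z\<^sub>1)\<close>,
  the Hermitian form is \<open>\<i>/2 \<Sum>\<^sub>j h\<^sub>j dz\<^sub>j \<and> dz\<^sub>j\<^sup>*\<close> with heights \<open>h = (1, exp (- 2 r\<^sub>1), exp (2 r\<^sub>1))\<close>,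
  \<open>r = Re z\<close>, where the star is complex conjugation. The phases of \<open>phi2\<close> and \<open>phi3\<close> also cancel in the
  volume form, which is \<open>dz\<^sub>1 \<and> dz\<^sub>2 \<and> dz\<^sub>3\<close>, and, by \<open>cos\<^sup>2 + sin\<^sup>2 = 1\<close>, in the symplectic form, which is
  \<open>dx\<^sub>1 \<and> dy\<^sub>1 + dx\<^sub>3 \<and> dy\<^sub>2 - dx\<^sub>2 \<and> dy\<^sub>3\<close> for \<open>z = x + \<i> y\<close>. This is \<open>\<Sum>\<^sub>j dt\<^sub>j \<and> dr\<^sub>j\<close> for the fibre coordinates
  \<open>t = (- y\<^sub>1, y\<^sub>3, - y\<^sub>2)\<close>, which dictates the identification \<open>mirror_chart\<close> of the cotangent side with the
  cover of the mirror.

  All forms that occur are combinations of constant forms with coefficients \<open>1\<close> and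
  \<open>exp (\<mp> 2 r\<^sub>1)\<close>. The differential of such a form only sees \<open>dr\<^sub>1\<close>, and so the form is closed as soon
  as its non-constant terms contain the factor \<open>dr\<^sub>1\<close> (\<open>closed_expo_form\<close>). This happens for the square
  of the Hermitian form, where \<open>h\<^sub>2 h\<^sub>3 = 1\<close> makes the remaining term constant, but not for the Hermitian
  form itself.

  The groups are controlled by lattices. The relation \<open>P M\<^sub>0 P\<^sup>-\<^sup>1 = D\<close> says that \<open>D\<close> preserves the lattice
  \<open>P \<int>\<^sup>2\<close>; being symmetric, \<open>D\<close> also preserves the dual lattice \<open>P\<^sup>-\<^sup>T \<int>\<^sup>2\<close>. So every element of either group
  has the normal form \<open>act lam tau n m w\<close>: a power of \<open>D\<close> followed by a translation. Such a group
  acts freely and properly, and the elements that preserve the real slice have linear part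
  \<open>diag(1, D\<^sup>n)\<close> on the base. On the imaginary parts the group of the Nakamura manifold acts by the same
  linear part, which is the tangent lift. On the mirror the coordinates \<open>t\<close> are multiplied by
  the inverse linear part, which is the cotangent lift, and are translated by the dual of the fibre
  lattice \<open>tau \<int> \<oplus> P \<int>\<^sup>2\<close>.

  For the Fourier-Mukai transform, the polarization switch turns twice the Hermitian form into
  \<open>\<i> \<Sum>\<^sub>j h\<^sub>j ds\<^sub>j \<and> dr\<^sub>j\<close>. After multiplication with the Poincare kernel the integrand is the exponential of
  \<open>\<Sum>\<^sub>j ds\<^sub>j \<and> (\<i> h\<^sub>j dr\<^sub>j + dt\<^sub>j)\<close>. Contraction with a vector is an antiderivation, so it multiplies an
  exponential by the contracted exponent. Contracting with the three fibre directions therefore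
  extracts, up to the volume of the fibre, the decomposable 3-form
  \<open>\<And>\<^sub>j (\<i> h\<^sub>j dr\<^sub>j + dt\<^sub>j)\<close> (\<open>FT_nakamura\<close>). It has the shape above, it descends to the mirror, and the
  non-constant terms of its real part contain \<open>dr\<^sub>1\<close>, so that the real part is closed.\<close>

section \<open>The exterior algebra at a point\<close>

text \<open>Forms at a point are arbitrary functions on lists of vectors. With \<open>alt_wedge\<close> they form
  the associative algebra that is dual to the signed shuffle coproduct on tensors.\<close>

definition smul :: "complex \<Rightarrow> ('v list \<Rightarrow> complex) \<Rightarrow> 'v list \<Rightarrow> complex" where
  "smul c a = (\<lambda>vs. c * a vs)"

definition unit_form :: "'v list \<Rightarrow> complex" where
  "unit_form vs = (if vs = [] then 1 else 0)"

text \<open>The grading involution, needed to pass an odd operator through a form of mixed degree.\<close>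

definition hat :: "('v list \<Rightarrow> complex) \<Rightarrow> 'v list \<Rightarrow> complex" where
  "hat a = (\<lambda>vs. (-1) ^ length vs * a vs)"

definition degree_form :: "nat \<Rightarrow> ('v list \<Rightarrow> complex) \<Rightarrow> bool" where
  "degree_form k a \<longleftrightarrow> (\<forall>vs. length vs \<noteq> k \<longrightarrow> a vs = 0)"

lemma alt_wedge_Cons:
  "(\<lambda>ws. alt_wedge a b (v # ws)) =
     alt_wedge (\<lambda>ws. a (v # ws)) b + alt_wedge (hat a) (\<lambda>ws. b (v # ws))"
  by (simp add: fun_eq_iff hat_def)

lemma wedge_add_left: "alt_wedge (a + a') b = alt_wedge a b + alt_wedge a' b"
  by (simp add: fun_eq_iff plus_fun_def alt_wedge_add_left)

lemma wedge_add_right: "alt_wedge a (b + b') = alt_wedge a b + alt_wedge a b'"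
  by (simp add: fun_eq_iff plus_fun_def alt_wedge_add_right)

lemma wedge_smul_left: "alt_wedge (smul c a) b = smul c (alt_wedge a b)"
  by (simp add: fun_eq_iff smul_def alt_wedge_mult_left)

lemma wedge_smul_right: "alt_wedge a (smul c b) = smul c (alt_wedge a b)"
  by (simp add: fun_eq_iff smul_def alt_wedge_mult_right)

lemma smul_smul: "smul c (smul d a) = smul (c * d) a"
  by (simp add: smul_def mult.assoc)

lemma wedge_zero_left: "alt_wedge 0 b = 0"
  using wedge_smul_left[of 0 0 b] by (simp add: smul_def zero_fun_def)

lemma wedge_zero_right: "alt_wedge a 0 = 0"
  using wedge_smul_right[of a 0 0] by (simp add: smul_def zero_fun_def)

lemma wedge_uminus_left: "alt_wedge (- a) b = - alt_wedge a b"
  using wedge_smul_left[of "-1" a b] by (simp add: smul_def fun_Compl_def)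

lemma wedge_uminus_right: "alt_wedge a (- b) = - alt_wedge a b"
  using wedge_smul_right[of a "-1" b] by (simp add: smul_def fun_Compl_def)

lemma wedge_diff_left: "alt_wedge (a - a') b = alt_wedge a b - alt_wedge a' b"
  by (simp only: diff_conv_add_uminus wedge_add_left wedge_uminus_left)

lemma wedge_diff_right: "alt_wedge a (b - b') = alt_wedge a b - alt_wedge a b'"
  by (simp only: diff_conv_add_uminus wedge_add_right wedge_uminus_right)

lemma alt_wedge_sum_right: "alt_wedge a (sum f A) = (\<Sum>i\<in>A. alt_wedge a (f i))"
  by (induction A rule: infinite_finite_induct) (simp_all only: sum.infinite sum.empty sum.insert simp_thms wedge_zero_right wedge_add_right)

lemmas wedge_linear = wedge_add_left wedge_add_right wedge_smul_left wedge_smul_right wedge_diff_left wedge_diff_right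
  wedge_uminus_left wedge_uminus_right wedge_zero_left wedge_zero_right

text \<open>The product at a list only evaluates its factors on shorter lists. This allows the
  length-dependent cut-off of an exponential to be replaced by a fixed one inside a product.\<close>

lemma alt_wedge_cong:
  assumes "\<And>us. length us \<le> length vs \<Longrightarrow> a us = a' us" "\<And>us. length us \<le> length vs \<Longrightarrow> b us = b' us"
  shows "alt_wedge a b vs = alt_wedge a' b' vs"
  using assms
proof (induction vs arbitrary: a b a' b')
  case (Cons v vs)
  have "alt_wedge (\<lambda>ws. a (v # ws)) b vs = alt_wedge (\<lambda>ws. a' (v # ws)) b' vs"
    by (rule Cons.IH) (use Cons.prems in auto)
  moreover have "alt_wedge (\<lambda>ws. (-1) ^ length ws * a ws) (\<lambda>ws. b (v # ws)) vs
      = alt_wedge (\<lambda>ws. (-1) ^ length ws * a' ws) (\<lambda>ws. b' (v # ws)) vs"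
    by (rule Cons.IH) (use Cons.prems in auto)
  ultimately show ?case by simp
qed auto

lemma hat_hat [simp]: "hat (hat a) = a"
  by (simp add: hat_def fun_eq_iff flip: power_add mult.assoc)

lemma hat_Cons: "(\<lambda>ws. hat a (v # ws)) = - hat (\<lambda>ws. a (v # ws))"
  by (simp add: hat_def fun_eq_iff)

lemma hat_add: "hat (a + b) = hat a + hat b"
  by (simp add: hat_def fun_eq_iff algebra_simps)

lemma hat_degree_form: "degree_form k a \<Longrightarrow> hat a = smul ((-1) ^ k) a"
  by (force simp: hat_def degree_form_def smul_def fun_eq_iff)

lemma hat_wedge: "hat (alt_wedge a b) = alt_wedge (hat a) (hat b)"
proof
  fix vs
  show "hat (alt_wedge a b) vs = alt_wedge (hat a) (hat b) vs"
  proof (induction vs arbitrary: a b)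
    case (Cons v vs)
    have "hat (alt_wedge a b) (v # vs) = - hat (\<lambda>ws. alt_wedge a b (v # ws)) vs"
      using hat_Cons[of "alt_wedge a b" v] by (simp add: fun_eq_iff)
    also have "\<dots> = alt_wedge (- hat (\<lambda>ws. a (v # ws))) (hat b) vs
        + alt_wedge (hat (hat a)) (- hat (\<lambda>ws. b (v # ws))) vs"
      by (simp only: alt_wedge_Cons hat_add plus_fun_apply Cons.IH wedge_linear uminus_apply) simp
    also have "\<dots> = alt_wedge (hat a) (hat b) (v # vs)"
      using fun_cong[OF alt_wedge_Cons[of "hat a" "hat b" v], of vs] by (simp add: hat_Cons)
    finally show ?case .
  qed (simp add: hat_def)
qed

text \<open>Contraction with the first vector is an antiderivation for both bracketings, and the
  contracted identity is an instance of the induction hypothesis.\<close>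

lemma alt_wedge_assoc: "alt_wedge (alt_wedge a b) c = alt_wedge a (alt_wedge b c)"
proof
  fix vs
  show "alt_wedge (alt_wedge a b) c vs = alt_wedge a (alt_wedge b c) vs"
  proof (induction vs arbitrary: a b c)
    case (Cons v vs)
    have "alt_wedge (alt_wedge a b) c (v # vs) =
        alt_wedge (\<lambda>ws. alt_wedge a b (v # ws)) c vs
        + alt_wedge (hat (alt_wedge a b)) (\<lambda>ws. c (v # ws)) vs"
      by (simp add: hat_def)
    also have "\<dots> = alt_wedge (\<lambda>ws. a (v # ws)) (alt_wedge b c) vs
        + alt_wedge (hat a) (\<lambda>ws. alt_wedge b c (v # ws)) vs"
      by (simp only: alt_wedge_Cons hat_wedge wedge_linear plus_fun_apply Cons.IH add.assoc)
    also have "\<dots> = alt_wedge a (alt_wedge b c) (v # vs)"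
      by (simp add: hat_def)
    finally show ?case .
  qed simp
qed

lemma smul_1 [simp]: "smul 1 a = a"
  by (simp add: smul_def)

lemma wedge_unit_left [simp]: "alt_wedge unit_form b = b"
proof
  fix vs :: "'a list"
  show "alt_wedge unit_form b vs = b vs"
  proof (induction vs arbitrary: b)
    case (Cons v vs)
    have "hat unit_form = (unit_form :: 'a list \<Rightarrow> complex)" by (auto simp: hat_def unit_form_def fun_eq_iff)
    moreover have "(\<lambda>ws. unit_form (v # ws)) = 0" by (simp add: unit_form_def fun_eq_iff)
    ultimately have "(\<lambda>ws. alt_wedge unit_form b (v # ws)) = alt_wedge unit_form (\<lambda>ws. b (v # ws))"
      by (simp only: alt_wedge_Cons wedge_zero_left) simp
    from fun_cong[OF this, of vs] show ?case by (simp only: Cons.IH)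
  qed (simp add: unit_form_def)
qed

lemma wedge_unit_right [simp]: "alt_wedge b unit_form = b"
proof
  fix vs
  show "alt_wedge b unit_form vs = b vs"
  proof (induction vs arbitrary: b)
    case (Cons v vs)
    have "(\<lambda>ws. unit_form (v # ws)) = 0" by (simp add: unit_form_def fun_eq_iff)
    then show ?case using fun_cong[OF alt_wedge_Cons[of b unit_form v], of vs]
      by (simp add: wedge_zero_right Cons.IH)
  qed (simp add: unit_form_def)
qed

lemma degree_form_Cons: "degree_form 1 l \<Longrightarrow> (\<lambda>ws. l (v # ws)) = smul (l [v]) unit_form"
  by (auto simp: degree_form_def smul_def unit_form_def fun_eq_iff)

text \<open>Graded commutativity with one factor of degree one; for a second factor of mixed degree the
  sign becomes the grading involution.\<close>

lemma one_form_commute: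
  assumes "degree_form 1 l"
  shows "alt_wedge l b = alt_wedge (hat b) l"
proof
  fix vs
  show "alt_wedge l b vs = alt_wedge (hat b) l vs"
  proof (induction vs arbitrary: b)
    case Nil
    then show ?case using assms by (simp add: degree_form_def)
  next
    case (Cons v vs)
    have l: "(\<lambda>ws. l (v # ws)) = smul (l [v]) unit_form" "hat l = smul (-1) l"
      using degree_form_Cons[OF assms] hat_degree_form[OF assms] by simp_all
    have "alt_wedge l b (v # vs) = smul (l [v]) b vs - alt_wedge l (\<lambda>ws. b (v # ws)) vs"
      using fun_cong[OF alt_wedge_Cons[of l b v], of vs]
      by (simp add: l wedge_linear) (simp add: smul_def)
    also have "\<dots> = alt_wedge (hat b) l (v # vs)"
      using fun_cong[OF alt_wedge_Cons[of "hat b" l v], of vs]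
      by (simp add: l hat_Cons wedge_linear Cons.IH)
    finally show ?case .
  qed
qed

definition cov :: "('v \<Rightarrow> complex) \<Rightarrow> 'v list \<Rightarrow> complex" where
  "cov f vs = (case vs of [v] \<Rightarrow> f v | _ \<Rightarrow> 0)"

lemma degree_cov: "degree_form 1 (cov f)"
  by (auto simp: degree_form_def cov_def split: list.splits)

lemma cov_simps [simp]: "cov f [] = 0" "cov f [v] = f v" "cov f (v # w # vs) = 0"
  by (simp_all add: cov_def)

lemma cov_map: "(\<lambda>vs. cov f (map g vs)) = cov (\<lambda>v. f (g v))"
  by (auto simp: cov_def fun_eq_iff split: list.splits)

lemma cov_smul: "cov (\<lambda>v. c * f v) = smul c (cov f)"
  by (auto simp: cov_def smul_def fun_eq_iff split: list.splits)

lemma cov_add: "cov (\<lambda>v. f v + g v) = cov f + cov g"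
  by (auto simp: cov_def fun_eq_iff split: list.splits)

lemma cov_uminus: "cov (\<lambda>v. - f v) = - cov f"
  by (auto simp: cov_def fun_eq_iff split: list.splits)

lemma cov_wedge_cov:
  "alt_wedge (cov f) (cov g) vs = (case vs of [v, w] \<Rightarrow> f v * g w - f w * g v | _ \<Rightarrow> 0)"
proof -
  have *: "(\<lambda>ws. cov h (v # ws)) = smul (h v) unit_form" for h :: "'a \<Rightarrow> complex" and v
    using degree_form_Cons[OF degree_cov, of h v] by simp
  have h: "hat (cov f) = smul (-1) (cov f)"
    using hat_degree_form[OF degree_cov, of f] by simp
  show ?thesis
  proof (cases vs)
    case (Cons v ws)
    have "alt_wedge (cov f) (cov g) (v # ws) = f v * cov g ws - g v * cov f ws"
      using fun_cong[OF alt_wedge_Cons[of "cov f" "cov g" v], of ws]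
      by (simp add: * h wedge_linear) (simp add: smul_def)
    then show ?thesis by (auto simp: Cons cov_def split: list.splits)
  qed simp
qed

lemma cov_swap: "alt_wedge (cov f) (cov g) = - alt_wedge (cov g) (cov f)"
  by (auto simp: fun_eq_iff cov_wedge_cov split: list.splits)

lemma cov_swap': "alt_wedge (cov f) (alt_wedge (cov g) b) = - alt_wedge (cov g) (alt_wedge (cov f) b)"
  by (simp only: alt_wedge_assoc[symmetric] cov_swap[of f g] wedge_linear)

lemma cov_square: "alt_wedge (cov f) (cov f) = 0"
  by (auto simp: fun_eq_iff cov_wedge_cov split: list.splits)

lemma cov_square': "alt_wedge (cov f) (alt_wedge (cov f) b) = 0"
  by (simp only: alt_wedge_assoc[symmetric] cov_square wedge_linear)

lemma cov_absorb:
  "alt_wedge (cov f) (alt_wedge (cov g) (alt_wedge (cov h) (cov f))) = 0"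
  by (simp only: cov_swap[of h f] cov_swap'[of g f] wedge_linear cov_square') simp

text \<open>Expansion along the first factor; this is the formula for the exterior derivative of a
  constant form multiplied by a function with differential \<open>f\<close>.\<close>

lemma cov_wedge:
  "alt_wedge (cov f) b vs =
     (\<Sum>i<length vs. (-1) ^ i * f (vs ! i) * b (take i vs @ drop (Suc i) vs))"
proof (induction vs arbitrary: b)
  case (Cons v vs)
  have "alt_wedge (cov f) b (v # vs) = f v * b vs - alt_wedge (cov f) (\<lambda>ws. b (v # ws)) vs"
    using fun_cong[OF alt_wedge_Cons[of "cov f" b v], of vs] degree_form_Cons[OF degree_cov, of f v]
      hat_degree_form[OF degree_cov, of f]
    by (simp add: wedge_linear) (simp add: smul_def)
  also have "\<dots> = (\<Sum>i<length (v # vs). (-1) ^ i * f ((v # vs) ! i) *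
      b (take i (v # vs) @ drop (Suc i) (v # vs)))"
    by (simp add: Cons.IH sum.lessThan_Suc_shift sum_negf del: sum.lessThan_Suc)
  finally show ?case .
qed simp

text \<open>Alternation is required for adjacent vectors only, because an adjacent swap inside a list is
  compatible with the recursion of \<open>alt_wedge\<close>; vanishing on arbitrary repetitions follows.\<close>

definition alt_form :: "nat \<Rightarrow> ('v::real_vector list \<Rightarrow> complex) \<Rightarrow> bool" where
  "alt_form k a \<longleftrightarrow> degree_form k a \<and> (\<forall>us ws. linear (\<lambda>v. a (us @ v # ws))) \<and>
     (\<forall>us v w ws. a (us @ v # w # ws) = - a (us @ w # v # ws))"

text \<open>Adjacent swaps move the two equal vectors next to each other, where antisymmetry gives
  \<open>x = - x\<close>.\<close>

lemma alt_form_repeat: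
  assumes "alt_form k a"
  shows "a (us @ v # ws @ v # zs) = 0"
proof (induction ws arbitrary: us)
  case Nil
  have "a (us @ v # v # zs) = - a (us @ v # v # zs)"
    using assms unfolding alt_form_def by blast
  then show ?case by simp
next
  case (Cons w ws)
  have "a (us @ v # w # ws @ v # zs) = - a ((us @ [w]) @ v # ws @ v # zs)"
    using assms unfolding alt_form_def by (metis append.assoc append_Cons append_Nil)
  then show ?case using Cons.IH[of "us @ [w]"] by simp
qed

lemma degree_form_wedge:
  assumes "degree_form j a" "degree_form k b"
  shows "degree_form (j + k) (alt_wedge a b)"
  unfolding degree_form_def
proof (intro allI impI)
  fix vs :: "'a list"
  assume "length vs \<noteq> j + k"
  then show "alt_wedge a b vs = 0"
    using assms
  proof (induction vs arbitrary: a b j k)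
    case Nil
    then show ?case by (auto simp: degree_form_def)
  next
    case (Cons v vs)
    have 1: "alt_wedge (\<lambda>ws. a (v # ws)) b vs = 0"
    proof (cases j)
      case 0
      then have "(\<lambda>ws. a (v # ws)) = 0" using Cons.prems by (auto simp: degree_form_def fun_eq_iff)
      then show ?thesis by (simp add: wedge_zero_left)
    next
      case (Suc j')
      show ?thesis by (rule Cons.IH[of j' k]) (use Suc Cons.prems in \<open>auto simp: degree_form_def\<close>)
    qed
    have 2: "alt_wedge (\<lambda>ws. (-1) ^ length ws * a ws) (\<lambda>ws. b (v # ws)) vs = 0"
    proof (cases k)
      case 0
      then have "(\<lambda>ws. b (v # ws)) = 0" using Cons.prems by (auto simp: degree_form_def fun_eq_iff)
      then show ?thesis by (simp add: wedge_zero_right)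
    next
      case (Suc k')
      show ?thesis by (rule Cons.IH[of j k']) (use Suc Cons.prems in \<open>auto simp: degree_form_def\<close>)
    qed
    show ?case by (simp add: 1 2)
  qed
qed

lemma alt_wedge_linear:
  assumes "\<And>us ws. linear (\<lambda>v. a (us @ v # ws))" "\<And>us ws. linear (\<lambda>v. b (us @ v # ws))"
  shows "linear (\<lambda>v. alt_wedge a b (us @ v # ws))"
  using assms
proof (induction us arbitrary: a b)
  case Nil
  have a: "linear (\<lambda>v. a (v # ws))" and b: "linear (\<lambda>v. b (v # ws))" for ws
    using Nil(1)[of "[]"] Nil(2)[of "[]"] by simp_all
  show ?case
    by (rule linearI)
      (simp_all add: linear_add[OF a] linear_add[OF b] linear_scale[OF a] linear_scale[OF b]
        scaleR_conv_of_real alt_wedge_add_left alt_wedge_add_right alt_wedge_mult_left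
        alt_wedge_mult_right algebra_simps)
next
  case (Cons u us)
  have "linear (\<lambda>v. alt_wedge (\<lambda>ws. a (u # ws)) b (us @ v # ws))"
    by (rule Cons.IH) (use Cons.prems(1)[of "u # us" for us] Cons.prems(2) in simp_all)
  moreover have "linear (\<lambda>v. alt_wedge (\<lambda>ws. (-1) ^ length ws * a ws) (\<lambda>ws. b (u # ws)) (us @ v # ws))"
  proof (rule Cons.IH)
    fix us ws
    show "linear (\<lambda>v. (-1) ^ length (us @ v # ws) * a (us @ v # ws))"
      using linear_compose[OF Cons.prems(1)[of us ws], of "\<lambda>x. (-1) ^ length (us @ undefined # ws) * x"]
      by (simp add: o_def linear_iff algebra_simps)
  qed (use Cons.prems(2)[of "u # us" for us] in simp)
  ultimately show ?case by (simp add: linear_compose_add)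
qed

lemma alt_wedge_swap:
  assumes "\<And>us v w ws. a (us @ v # w # ws) = - a (us @ w # v # ws)"
    and "\<And>us v w ws. b (us @ v # w # ws) = - b (us @ w # v # ws)"
  shows "alt_wedge a b (us @ v # w # ws) = - alt_wedge a b (us @ w # v # ws)"
  using assms
proof (induction us arbitrary: a b)
  case Nil
  have a: "(\<lambda>ws. a (v # w # ws)) = - (\<lambda>ws. a (w # v # ws))"
    and b: "(\<lambda>ws. b (v # w # ws)) = - (\<lambda>ws. b (w # v # ws))"
    using Nil(1)[of "[]" v w] Nil(2)[of "[]" v w] by (auto simp: fun_eq_iff)
  have *: "(\<lambda>us. (-1) ^ length us * ((-1) ^ length us * a us)) = a"
    by (simp add: fun_eq_iff flip: power_add mult.assoc)
  have **: "alt_wedge (\<lambda>ws. - ((- 1) ^ length ws * a (x # ws))) c vs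
     = - alt_wedge (\<lambda>ws. ((- 1) ^ length ws * a (x # ws))) c vs" for x c vs
    using alt_wedge_mult_left[of "-1"] by simp
  show ?case
    by (simp add: a b * ** wedge_linear)
next
  case (Cons u us)
  have "alt_wedge (\<lambda>ws. a (u # ws)) b (us @ v # w # ws)
      = - alt_wedge (\<lambda>ws. a (u # ws)) b (us @ w # v # ws)"
    by (rule Cons.IH) (metis Cons.prems append_Cons)+
  moreover have "alt_wedge (\<lambda>ws. (-1) ^ length ws * a ws) (\<lambda>ws. b (u # ws)) (us @ v # w # ws)
      = - alt_wedge (\<lambda>ws. (-1) ^ length ws * a ws) (\<lambda>ws. b (u # ws)) (us @ w # v # ws)"
  proof (rule Cons.IH)
    fix us v w ws
    show "(-1) ^ length (us @ v # w # ws) * a (us @ v # w # ws)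
        = - ((-1) ^ length (us @ w # v # ws) * a (us @ w # v # ws))"
      using Cons.prems(1)[of us v w ws] by simp
    show "b (u # us @ v # w # ws) = - b (u # us @ w # v # ws)"
      using Cons.prems(2)[of "u # us" v w ws] by simp
  qed
  ultimately show ?case by simp
qed

lemma alt_form_wedge:
  assumes "alt_form j a" "alt_form k b"
  shows "alt_form (j + k) (alt_wedge a b)"
  unfolding alt_form_def
proof (intro conjI allI)
  show "degree_form (j + k) (alt_wedge a b)"
    using assms by (intro degree_form_wedge) (simp_all add: alt_form_def)
  show "linear (\<lambda>v. alt_wedge a b (us @ v # ws))" for us ws
    using assms by (intro alt_wedge_linear) (simp_all add: alt_form_def)
  show "alt_wedge a b (us @ v # w # ws) = - alt_wedge a b (us @ w # v # ws)" for us v w ws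
  proof (rule alt_wedge_swap)
    show "a (us @ v # w # ws) = - a (us @ w # v # ws)" for us v w ws
      using assms(1) unfolding alt_form_def by blast
    show "b (us @ v # w # ws) = - b (us @ w # v # ws)" for us v w ws
      using assms(2) unfolding alt_form_def by blast
  qed
qed

lemma alt_form_cov:
  assumes "linear f"
  shows "alt_form 1 (cov f)"
  unfolding alt_form_def
proof (intro conjI allI)
  show "linear (\<lambda>v. cov f (us @ v # ws))" for us ws
  proof (cases "us = [] \<and> ws = []")
    case False
    then have "cov f (us @ v # ws) = 0" for v
      using degree_cov[of f] by (force simp: degree_form_def)
    then show ?thesis by (simp add: linear_iff)
  qed (use assms in simp)
  show "cov f (us @ v # w # ws) = - cov f (us @ w # v # ws)" for us v w ws
    using degree_cov[of f] by (force simp: degree_form_def)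
qed (rule degree_cov)

lemma alt_form_add:
  assumes "alt_form k a" "alt_form k b"
  shows "alt_form k (a + b)"
  unfolding alt_form_def
proof (intro conjI allI)
  show "linear (\<lambda>v. (a + b) (us @ v # ws))" for us ws
    using assms by (auto simp: alt_form_def intro: linear_compose_add)
  show "(a + b) (us @ v # w # ws) = - (a + b) (us @ w # v # ws)" for us v w ws
  proof -
    have "a (us @ v # w # ws) = - a (us @ w # v # ws)" "b (us @ v # w # ws) = - b (us @ w # v # ws)"
      using assms unfolding alt_form_def by blast+
    then show ?thesis by simp
  qed
qed (use assms in \<open>simp add: alt_form_def degree_form_def\<close>)

lemma alt_form_smul:
  assumes "alt_form k a"
  shows "alt_form k (smul c a)"
  unfolding alt_form_def
proof (intro conjI allI)
  show "linear (\<lambda>v. smul c a (us @ v # ws))" for us ws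
    using assms unfolding alt_form_def smul_def
    by (auto simp: linear_iff distrib_left)
  show "smul c a (us @ v # w # ws) = - smul c a (us @ w # v # ws)" for us v w ws
  proof -
    have "a (us @ v # w # ws) = - a (us @ w # v # ws)"
      using assms unfolding alt_form_def by blast
    then show ?thesis by (simp add: smul_def)
  qed
qed (use assms in \<open>simp add: alt_form_def degree_form_def smul_def\<close>)

lemma alt_form_uminus: "alt_form k a \<Longrightarrow> alt_form k (- a)"
  using alt_form_smul[of k a "-1"] by (simp add: smul_def fun_Compl_def)

lemma alt_form_diff: "alt_form k a \<Longrightarrow> alt_form k b \<Longrightarrow> alt_form k (a - b)"
  unfolding diff_conv_add_uminus by (intro alt_form_add alt_form_uminus)

lemma alt_form_0: "alt_form k 0"
  by (simp add: alt_form_def degree_form_def linear_iff)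

lemma alt_form_cov2:
  assumes "linear f" "linear g"
  shows "alt_form 2 (alt_wedge (cov f) (cov g))"
  using alt_form_wedge[OF alt_form_cov[OF assms(1)] alt_form_cov[OF assms(2)]]
  by (simp only: one_add_one)

lemma alt_form_cov3:
  assumes "linear f" "linear g" "linear h"
  shows "alt_form 3 (alt_wedge (cov f) (alt_wedge (cov g) (cov h)))"
proof -
  have "(1::nat) + 2 = 3" by simp
  then show ?thesis
    using alt_form_wedge[OF alt_form_cov[OF assms(1)] alt_form_cov2[OF assms(2,3)]] by (simp only:)
qed

section \<open>Smoothness and the exterior derivative\<close>

lemma Ck_const: "Ck n (\<lambda>_. c)"
  by (induction n arbitrary: c) simp_all

lemma frechet_derivative_affine:
  fixes L :: "'a::euclidean_space \<Rightarrow> 'b::real_normed_vector"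
  assumes "linear L"
  shows "frechet_derivative (\<lambda>x. L x + b) (at x) = L"
proof -
  have "((\<lambda>x. L x + b) has_derivative L) (at x)"
    using assms by (auto intro!: derivative_eq_intros bounded_linear_imp_has_derivative
        simp: linear_conv_bounded_linear)
  then show ?thesis by (metis frechet_derivative_at)
qed

lemma smooth_affine:
  fixes L :: "'a::euclidean_space \<Rightarrow> 'b::real_normed_vector"
  assumes "linear L"
  shows "smooth (\<lambda>x. L x + b)"
  unfolding smooth_def
proof
  fix n
  have d: "((\<lambda>x. L x + b) has_derivative L) (at x)" for x
    using assms by (auto intro!: derivative_eq_intros bounded_linear_imp_has_derivative
        simp: linear_conv_bounded_linear)
  show "Ck n (\<lambda>x. L x + b)"
  proof (cases n)
    case 0
    then show ?thesis
      using assms linear_continuous_on[of L UNIV]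
      by (auto intro!: continuous_on_add simp: linear_conv_bounded_linear)
  next
    case (Suc m)
    have "(\<lambda>x. L x + b) differentiable (at x)" for x
      using d unfolding differentiable_def by blast
    then show ?thesis by (simp add: Suc frechet_derivative_affine[OF assms] Ck_const)
  qed
qed

lemma frechet_derivative_linear:
  fixes L :: "'a::euclidean_space \<Rightarrow> 'b::real_normed_vector"
  assumes "linear L"
  shows "frechet_derivative L (at x) = L"
  using frechet_derivative_affine[OF assms, of 0] by simp

lemma smooth_linear:
  fixes L :: "'a::euclidean_space \<Rightarrow> 'b::real_normed_vector"
  assumes "linear L"
  shows "smooth L"
  using smooth_affine[OF assms, of 0] by simp

text \<open>The Hermitian form, its square, the volume form, the symplectic form and the mirror 3-form
  all have this shape. It is stable under directional derivatives, which gives smoothness by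
  induction.\<close>

definition expo_form ::
    "(C3 list \<Rightarrow> complex) \<Rightarrow> (C3 list \<Rightarrow> complex) \<Rightarrow> (C3 list \<Rightarrow> complex) \<Rightarrow> C3 form" where
  "expo_form a b c z = a + smul (complex_of_real (exp (- 2 * Re (z $ 1)))) b
     + smul (complex_of_real (exp (2 * Re (z $ 1)))) c"

lemma expo_form_apply:
  "expo_form a b c z vs = a vs + complex_of_real (exp (- 2 * Re (z $ 1))) * b vs
     + complex_of_real (exp (2 * Re (z $ 1))) * c vs"
  by (simp add: expo_form_def smul_def)

lemma expo_has_derivative:
  "((\<lambda>z::C3. a + complex_of_real (exp (- 2 * Re (z $ 1))) * b + complex_of_real (exp (2 * Re (z $ 1))) * c)
     has_derivative (\<lambda>v. 0 + complex_of_real (exp (- 2 * Re (z $ 1))) * (- 2 * complex_of_real (Re (v $ 1)) * b)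
       + complex_of_real (exp (2 * Re (z $ 1))) * (2 * complex_of_real (Re (v $ 1)) * c))) (at z)"
  by (auto intro!: derivative_eq_intros bounded_linear_imp_has_derivative
      bounded_linear_Re bounded_linear_vec_nth simp: fun_eq_iff algebra_simps)

lemma expo_frechet_derivative:
  "frechet_derivative (\<lambda>z::C3. a + complex_of_real (exp (- 2 * Re (z $ 1))) * b
      + complex_of_real (exp (2 * Re (z $ 1))) * c) (at z) =
   (\<lambda>v. 0 + complex_of_real (exp (- 2 * Re (z $ 1))) * (- 2 * complex_of_real (Re (v $ 1)) * b)
       + complex_of_real (exp (2 * Re (z $ 1))) * (2 * complex_of_real (Re (v $ 1)) * c))"
  using frechet_derivative_at[OF expo_has_derivative] by metis

lemma Ck_expo:
  "Ck n (\<lambda>z::C3. a + complex_of_real (exp (- 2 * Re (z $ 1))) * b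
      + complex_of_real (exp (2 * Re (z $ 1))) * c)"
proof (induction n arbitrary: a b c)
  case 0
  then show ?case by (auto intro!: continuous_intros)
next
  case (Suc n)
  have "(\<lambda>z::C3. a + complex_of_real (exp (- 2 * Re (z $ 1))) * b
      + complex_of_real (exp (2 * Re (z $ 1))) * c) differentiable (at z)" for z
    using expo_has_derivative unfolding differentiable_def by blast
  then show ?case
    unfolding Ck.simps expo_frechet_derivative using Suc.IH by blast
qed

definition dz :: "3 \<Rightarrow> C3 \<Rightarrow> complex" where "dz j v = v $ j"
definition dzbar :: "3 \<Rightarrow> C3 \<Rightarrow> complex" where "dzbar j v = cnj (v $ j)"
definition dx :: "3 \<Rightarrow> C3 \<Rightarrow> complex" where "dx j v = complex_of_real (Re (v $ j))"
definition dy :: "3 \<Rightarrow> C3 \<Rightarrow> complex" where "dy j v = complex_of_real (Im (v $ j))"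

text \<open>The coefficients depend on \<open>Re z\<^sub>1\<close> only, so the exterior derivative is a wedge product with
  \<open>dx\<^sub>1\<close>.\<close>

lemma ext_d_expo_form:
  "ext_d (expo_form a b c) = expo_form 0 (smul (-2) (alt_wedge (cov (dx 1)) b)) (smul 2 (alt_wedge (cov (dx 1)) c))"
proof (intro ext)
  fix z :: C3 and vs :: "C3 list"
  let ?us = "\<lambda>i. take i vs @ drop (Suc i) vs"
  have "ext_d (expo_form a b c) z vs = (\<Sum>i<length vs. (-1) ^ i *
      (complex_of_real (exp (- 2 * Re (z $ 1))) * (- 2 * complex_of_real (Re ((vs ! i) $ 1)) * b (?us i))
       + complex_of_real (exp (2 * Re (z $ 1))) * (2 * complex_of_real (Re ((vs ! i) $ 1)) * c (?us i))))"
    unfolding ext_d_def expo_form_apply expo_frechet_derivative by simp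
  also have "\<dots> = expo_form 0 (smul (-2) (alt_wedge (cov (dx 1)) b)) (smul 2 (alt_wedge (cov (dx 1)) c)) z vs"
    by (simp add: expo_form_apply smul_def cov_wedge dx_def sum_distrib_left
        algebra_simps flip: sum.distrib sum_subtractf)
  finally show "ext_d (expo_form a b c) z vs = \<dots>" .
qed

text \<open>The criterion behind every proof of closedness below: the coefficients of the
  two exponentials are annihilated by \<open>dx\<^sub>1\<close>.\<close>

lemma closed_expo_form:
  assumes "alt_wedge (cov (dx 1)) b = 0" "alt_wedge (cov (dx 1)) c = 0"
  shows "closed_form (expo_form a b c)"
  by (simp add: closed_form_def ext_d_expo_form assms) (simp add: fun_eq_iff expo_form_apply smul_def)

lemma diff_form_expo_form:
  assumes "alt_form k a" "alt_form k b" "alt_form k c"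
  shows "diff_form k (expo_form a b c)"
  unfolding diff_form_def
proof (intro conjI allI impI)
  fix z :: C3 and us ws zs :: "C3 list" and v :: C3
  have z: "alt_form k (expo_form a b c z)"
    unfolding expo_form_def by (intro alt_form_add alt_form_smul assms)
  show "smooth (\<lambda>x. expo_form a b c x us)"
    unfolding smooth_def expo_form_apply using Ck_expo by blast
  show "length us \<noteq> k \<Longrightarrow> expo_form a b c z us = 0"
    using z by (simp add: alt_form_def degree_form_def)
  show "linear (\<lambda>v. expo_form a b c z (us @ v # ws))"
    using z by (simp add: alt_form_def)
  show "expo_form a b c z (us @ v # ws @ v # zs) = 0"
    by (rule alt_form_repeat[OF z])
qed

section \<open>The Nakamura forms in coordinates\<close>

lemma dfun_linear_cov:
  fixes l :: "'a::euclidean_space \<Rightarrow> complex"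
  shows "linear l \<Longrightarrow> dfun l x = cov l"
  by (rule ext) (simp add: dfun_linear cov_def)

lemma fun_form_eq: "fun_form f x = smul (f x) unit_form"
  by (auto simp: fun_form_def smul_def unit_form_def fun_eq_iff)

lemma linear_coordinates: "linear (dz j)" "linear (dzbar j)" "linear (dx j)" "linear (dy j)"
  by (auto intro!: linearI simp: dz_def dzbar_def dx_def dy_def complex_eq_iff)

lemma cov_dx: "cov (dx j) = smul (1/2) (cov (dz j) + cov (dzbar j))"
  unfolding cov_add[symmetric] cov_smul[symmetric]
  by (rule arg_cong[of _ _ cov]) (auto simp: fun_eq_iff dx_def dz_def dzbar_def complex_eq_iff)

lemma phi1_eq: "phi1 z = cov (dz 1)"
  using dfun_linear_cov[OF linear_coordinates(1), of 1 z] by (simp add: phi1_def dz_def[abs_def])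

lemma phi2_eq: "phi2 z = smul (exp (- z $ 1)) (cov (dz 2))"
  using dfun_linear_cov[OF linear_coordinates(1), of 2 z]
  by (simp add: phi2_def dz_def[abs_def] wedge_def fun_form_eq wedge_smul_left)

lemma phi3_eq: "phi3 z = smul (exp (z $ 1)) (cov (dz 3))"
  using dfun_linear_cov[OF linear_coordinates(1), of 3 z]
  by (simp add: phi3_def dz_def[abs_def] wedge_def fun_form_eq wedge_smul_left)

lemma cnj_form_cov: "\<alpha> z = smul c (cov (dz j)) \<Longrightarrow> cnj_form \<alpha> z = smul (cnj c) (cov (dzbar j))"
  by (auto simp: cnj_form_def fun_eq_iff smul_def cov_def dz_def dzbar_def split: list.splits)

definition kform :: "3 \<Rightarrow> C3 list \<Rightarrow> complex" where
  "kform j = alt_wedge (cov (dz j)) (cov (dzbar j))"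

lemma exp_mult_cnj_exp: "exp z * cnj (exp z) = complex_of_real (exp (2 * Re z))"
  by (simp add: exp_cnj flip: exp_add exp_of_real) (simp add: complex_add_cnj exp_of_real)

lemma nakamura_omega_eq:
  "nakamura_omega = expo_form (smul (\<i>/2) (kform 1)) (smul (\<i>/2) (kform 2)) (smul (\<i>/2) (kform 3))"
proof
  fix z
  have c: "cnj_form phi1 z = cov (dzbar 1)" "cnj_form phi2 z = smul (cnj (exp (- z $ 1))) (cov (dzbar 2))"
    "cnj_form phi3 z = smul (cnj (exp (z $ 1))) (cov (dzbar 3))"
    using cnj_form_cov[of phi1 z 1 1] cnj_form_cov[of phi2 z _ 2] cnj_form_cov[of phi3 z _ 3]
    by (simp_all add: phi1_eq phi2_eq phi3_eq)
  have e: "exp (- z $ 1) * cnj (exp (- z $ 1)) = complex_of_real (exp (- 2 * Re (z $ 1)))"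
    "exp (z $ 1) * cnj (exp (z $ 1)) = complex_of_real (exp (2 * Re (z $ 1)))"
    using exp_mult_cnj_exp[of "- z $ 1"] exp_mult_cnj_exp[of "z $ 1"] by simp_all
  have "(phi1 \<and>\<^sub>d cnj_form phi1) z = kform 1"
    by (simp add: wedge_def phi1_eq c kform_def)
  moreover have "(phi2 \<and>\<^sub>d cnj_form phi2) z = smul (complex_of_real (exp (- 2 * Re (z $ 1)))) (kform 2)"
    by (simp only: wedge_def phi2_eq c kform_def wedge_smul_left wedge_smul_right smul_smul e mult.commute[of "cnj _"])
  moreover have "(phi3 \<and>\<^sub>d cnj_form phi3) z = smul (complex_of_real (exp (2 * Re (z $ 1)))) (kform 3)"
    by (simp only: wedge_def phi3_eq c kform_def wedge_smul_left wedge_smul_right smul_smul e mult.commute[of "cnj _"])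
  ultimately show "nakamura_omega z = expo_form (smul (\<i>/2) (kform 1)) (smul (\<i>/2) (kform 2)) (smul (\<i>/2) (kform 3)) z"
    by (simp add: fun_eq_iff nakamura_omega_def fscale_def expo_form_apply smul_def algebra_simps)
qed

lemma kform_apply: "kform j vs = (case vs of [v, w] \<Rightarrow> v $ j * cnj (w $ j) - w $ j * cnj (v $ j) | _ \<Rightarrow> 0)"
  by (simp add: kform_def cov_wedge_cov dz_def dzbar_def mult.commute split: list.splits)

lemma alt_form_kform: "alt_form 2 (kform j)"
  unfolding kform_def by (intro alt_form_cov2 linear_coordinates)

lemma nakamura_Omega_eq:
  "nakamura_Omega = expo_form (alt_wedge (cov (dz 1)) (alt_wedge (cov (dz 2)) (cov (dz 3)))) 0 0"
  by (simp add: fun_eq_iff nakamura_Omega_def wedge_def phi1_eq phi2_eq phi3_eq wedge_linear expo_form_apply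
      smul_smul flip: exp_add)

text \<open>The symplectic form has constant coefficients: multiplication of \<open>dz\<^sub>2\<close> by \<open>exp (- z\<^sub>1)\<close> and of
  \<open>dz\<^sub>3\<close> by \<open>exp z\<^sub>1\<close> scales by inverse factors and rotates by opposite angles, and the expression
  \<open>dx\<^sub>3 \<and> dy\<^sub>2 - dx\<^sub>2 \<and> dy\<^sub>3\<close> is invariant under both.\<close>

lemma mirror_omega_eq:
  "mirror_omega = expo_form (alt_wedge (cov (dx 1)) (cov (dy 1))
     + alt_wedge (cov (dx 3)) (cov (dy 2)) - alt_wedge (cov (dx 2)) (cov (dy 3))) 0 0"
proof (intro ext)
  fix z :: C3 and vs :: "C3 list"
  define x y where "x = Re (z $ 1)" and "y = Im (z $ 1)"
  have z: "z $ 1 = Complex x y" by (simp add: x_def y_def)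
  have p1: "Re_form phi1 z = cov (dx 1)" "Im_form phi1 z = cov (dy 1)"
    by (auto simp: Re_form_def Im_form_def phi1_eq fun_eq_iff cov_def dz_def dx_def dy_def split: list.splits)
  have p2: "Re_form phi2 z = cov (\<lambda>v. exp (- x) * (cos y * dx 2 v + sin y * dy 2 v))"
    "Im_form phi2 z = cov (\<lambda>v. exp (- x) * (cos y * dy 2 v - sin y * dx 2 v))"
    by (auto simp: Re_form_def Im_form_def phi2_eq fun_eq_iff cov_def dz_def dx_def dy_def
        smul_def z Re_exp Im_exp exp_of_real algebra_simps simp flip: exp_of_real split: list.splits)
  have p3: "Re_form phi3 z = cov (\<lambda>v. exp x * (cos y * dx 3 v - sin y * dy 3 v))"
    "Im_form phi3 z = cov (\<lambda>v. exp x * (cos y * dy 3 v + sin y * dx 3 v))"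
    by (auto simp: Re_form_def Im_form_def phi3_eq fun_eq_iff cov_def dz_def dx_def dy_def
        smul_def z Re_exp Im_exp exp_of_real algebra_simps simp flip: exp_of_real split: list.splits)
  show "mirror_omega z vs = expo_form (alt_wedge (cov (dx 1)) (cov (dy 1))
     + alt_wedge (cov (dx 3)) (cov (dy 2)) - alt_wedge (cov (dx 2)) (cov (dy 3))) 0 0 z vs"
  proof (cases "\<exists>v w. vs = [v, w]")
    case True
    then obtain v w where vs: "vs = [v, w]" by blast
    have e: "complex_of_real (exp (- x)) * complex_of_real (exp x) = 1"
      by (simp flip: of_real_mult exp_add)
    have cs: "complex_of_real (cos y) * complex_of_real (cos y) = 1 - complex_of_real (sin y) * complex_of_real (sin y)"
      using arg_cong[OF sin_cos_squared_add3[of y], of complex_of_real]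
      unfolding of_real_add of_real_mult of_real_1 by (simp only: eq_diff_eq)
    have *: "(E' * (C * a3 - S * b3)) * (E * (C * B2 - S * A2)) - (E' * (C * A3 - S * B3)) * (E * (C * b2 - S * a2))
       - ((E * (C * a2 + S * b2)) * (E' * (C * B3 + S * A3)) - (E * (C * A2 + S * B2)) * (E' * (C * b3 + S * a3)))
       = (a3 * B2 - A3 * b2) - (a2 * B3 - A2 * b3)"
      if "E * E' = 1" "C * C = 1 - S * S" for E E' C S a2 b2 a3 b3 A2 B2 A3 B3 :: complex
      using that by algebra
    show ?thesis
      using *[OF e cs, of "dx 3 v" "dy 3 v" "dy 2 w" "dx 2 w" "dx 3 w" "dy 3 w"
          "dy 2 v" "dx 2 v"]
      by (simp add: vs mirror_omega_def wedge_def p1 p2 p3 expo_form_apply cov_wedge_cov, algebra)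
  next
    case False
    then have "(case vs of [v, w] \<Rightarrow> f v w | _ \<Rightarrow> 0) = (0::complex)" for f
      by (auto split: list.splits)
    then show ?thesis
      by (simp add: mirror_omega_def wedge_def p1 p2 p3 expo_form_apply cov_wedge_cov)
  qed
qed

lemma closed_mirror_omega: "closed_form mirror_omega"
  unfolding mirror_omega_eq by (rule closed_expo_form) (simp_all only: wedge_linear)

lemma closed_nakamura_Omega: "closed_form nakamura_Omega"
  unfolding nakamura_Omega_eq by (rule closed_expo_form) (simp_all only: wedge_linear)

lemma kform_swap: "alt_wedge (kform i) (kform j) = alt_wedge (kform j) (kform i)"
proof -
  have h: "hat (kform j) = kform j"
    using alt_form_kform[of j] hat_degree_form[of 2 "kform j"] by (simp add: alt_form_def)
  show ?thesis
    unfolding kform_def[of i]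
    by (simp only: alt_wedge_assoc one_form_commute[OF degree_cov, of _ "kform j"] h)
      (simp only: alt_wedge_assoc[symmetric] one_form_commute[OF degree_cov, of _ "kform j"] h)
qed

lemma kform_square: "alt_wedge (kform j) (kform j) = 0"
  unfolding kform_def by (simp only: alt_wedge_assoc cov_swap'[of "dzbar j" "dz j"] cov_square cov_square' wedge_linear minus_zero)

text \<open>\<open>dx\<^sub>1\<close> is a combination of \<open>dz\<^sub>1\<close> and its conjugate, both of which divide \<open>kform 1\<close>.\<close>

lemma dx1_kform1: "alt_wedge (cov (dx 1)) (alt_wedge (kform 1) b) = 0"
proof -
  have "alt_wedge (cov (dzbar 1)) (alt_wedge (kform 1) b) = 0" "alt_wedge (cov (dz 1)) (alt_wedge (kform 1) b) = 0"
    by (simp_all only: kform_def alt_wedge_assoc cov_swap'[of "dzbar 1" "dz 1"] cov_square' wedge_linear)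
      (simp_all)
  then show ?thesis
    by (simp only: cov_dx wedge_linear) (simp add: smul_def fun_eq_iff)
qed

text \<open>The products with \<open>kform 1\<close> are killed by \<open>dx\<^sub>1\<close>; in the product of \<open>kform 2\<close> and \<open>kform 3\<close> the two
  exponential factors cancel.\<close>

lemma nakamura_omega_balanced: "closed_form (nakamura_omega \<and>\<^sub>d nakamura_omega)"
proof -
  have "(nakamura_omega \<and>\<^sub>d nakamura_omega) =
    expo_form (smul (-1/2) (alt_wedge (kform 2) (kform 3))) (smul (-1/2) (alt_wedge (kform 1) (kform 2)))
      (smul (-1/2) (alt_wedge (kform 1) (kform 3)))"
  proof
    fix z :: C3
    have e: "complex_of_real (exp (2 * Re (z $ 1))) * complex_of_real (exp (- (2 * Re (z $ 1)))) = 1"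
      by (simp flip: of_real_mult exp_add)
    show "(nakamura_omega \<and>\<^sub>d nakamura_omega) z = expo_form (smul (-1/2) (alt_wedge (kform 2) (kform 3)))
      (smul (-1/2) (alt_wedge (kform 1) (kform 2))) (smul (-1/2) (alt_wedge (kform 1) (kform 3))) z"
      unfolding wedge_def nakamura_omega_eq expo_form_def
      by (simp only: wedge_linear kform_square kform_swap[of 2 1] kform_swap[of 3 1] kform_swap[of 3 2])
        (use e in \<open>simp add: fun_eq_iff smul_def field_simps\<close>)
  qed
  then show ?thesis
    by (simp only:) (rule closed_expo_form; simp only: wedge_linear dx1_kform1; simp add: smul_def fun_eq_iff)
qed

text \<open>The derivative of the coefficient of \<open>kform 2\<close> in direction \<open>x\<^sub>1\<close> does not vanish.\<close>

lemma nakamura_omega_not_closed: "\<not> closed_form nakamura_omega"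
proof
  assume "closed_form nakamura_omega"
  then have "ext_d nakamura_omega 0 [axis 1 1, axis 2 1, axis 2 \<i>] = 0"
    by (simp add: closed_form_def)
  then show False
    unfolding nakamura_omega_eq ext_d_expo_form
    by (simp add: expo_form_apply smul_def cov_wedge kform_apply dx_def axis_def numeral_3_eq_3 wedge_linear)
qed

section \<open>The Fourier-Mukai transform of the exponential\<close>

text \<open>Contraction in the last slot, which is where fibre integration inserts the directions of
  the fibre.\<close>

definition rcontr :: "'v \<Rightarrow> ('v list \<Rightarrow> complex) \<Rightarrow> 'v list \<Rightarrow> complex" where
  "rcontr v a = (\<lambda>ws. a (ws @ [v]))"

lemma alt_wedge_snoc:
  "rcontr v (alt_wedge a b) = alt_wedge a (rcontr v b) + alt_wedge (rcontr v a) (hat b)"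
proof
  fix vs
  show "rcontr v (alt_wedge a b) vs = (alt_wedge a (rcontr v b) + alt_wedge (rcontr v a) (hat b)) vs"
  proof (induction vs arbitrary: a b)
    case Nil
    then show ?case by (simp add: rcontr_def hat_def)
  next
    case (Cons u us)
    have h: "rcontr v (hat a) = - hat (rcontr v a)"
      by (simp add: rcontr_def hat_def fun_eq_iff)
    have c: "rcontr v (\<lambda>ws. f (u # ws)) = (\<lambda>ws. rcontr v f (u # ws))" for f :: "'a list \<Rightarrow> complex"
      by (simp add: rcontr_def)
    have "rcontr v (alt_wedge a b) (u # us)
        = rcontr v (alt_wedge (\<lambda>ws. a (u # ws)) b) us + rcontr v (alt_wedge (hat a) (\<lambda>ws. b (u # ws))) us"
      by (simp add: rcontr_def hat_def)
    also have "\<dots> = (alt_wedge (\<lambda>ws. a (u # ws)) (rcontr v b)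
        + alt_wedge (\<lambda>ws. rcontr v a (u # ws)) (hat b)
        + alt_wedge (hat a) (\<lambda>ws. rcontr v b (u # ws))
        + alt_wedge (- hat (rcontr v a)) (hat (\<lambda>ws. b (u # ws)))) us"
      by (simp only: Cons.IH h c plus_fun_apply add.assoc)
    also have "\<dots> = ((\<lambda>ws. alt_wedge a (rcontr v b) (u # ws))
        + (\<lambda>ws. alt_wedge (rcontr v a) (hat b) (u # ws))) us"
      by (simp only: alt_wedge_Cons hat_Cons wedge_linear plus_fun_apply uminus_apply add.assoc add.left_commute)
    finally show ?case by simp
  qed
qed

primrec apow :: "('v list \<Rightarrow> complex) \<Rightarrow> nat \<Rightarrow> 'v list \<Rightarrow> complex" where
  "apow a 0 = unit_form"
| "apow a (Suc n) = alt_wedge a (apow a n)"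

definition aexp :: "('v list \<Rightarrow> complex) \<Rightarrow> 'v list \<Rightarrow> complex" where
  "aexp a vs = (\<Sum>k\<le>length vs. apow a k vs / fact k)"

lemma fpow_apow: "fpow \<alpha> n x = apow (\<alpha> x) n"
  by (induction n) (simp_all add: fun_form_eq wedge_def)

lemma fexp_aexp: "fexp \<alpha> x = aexp (\<alpha> x)"
  by (simp add: fun_eq_iff fexp_def aexp_def fpow_apow)

lemma degree_apow: "degree_form 2 a \<Longrightarrow> degree_form (2 * k) (apow a k)"
proof (induction k)
  case (Suc k)
  then show ?case using degree_form_wedge[of 2 a "2 * k" "apow a k"] by simp
qed (simp add: degree_form_def unit_form_def)

lemma hat_apow: "degree_form 2 a \<Longrightarrow> hat (apow a k) = apow a k"
  using hat_degree_form[OF degree_apow, of a k] by simp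

lemma hat_aexp: "degree_form 2 a \<Longrightarrow> hat (aexp a) = aexp a"
proof
  fix vs :: "'a list"
  assume "degree_form 2 a"
  then have "(-1) ^ length vs * apow a k vs = apow a k vs" for k
    using fun_cong[OF hat_apow, of a k vs] unfolding hat_def by blast
  then show "hat (aexp a) vs = aexp a vs"
    by (simp only: hat_def aexp_def sum_distrib_left times_divide_eq_right)
qed

lemma degree_rcontr: "degree_form (Suc k) a \<Longrightarrow> degree_form k (rcontr v a)"
  by (simp add: degree_form_def rcontr_def)

lemma even_commute: "degree_form 1 l \<Longrightarrow> hat b = b \<Longrightarrow> alt_wedge b l = alt_wedge l b"
  using one_form_commute[of l b] by simp

lemma rcontr_apow:
  assumes "degree_form 2 a"
  shows "rcontr v (apow a (Suc k)) = smul (of_nat (Suc k)) (alt_wedge (rcontr v a) (apow a k))"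
proof (induction k)
  case 0
  then show ?case by (simp add: rcontr_def)
next
  case (Suc k)
  have 1: "degree_form 1 (rcontr v a)"
    using degree_rcontr[of 1 a v] assms by (simp add: numeral_2_eq_2)
  have 2: "hat a = a" using hat_degree_form[OF assms] by simp
  have "rcontr v (apow a (Suc (Suc k))) =
      alt_wedge a (rcontr v (apow a (Suc k))) + alt_wedge (rcontr v a) (hat (apow a (Suc k)))"
    by (simp only: apow.simps(2)[of a "Suc k"] alt_wedge_snoc)
  also have "alt_wedge a (rcontr v (apow a (Suc k))) =
      smul (of_nat (Suc k)) (alt_wedge (alt_wedge (rcontr v a) a) (apow a k))"
    by (simp only: Suc.IH wedge_smul_right alt_wedge_assoc[symmetric] even_commute[OF 1 2])
  also have "hat (apow a (Suc k)) = apow a (Suc k)" by (rule hat_apow[OF assms])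
  also have "smul (of_nat (Suc k)) (alt_wedge (alt_wedge (rcontr v a) a) (apow a k))
      + alt_wedge (rcontr v a) (apow a (Suc k))
      = smul (of_nat (Suc (Suc k))) (alt_wedge (rcontr v a) (apow a (Suc k)))"
    by (simp only: apow.simps alt_wedge_assoc) (simp add: fun_eq_iff smul_def algebra_simps)
  finally show ?case .
qed

lemma sum_fun_apply: "sum f A x = (\<Sum>k\<in>A. f k x)"
  by (induction A rule: infinite_finite_induct) auto

text \<open>Contraction acts on powers of an even form like a derivation, hence on the exponential by
  multiplication with the contracted exponent. The term of order zero disappears and shifts the
  summation index, which matches the cut-off on a list that is shorter by one.\<close>

lemma rcontr_aexp:
  assumes "degree_form 2 a"
  shows "rcontr v (aexp a) = alt_wedge (rcontr v a) (aexp a)"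
proof
  fix vs :: "'a list"
  let ?n = "length vs"
  let ?E = "\<Sum>k\<le>?n. smul (1 / fact k) (apow a k)"
  have "rcontr v (aexp a) vs = (\<Sum>k\<le>Suc ?n. rcontr v (apow a k) vs / fact k)"
    by (simp add: rcontr_def aexp_def)
  also have "\<dots> = (\<Sum>k\<le>?n. rcontr v (apow a (Suc k)) vs / fact (Suc k))"
    by (subst sum.atMost_Suc_shift) (simp add: rcontr_def unit_form_def)
  also have "\<dots> = (\<Sum>k\<le>?n. alt_wedge (rcontr v a) (apow a k) vs / fact k)"
    unfolding rcontr_apow[OF assms] by (intro sum.cong refl) (simp add: smul_def field_simps del: of_nat_Suc)
  also have "\<dots> = alt_wedge (rcontr v a) ?E vs"
    by (simp only: alt_wedge_sum_right wedge_smul_right sum_fun_apply) (simp add: smul_def)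
  also have "\<dots> = alt_wedge (rcontr v a) (aexp a) vs"
  proof (rule alt_wedge_cong)
    fix us :: "'a list"
    assume "length us \<le> ?n"
    have "?E us = (\<Sum>k\<le>?n. apow a k us / fact k)" by (simp add: sum_fun_apply smul_def)
    also have "\<dots> = aexp a us"
      unfolding aexp_def using \<open>length us \<le> ?n\<close> degree_apow[OF assms]
      by (intro sum.mono_neutral_right) (auto simp: degree_form_def)
    finally show "?E us = aexp a us" .
  qed simp
  finally show "rcontr v (aexp a) vs = alt_wedge (rcontr v a) (aexp a) vs" .
qed

lemma rcontr_aexp_wedge:
  assumes "degree_form 2 a" "degree_form 2 b"
  shows "rcontr v (alt_wedge (aexp a) (aexp b))
    = alt_wedge (rcontr v (a + b)) (alt_wedge (aexp a) (aexp b))"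
proof -
  (* the contracted exponent is moved past the even form aexp a *)
  have 1: "degree_form 1 (rcontr v b)"
    using degree_rcontr[of 1 b v] assms by (simp add: numeral_2_eq_2)
  have "rcontr v (alt_wedge (aexp a) (aexp b)) =
     alt_wedge (alt_wedge (aexp a) (rcontr v b)) (aexp b) + alt_wedge (alt_wedge (rcontr v a) (aexp a)) (aexp b)"
    by (simp only: alt_wedge_snoc rcontr_aexp[OF assms(1)] rcontr_aexp[OF assms(2)] hat_aexp[OF assms(2)]
        alt_wedge_assoc)
  also have "alt_wedge (aexp a) (rcontr v b) = alt_wedge (rcontr v b) (aexp a)"
    by (rule even_commute[OF 1 hat_aexp[OF assms(1)]])
  also have "alt_wedge (alt_wedge (rcontr v b) (aexp a)) (aexp b) + alt_wedge (alt_wedge (rcontr v a) (aexp a)) (aexp b)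
     = alt_wedge (rcontr v a + rcontr v b) (alt_wedge (aexp a) (aexp b))"
    by (simp only: alt_wedge_assoc wedge_linear add.commute)
  also have "rcontr v a + rcontr v b = rcontr v (a + b)"
    by (simp add: fun_eq_iff rcontr_def)
  finally show ?thesis .
qed

text \<open>If the three vectors span an isotropic subspace for the exponent, then each contraction hits
  only the exponential and not the one-forms that have been split off before.\<close>

lemma aexp_wedge_contract3:
  assumes a: "degree_form 2 a" and b: "degree_form 2 b"
    and iso: "\<And>v w. v \<in> {v1, v2, v3} \<Longrightarrow> w \<in> {v1, v2, v3} \<Longrightarrow> (a + b) [v, w] = 0"
  shows "alt_wedge (aexp a) (aexp b) (vs @ [v1, v2, v3]) =
    alt_wedge (rcontr v3 (a + b)) (alt_wedge (rcontr v2 (a + b))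
      (alt_wedge (rcontr v1 (a + b)) (alt_wedge (aexp a) (aexp b)))) vs"
proof -
  let ?E = "alt_wedge (aexp a) (aexp b)"
  have ab: "degree_form 2 (a + b)" using a b by (simp add: degree_form_def)
  have z: "rcontr v (rcontr w (a + b)) = 0" if "v \<in> {v1, v2, v3}" "w \<in> {v1, v2, v3}" for v w
  proof
    fix ws
    show "rcontr v (rcontr w (a + b)) ws = 0 ws"
      using iso[OF that] ab by (cases ws) (auto simp: rcontr_def degree_form_def)
  qed
  have s: "rcontr v (alt_wedge (rcontr w (a + b)) c) = alt_wedge (rcontr w (a + b)) (rcontr v c)"
    if "v \<in> {v1, v2, v3}" "w \<in> {v1, v2, v3}" for v w c
    using z[OF that] by (simp only: alt_wedge_snoc wedge_linear add_0_right)
  have "?E (vs @ [v1, v2, v3]) = rcontr v1 (rcontr v2 (rcontr v3 ?E)) vs"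
    by (simp add: rcontr_def)
  also have "rcontr v1 (rcontr v2 (rcontr v3 ?E)) = alt_wedge (rcontr v3 (a + b)) (alt_wedge (rcontr v2 (a + b))
      (alt_wedge (rcontr v1 (a + b)) ?E))"
    by (simp add: rcontr_aexp_wedge[OF a b] s)
  finally show ?thesis .
qed

lemma apow_map: "apow a k (map f vs) = apow (\<lambda>us. a (map f us)) k vs"
  by (induction k arbitrary: vs) (simp_all add: unit_form_def alt_wedge_map)

lemma aexp_map: "aexp a (map f vs) = aexp (\<lambda>us. a (map f us)) vs"
  by (simp add: aexp_def apow_map)

lemma aexp_zero: "aexp 0 = unit_form"
proof
  fix vs :: "'a list"
  have "apow (0 :: 'a list \<Rightarrow> complex) k vs = (if k = 0 then unit_form vs else 0)" for k
    by (cases k) (simp_all only: apow.simps wedge_zero_left zero_fun_apply simp_thms if_True if_False nat.distinct)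
  then show "aexp 0 vs = unit_form vs"
    by (simp add: aexp_def if_distrib[of "\<lambda>x. x / _"] cong: if_cong)
qed

text \<open>Needed because the cut-off of the exponential depends on the length of its argument: on lists
  of a fixed length it is a fixed finite sum, to which linearity applies.\<close>

lemma complex_ext_cong:
  "(\<And>us. length us = length ws \<Longrightarrow> a us = b us) \<Longrightarrow> complex_ext a ws = complex_ext b ws"
proof (induction ws arbitrary: a b)
  case (Cons w ws)
  obtain u v where w: "w = (u, v)" by (cases w)
  have "complex_ext (\<lambda>us. a (x # us)) ws = complex_ext (\<lambda>us. b (x # us)) ws" for x
    by (rule Cons.IH) (simp add: Cons.prems)
  then show ?case by (simp add: w)
qed simp

lemma complex_ext_unit: "complex_ext unit_form ws = unit_form ws"
  by (cases ws) (auto simp: unit_form_def complex_ext_0 split: prod.splits)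

lemma complex_ext_apow: "complex_ext (apow a k) = apow (complex_ext a) k"
proof (induction k)
  case (Suc k)
  have "complex_ext (alt_wedge a b) = alt_wedge (complex_ext a) (complex_ext b)" for b
    by (rule ext) (rule complex_ext_alt_wedge)
  then show ?case by (simp add: Suc.IH)
qed (simp add: fun_eq_iff complex_ext_unit)

lemma complex_ext_sum: "complex_ext (\<lambda>us. \<Sum>k\<in>A. f k us) ws = (\<Sum>k\<in>A. complex_ext (f k) ws)"
  by (induction A rule: infinite_finite_induct) (simp_all add: complex_ext_0 complex_ext_add)

lemma complex_ext_aexp: "complex_ext (aexp a) ws = aexp (complex_ext a) ws"
proof -
  have "complex_ext (aexp a) ws = complex_ext (\<lambda>us. \<Sum>k\<le>length ws. inverse (fact k) * apow a k us) ws"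
    by (rule complex_ext_cong) (simp add: aexp_def divide_inverse mult.commute)
  also have "\<dots> = aexp (complex_ext a) ws"
    by (simp add: complex_ext_sum complex_ext_mult complex_ext_apow aexp_def
        divide_inverse mult.commute)
  finally show ?thesis .
qed

lemma pol_switch_fexp: "pol_switch (fexp \<alpha>) = fexp (pol_switch \<alpha>)"
proof (intro ext)
  fix x vs
  have "pol_switch (fexp \<alpha>) x vs = aexp (complex_ext (\<alpha> x)) (map pol_vec vs)"
    by (simp add: pol_switch_def fexp_aexp complex_ext_aexp)
  also have "\<dots> = fexp (pol_switch \<alpha>) x vs"
    by (simp add: aexp_map fexp_aexp pol_switch_def[abs_def])
  finally show "pol_switch (fexp \<alpha>) x vs = fexp (pol_switch \<alpha>) x vs" .
qed

lemma pullback_fexp: "pullback f (fexp \<alpha>) = fexp (pullback f \<alpha>)"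
  by (simp add: fun_eq_iff pullback_def[abs_def] fexp_aexp aexp_map)

text \<open>The squared moduli of \<open>1\<close>, \<open>exp (- z\<^sub>1)\<close> and \<open>exp z\<^sub>1\<close> in terms of the base coordinates.\<close>

definition height :: "R3 \<Rightarrow> 3 \<Rightarrow> real" where
  "height r j = (if j = 1 then 1 else if j = 2 then exp (- 2 * r $ 1) else exp (2 * r $ 1))"

lemma linear_slice_chart: "linear slice_chart"
  by (rule linearI) (auto simp: slice_chart_def vec_eq_iff complex_eq_iff)

text \<open>The holomorphic coordinate is \<open>s\<^sub>j + \<i> r\<^sub>j = \<i> z\<^sub>j\<close>, and the phase \<open>\<i>\<close> cancels against its conjugate.\<close>

lemma pullback_nakamura_omega:
  "pullback slice_chart (fscale 2 nakamura_omega) (r, s) vs =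
     (\<Sum>j\<in>UNIV. \<i> * height r j *
       ((d_fibre j + fscale \<i> (d_base j)) \<and>\<^sub>d (d_fibre j - fscale \<i> (d_base j))) (r, s) vs)"
proof -
  have g: "((d_fibre j + fscale \<i> (d_base j)) \<and>\<^sub>d (d_fibre j - fscale \<i> (d_base j))) (r, s) vs
      = kform j (map slice_chart vs)" for j
  proof -
    have "(d_fibre j + fscale \<i> (d_base j)) (r, s) = cov (\<lambda>v. \<i> * dz j (slice_chart v))"
      "(d_fibre j - fscale \<i> (d_base j)) (r, s) = cov (\<lambda>v. - \<i> * dzbar j (slice_chart v))"
      by (auto simp: fun_eq_iff d_fibre_eq d_base_eq fscale_def cov_def slice_chart_def dz_def dzbar_def
          complex_eq_iff split: list.splits)
    then show ?thesis
      by (simp add: wedge_def kform_def alt_wedge_map cov_map cov_smul cov_uminus wedge_linear smul_smul)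
        (simp add: smul_def)
  qed
  show ?thesis
    by (simp add: g pullback_def frechet_derivative_linear[OF linear_slice_chart] fscale_def
        nakamura_omega_eq expo_form_apply sum_3 height_def smul_def)
      (simp add: slice_chart_def algebra_simps)
qed

lemma pol_switch_nakamura_omega:
  "pol_switch (pullback slice_chart (fscale 2 nakamura_omega)) (r, s) vs =
     (\<Sum>j\<in>UNIV. \<i> * height r j * (d_fibre j \<and>\<^sub>d d_base j) (r, s) vs)"
proof -
  have "pol_switch (pullback slice_chart (fscale 2 nakamura_omega)) (r, s) vs =
     (\<Sum>j\<in>UNIV. \<i> * height r j * pol_switch
       ((d_fibre j + fscale \<i> (d_base j)) \<and>\<^sub>d (d_fibre j - fscale \<i> (d_base j))) (r, s) vs)"
    unfolding pol_switch_def
    by (simp only: pullback_nakamura_omega[abs_def] complex_ext_sum complex_ext_mult)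
  then show ?thesis by (simp only: pol_switch_wedge pol_switch_generators)
qed

definition fibre_volume :: "real^3^3 \<Rightarrow> real" where
  "fibre_volume A = integral ((\<lambda>v. A *v v) ` cbox 0 (\<chi> i. 1)) (\<lambda>_. 1)"

text \<open>The fibre is a compact parallelepiped, so constants are integrable and the factor is a real
  number. A real factor does not mix the real and the imaginary part of the transform.\<close>

lemma integral_fibre_const:
  "integral ((\<lambda>v. A *v v) ` cbox 0 (\<chi> i. 1)) (\<lambda>_. c :: complex) = of_real (fibre_volume A) * c"
proof -
  let ?S = "(\<lambda>v. A *v v) ` cbox 0 (\<chi> i. 1)"
  have "compact ?S"
    by (intro compact_continuous_image linear_continuous_on compact_cbox) (simp add: matrix_vector_mul_bounded_linear)
  then have i: "(\<lambda>_. 1 :: real) integrable_on ?S"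
    by (intro integrable_on_const lmeasurable_compact)
  have "integral ?S (\<lambda>_. c) = integral ?S (\<lambda>_. 1 *\<^sub>R c)" by simp
  also have "\<dots> = integral ?S (\<lambda>_. 1) *\<^sub>R c"
    using integral_linear[OF i bounded_linear_scaleR_left[of c]] by (simp add: o_def)
  finally show ?thesis by (simp add: fibre_volume_def scaleR_conv_of_real)
qed

text \<open>The integrand does not depend on the fibre coordinate. Contracting it with the three fibre
  directions splits off \<open>- (\<i> h\<^sub>j dr\<^sub>j + dt\<^sub>j)\<close> for \<open>j = 3, 2, 1\<close>, and the remaining exponential restricts
  to \<open>1\<close> on vectors without fibre component. The result has pure degree three although the
  transformed form has mixed degree.\<close>

lemma FT_nakamura:
  "FT A (pullback slice_chart (fexp (fscale 2 nakamura_omega))) (r, t) =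
     smul (of_real (fibre_volume A))
      (alt_wedge (cov (\<lambda>v. - (\<i> * height r 3 * fst v $ 3 + snd v $ 3)))
      (alt_wedge (cov (\<lambda>v. - (\<i> * height r 2 * fst v $ 2 + snd v $ 2)))
        (cov (\<lambda>v. - (\<i> * height r 1 * fst v $ 1 + snd v $ 1)))))"
proof
  fix vs :: "(R3 \<times> R3) list"
  let ?\<alpha> = "pullback slice_chart (fscale 2 nakamura_omega)"
  let ?\<eta> = "\<lambda>j. cov (\<lambda>v :: R3 \<times> R3. - (\<i> * height r j * fst v $ j + snd v $ j))"
  let ?lift = "\<lambda>(u, w). (u, 0, w) :: R3 \<times> R3 \<times> R3"
  let ?e = "\<lambda>j. (0, axis j 1, 0) :: R3 \<times> R3 \<times> R3"
  define sf where "sf j v = complex_of_real (fst (snd v) $ j)" for j and v :: "R3 \<times> R3 \<times> R3"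
  define tf where "tf j v = complex_of_real (snd (snd v) $ j)" for j and v :: "R3 \<times> R3 \<times> R3"
  define rf where "rf j v = complex_of_real (fst v $ j)" for j and v :: "R3 \<times> R3 \<times> R3"
  define a where "a vs = (\<Sum>j\<in>UNIV. \<i> * height r j * alt_wedge (cov (sf j)) (cov (rf j)) vs)" for vs
  define b where "b vs = (\<Sum>j\<in>UNIV. alt_wedge (cov (sf j)) (cov (tf j)) vs)" for vs
  have lin: "linear (sf j)" "linear (tf j)" for j
    by (auto intro!: linearI simp: sf_def tf_def complex_eq_iff)
  have proj: "frechet_derivative (\<lambda>(r, s, t). (r, s)) (at p) = (\<lambda>(r, s, t). (r, s))" for p :: "R3 \<times> R3 \<times> R3"
    by (rule frechet_derivative_linear) (auto intro!: linearI)
  have pa: "pullback (\<lambda>(r, s, t). (r, s)) (pol_switch ?\<alpha>) (r, s, t) = a" for s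
  proof
    fix us :: "(R3 \<times> R3 \<times> R3) list"
    have "(d_fibre j \<and>\<^sub>d d_base j) (r, s) (map (\<lambda>(r, s, t). (r, s)) us) = alt_wedge (cov (sf j)) (cov (rf j)) us" for j
    proof -
      have "d_fibre j (r, s) = cov (\<lambda>v. complex_of_real (snd v $ j))" "d_base j (r, s) = cov (\<lambda>v. complex_of_real (fst v $ j))"
        by (auto simp: fun_eq_iff d_fibre_eq d_base_eq cov_def split: list.splits)
      then show ?thesis
        by (simp add: wedge_def alt_wedge_map cov_map case_prod_unfold sf_def[abs_def] rf_def[abs_def])
    qed
    then show "pullback (\<lambda>(r, s, t). (r, s)) (pol_switch ?\<alpha>) (r, s, t) us = a us"
      by (simp add: pullback_def proj pol_switch_nakamura_omega[of r s "map _ us"] a_def)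
  qed
  have pb: "poincare_two_form (r, s, t) = b" for s
  proof
    fix us :: "(R3 \<times> R3 \<times> R3) list"
    have "dfun (\<lambda>(r, s, t). complex_of_real (s $ j)) (r, s, t) = cov (sf j)"
      "dfun (\<lambda>(r, s, t). complex_of_real (t $ j)) (r, s, t) = cov (tf j)" for j
      using dfun_linear_cov[OF lin(1)[of j], of "(r, s, t)"] dfun_linear_cov[OF lin(2)[of j], of "(r, s, t)"]
      by (simp_all add: sf_def[abs_def] tf_def[abs_def] case_prod_unfold)
    then show "poincare_two_form (r, s, t) us = b us"
      by (simp add: poincare_two_form_def b_def wedge_def sum_3)
  qed
  have deg: "degree_form 2 a" "degree_form 2 b"
    by (auto simp: degree_form_def a_def b_def cov_wedge_cov split: list.splits intro!: sum.neutral)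
  (* every term of the exponents contains only one ds, so the fibre is isotropic *)
  have iso: "(a + b) [v, w] = 0" if "v \<in> {?e 1, ?e 2, ?e 3}" "w \<in> {?e 1, ?e 2, ?e 3}" for v w
    using that by (auto simp: a_def b_def cov_wedge_cov sf_def rf_def tf_def)
  define E where "E = alt_wedge (aexp a) (aexp b)"
  (* every term of the exponents contains some ds, which vanishes on lifted vectors *)
  have E: "(\<lambda>us. E (map ?lift us)) = unit_form"
  proof -
    have "(\<lambda>us. a (map ?lift us)) = 0" "(\<lambda>us. b (map ?lift us)) = 0"
      by (auto simp: fun_eq_iff a_def b_def cov_wedge_cov sf_def split: list.splits intro!: sum.neutral)
    then have "(\<lambda>us. aexp a (map ?lift us)) = unit_form" "(\<lambda>us. aexp b (map ?lift us)) = unit_form"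
      by (simp_all only: aexp_map aexp_zero)
    then show ?thesis by (simp only: E_def alt_wedge_map wedge_unit_left)
  qed
  have eta: "(\<lambda>us. rcontr (?e j) (a + b) (map ?lift us)) = ?\<eta> j" if "j \<in> {1, 2, 3}" for j
  proof
    fix us :: "(R3 \<times> R3) list"
    show "rcontr (?e j) (a + b) (map ?lift us) = ?\<eta> j us"
    proof (cases "\<exists>v. us = [v]")
      case True
      then show ?thesis using that
        by (auto simp: rcontr_def a_def b_def cov_wedge_cov sf_def rf_def tf_def sum_3 axis_def)
    next
      case False
      then have "length us \<noteq> 1" by (auto simp: length_Suc_conv)
      then have "length (map ?lift us @ [?e j]) \<noteq> 2" "?\<eta> j us = 0"
        using degree_cov unfolding degree_form_def by (simp, blast)
      then show ?thesis using deg by (simp only: degree_form_def rcontr_def plus_fun_apply) simp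
    qed
  qed
  have "FT A (pullback slice_chart (fexp (fscale 2 nakamura_omega))) (r, t) vs =
    integral ((\<lambda>v. A *v v) ` cbox 0 (\<chi> i. 1))
      (\<lambda>s. E (map ?lift vs @ [?e 1, ?e 2, ?e 3]))"
    by (simp only: FT_def fibre_integral_def wedge_def pullback_fexp pol_switch_fexp fexp_aexp pa pb prod.case E_def)
  also have "\<dots> = of_real (fibre_volume A) * E (map ?lift vs @ [?e 1, ?e 2, ?e 3])"
    by (rule integral_fibre_const)
  also have "E (map ?lift vs @ [?e 1, ?e 2, ?e 3]) =
     alt_wedge (rcontr (?e 3) (a + b)) (alt_wedge (rcontr (?e 2) (a + b))
      (alt_wedge (rcontr (?e 1) (a + b)) E)) (map ?lift vs)"
    unfolding E_def by (rule aexp_wedge_contract3[OF deg iso])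
  also have "\<dots> = alt_wedge (?\<eta> 3) (alt_wedge (?\<eta> 2) (?\<eta> 1)) vs"
    by (simp only: alt_wedge_map E eta insert_iff simp_thms wedge_unit_right)
  finally show "FT A (pullback slice_chart (fexp (fscale 2 nakamura_omega))) (r, t) vs =
     smul (of_real (fibre_volume A)) (alt_wedge (?\<eta> 3) (alt_wedge (?\<eta> 2) (?\<eta> 1))) vs"
    by (simp add: smul_def)
qed

section \<open>Lattices\<close>

lemma integer_vectors_simps:
  "0 \<in> integer_vectors" "u \<in> integer_vectors \<Longrightarrow> v \<in> integer_vectors \<Longrightarrow> u + v \<in> integer_vectors"
  "u \<in> integer_vectors \<Longrightarrow> - u \<in> integer_vectors"
  by (auto simp: integer_vectors_def)

lemma finite_bounded_integer_vectors: "finite {v \<in> integer_vectors. norm (v :: real^'n) \<le> R}"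
proof -
  have "{v \<in> integer_vectors. norm (v :: real^'n) \<le> R} \<subseteq> vec_lambda ` (PiE UNIV (\<lambda>_. {k \<in> \<int>. \<bar>k\<bar> \<le> R}))"
  proof
    fix v :: "real^'n"
    assume "v \<in> {v \<in> integer_vectors. norm v \<le> R}"
    then have "(\<lambda>i. v $ i) \<in> PiE UNIV (\<lambda>_. {k \<in> \<int>. \<bar>k\<bar> \<le> R})"
      by (auto simp: integer_vectors_def intro: order_trans[OF component_le_norm_cart])
    then show "v \<in> vec_lambda ` (PiE UNIV (\<lambda>_. {k \<in> \<int>. \<bar>k\<bar> \<le> R}))"
      by (rule image_eqI[rotated]) simp
  qed
  then show ?thesis
    by (rule finite_subset) (intro finite_imageI finite_PiE finite_abs_int_segment finite_class.finite_UNIV)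
qed

lemma matrix_inv_mult:
  fixes A :: "real^'n^'n"
  assumes "invertible A"
  shows "matrix_inv A ** A = mat 1" "A ** matrix_inv A = mat 1"
  using assms someI_ex[of "\<lambda>B. A ** B = mat 1 \<and> B ** A = mat 1"]
  unfolding matrix_inv_def invertible_def by blast+

lemma matrix_inv_vector:
  fixes A :: "real^'n^'n"
  assumes "invertible A"
  shows "matrix_inv A *v (A *v v) = v" "A *v (matrix_inv A *v v) = v"
  by (simp_all add: matrix_vector_mul_assoc matrix_inv_mult[OF assms])

lemma mem_lattice_iff:
  assumes "invertible A"
  shows "w \<in> lattice A \<longleftrightarrow> matrix_inv A *v w \<in> integer_vectors"
  unfolding lattice_def using matrix_inv_vector[OF assms] by (metis (no_types, lifting) image_iff)

lemma finite_bounded_lattice: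
  assumes "invertible A"
  shows "finite {w \<in> lattice A. norm w \<le> R}"
proof -
  obtain K where K: "K > 0" "\<And>w. norm (matrix_inv A *v w) \<le> norm w * K"
    using bounded_linear.pos_bounded[OF matrix_vector_mul_bounded_linear[of "matrix_inv A"]] by blast
  have "{w \<in> lattice A. norm w \<le> R} \<subseteq> (\<lambda>v. A *v v) ` {v \<in> integer_vectors. norm v \<le> R * K}"
  proof
    fix w assume w: "w \<in> {w \<in> lattice A. norm w \<le> R}"
    then have "norm (matrix_inv A *v w) \<le> R * K"
      using K(2)[of w] mult_right_mono[OF _ less_imp_le[OF K(1)], of "norm w" R]
      by (auto intro: order_trans)
    then show "w \<in> (\<lambda>v. A *v v) ` {v \<in> integer_vectors. norm v \<le> R * K}"
      using w mem_lattice_iff[OF assms, of w] matrix_inv_vector(2)[OF assms, of w] by (auto intro!: image_eqI[of w])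
  qed
  then show ?thesis by (rule finite_subset) (intro finite_imageI finite_bounded_integer_vectors)
qed

text \<open>Integrality of all pairings with a lattice can be tested on the columns of a basis matrix.\<close>

lemma mem_dual_lattice_iff: "w \<in> dual_lattice (lattice A) \<longleftrightarrow> transpose A *v w \<in> integer_vectors"
proof -
  have d: "(A *v v) \<bullet> w = v \<bullet> (transpose A *v w)" for v
    by (metis dot_lmul_matrix matrix_vector_mul_assoc transpose_matrix_vector transpose_transpose inner_commute)
  have "w \<in> dual_lattice (lattice A) \<longleftrightarrow> (\<forall>v\<in>integer_vectors. v \<bullet> (transpose A *v w) \<in> \<int>)"
    by (simp add: dual_lattice_def lattice_def d)
  also have "\<dots> \<longleftrightarrow> transpose A *v w \<in> integer_vectors"
  proof
    assume *: "\<forall>v\<in>integer_vectors. v \<bullet> (transpose A *v w) \<in> \<int>"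
    have "axis i 1 \<in> integer_vectors" for i by (simp add: integer_vectors_def axis_def)
    then have "axis i 1 \<bullet> (transpose A *v w) \<in> \<int>" for i using * by blast
    then show "transpose A *v w \<in> integer_vectors"
      by (simp add: integer_vectors_def inner_axis inner_commute[of "axis _ _"])
  next
    assume "transpose A *v w \<in> integer_vectors"
    then show "\<forall>v\<in>integer_vectors. v \<bullet> (transpose A *v w) \<in> \<int>"
      by (auto simp: integer_vectors_def inner_vec_def intro!: Ints_sum Ints_mult)
  qed
  finally show ?thesis .
qed

lemma lattice_transpose_inv:
  assumes "invertible A"
  shows "lattice (transpose (matrix_inv A)) = dual_lattice (lattice A)"
proof -
  have 1: "transpose A ** transpose (matrix_inv A) = mat 1" "transpose (matrix_inv A) ** transpose A = mat 1"
    by (metis matrix_inv_mult[OF assms] matrix_transpose_mul transpose_mat)+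
  show ?thesis
  proof (intro set_eqI iffI)
    fix w assume "w \<in> lattice (transpose (matrix_inv A))"
    then obtain v where "v \<in> integer_vectors" "w = transpose (matrix_inv A) *v v"
      unfolding lattice_def by blast
    then show "w \<in> dual_lattice (lattice A)"
      by (simp only: mem_dual_lattice_iff matrix_vector_mul_assoc 1 matrix_vector_mul_lid)
  next
    fix w assume "w \<in> dual_lattice (lattice A)"
    then show "w \<in> lattice (transpose (matrix_inv A))"
      unfolding mem_dual_lattice_iff lattice_def[of "transpose (matrix_inv A)"]
      by (rule image_eqI[rotated]) (simp only: matrix_vector_mul_assoc 1 matrix_vector_mul_lid)
  qed
qed

definition dil :: "real \<Rightarrow> real^2 \<Rightarrow> real^2" where
  "dil c v = vector [exp c * v $ 1, exp (- c) * v $ 2]"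

text \<open>What the action on the universal cover requires of a lattice: it is a locally finite subgroup
  of the plane that is invariant under all integer powers of the hyperbolic matrix.\<close>

definition stable_lattice :: "real \<Rightarrow> (real^2) set \<Rightarrow> bool" where
  "stable_lattice lam K \<longleftrightarrow> 0 \<in> K \<and> (\<forall>u\<in>K. \<forall>v\<in>K. u + v \<in> K) \<and> (\<forall>u\<in>K. - u \<in> K) \<and>
     (\<forall>n::int. \<forall>u\<in>K. dil (of_int n * lam) u \<in> K) \<and> (\<forall>R. finite {u \<in> K. norm u \<le> R})"

lemma dil_simps [simp]: "dil c v $ 1 = exp c * v $ 1" "dil c v $ 2 = exp (- c) * v $ 2"
  by (simp_all add: dil_def)

lemma dil_dil: "dil c (dil d v) = dil (c + d) v"
  by (simp add: vec_eq_iff forall_2 exp_add[symmetric] mult.assoc[symmetric] add.commute)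

lemma dil_0: "dil 0 v = v"
  by (simp add: vec_eq_iff forall_2)

lemma dil_int_stable:
  assumes "\<And>u. u \<in> K \<Longrightarrow> dil lam u \<in> K" "\<And>u. u \<in> K \<Longrightarrow> dil (- lam) u \<in> K" "u \<in> K"
  shows "dil (of_int n * lam) u \<in> K"
proof (induction n rule: int_induct[where k = 0])
  case base
  then show ?case using assms(3) by (simp add: dil_0)
next
  case (step1 i)
  then show ?case using assms(1)[OF step1(2)] by (simp add: dil_dil algebra_simps)
next
  case (step2 i)
  then show ?case using assms(2)[OF step2(2)] by (simp add: dil_dil algebra_simps)
qed

lemma diag2_vector: "diag2 (exp lam) (exp (- lam)) *v v = dil lam v"
  by (simp add: vec_eq_iff forall_2 matrix_vector_mult_def sum_2 diag2_def)

text \<open>\<open>D P = P M\<^sub>0\<close> gives invariance under \<open>D\<close>; invariance under the inverse uses that the inverse of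
  \<open>M\<^sub>0\<close> is its adjugate, which is integral because the determinant is one.\<close>

lemma hyperbolic_lattice_stable:
  fixes M0 :: "int^2^2"
  assumes "det M0 = 1" "invertible P"
    "P ** map_matrix real_of_int M0 ** matrix_inv P = diag2 (exp lam) (exp (- lam))"
  shows "stable_lattice lam (lattice P)"
proof -
  let ?M = "map_matrix real_of_int M0"
  have D: "dil lam (P *v v) = P *v (?M *v v)" for v
    using matrix_inv_vector(1)[OF assms(2), of v]
    by (simp flip: diag2_vector assms(3) matrix_vector_mul_assoc)
  have M: "?M *v v \<in> integer_vectors" if "v \<in> integer_vectors" for v
    using that by (auto simp: integer_vectors_def matrix_vector_mult_def map_matrix_def)
  define Mi where "Mi v = (vector [of_int (M0 $ 2 $ 2) * v $ 1 - of_int (M0 $ 1 $ 2) * v $ 2,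
      of_int (M0 $ 1 $ 1) * v $ 2 - of_int (M0 $ 2 $ 1) * v $ 1] :: real^2)" for v :: "real^2"
  have det: "real_of_int (M0 $ 1 $ 1) * of_int (M0 $ 2 $ 2) - of_int (M0 $ 1 $ 2) * of_int (M0 $ 2 $ 1) = 1"
    using assms(1) by (simp add: det_2 flip: of_int_mult of_int_diff)
  have "?M *v Mi v = v" for v
  proof -
    have *: "a * (d * x - b * y) + b * (a * y - c * x) = x" "c * (d * x - b * y) + d * (a * y - c * x) = y"
      if "a * d - b * c = 1" for a b c d x y :: real
      using that by algebra+
    show ?thesis using *[OF det]
      by (simp add: vec_eq_iff forall_2 matrix_vector_mult_def sum_2 Mi_def map_matrix_def)
  qed
  then have Di: "dil (- lam) (P *v v) = P *v Mi v" for v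
    using D[of "Mi v"] by (metis dil_dil dil_0 add.left_inverse)
  have Mi: "Mi v \<in> integer_vectors" if "v \<in> integer_vectors" for v
    using that by (auto simp: integer_vectors_def Mi_def forall_2)
  have "dil lam u \<in> lattice P" "dil (- lam) u \<in> lattice P" if "u \<in> lattice P" for u
    using that D Di M Mi unfolding lattice_def by blast+
  then have "dil (of_int n * lam) u \<in> lattice P" if "u \<in> lattice P" for n u
    using that by (intro dil_int_stable) auto
  moreover have "0 \<in> lattice P" "u \<in> lattice P \<Longrightarrow> - u \<in> lattice P"
    "u \<in> lattice P \<Longrightarrow> v \<in> lattice P \<Longrightarrow> u + v \<in> lattice P" for u v
    using integer_vectors_simps
    by (simp_all add: mem_lattice_iff[OF assms(2)] matrix_vector_right_distrib linear_neg[OF matrix_vector_mul_linear])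
  ultimately show ?thesis
    using finite_bounded_lattice[OF assms(2)] by (simp add: stable_lattice_def)
qed

text \<open>The diagonal matrix is symmetric, so it preserves the dual lattice as well. The quarter turn
  \<open>imag_of_dual\<close> exchanges the two eigenlines and thereby replaces the matrix by its inverse.\<close>

lemma stable_lattice_mirror:
  assumes P: "invertible P" and st: "stable_lattice lam (lattice P)"
  shows "stable_lattice lam (imag_of_dual ` lattice (transpose (matrix_inv P)))"
proof -
  let ?K = "dual_lattice (lattice P)"
  have inv: "invertible (transpose (matrix_inv P))"
    by (metis P transpose_invertible matrix_inv_mult invertible_def)
  have K: "0 \<in> ?K" "u \<in> ?K \<Longrightarrow> v \<in> ?K \<Longrightarrow> u + v \<in> ?K" "u \<in> ?K \<Longrightarrow> - u \<in> ?K" for u v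
    by (auto simp: dual_lattice_def inner_add_right)
  have D: "dil (of_int n * lam) u \<in> ?K" if "u \<in> ?K" for u n
    unfolding dual_lattice_def
  proof (safe)
    fix v assume "v \<in> lattice P"
    then have "dil (of_int n * lam) v \<in> lattice P" using st by (simp add: stable_lattice_def)
    then have "dil (of_int n * lam) v \<bullet> u \<in> \<int>" using that by (auto simp: dual_lattice_def)
    moreover have "dil (of_int n * lam) v \<bullet> u = v \<bullet> dil (of_int n * lam) u"
      by (simp add: inner_vec_def sum_2 algebra_simps)
    ultimately show "v \<bullet> dil (of_int n * lam) u \<in> \<int>" by simp
  qed
  have i: "imag_of_dual 0 = 0" "imag_of_dual (u + v) = imag_of_dual u + imag_of_dual v"
    "imag_of_dual (- u) = - imag_of_dual u"
    "dil c (imag_of_dual u) = imag_of_dual (dil (- c) u)" "norm (imag_of_dual u) = norm u" for u v c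
    by (simp_all add: imag_of_dual_def vec_eq_iff forall_2 norm_vec_def L2_set_def sum_2 add.commute)
  have fin: "finite {u \<in> imag_of_dual ` ?K. norm u \<le> R}" for R
  proof -
    have "{u \<in> imag_of_dual ` ?K. norm u \<le> R} \<subseteq> imag_of_dual ` {u \<in> ?K. norm u \<le> R}"
      by (auto simp: i)
    then show ?thesis
      by (rule finite_subset)
        (use finite_bounded_lattice[OF inv, of R] in \<open>simp add: lattice_transpose_inv[OF P]\<close>)
  qed
  have "dil (of_int n * lam) u \<in> imag_of_dual ` ?K" if "u \<in> imag_of_dual ` ?K" for n u
    using that D[of _ "- n"] by (auto simp: i)
  moreover have "0 \<in> imag_of_dual ` ?K" using K(1) i(1) by (metis image_eqI)
  moreover have "u + v \<in> imag_of_dual ` ?K" if "u \<in> imag_of_dual ` ?K" "v \<in> imag_of_dual ` ?K" for u v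
    using that K(2) by (auto simp flip: i(2))
  moreover have "- u \<in> imag_of_dual ` ?K" if "u \<in> imag_of_dual ` ?K" for u
    using that K(3) by (auto simp flip: i(3))
  ultimately show ?thesis
    unfolding lattice_transpose_inv[OF P] stable_lattice_def using fin by blast
qed

section \<open>Normal forms of the deck groups\<close>

lemma smooth_continuous: "smooth f \<Longrightarrow> continuous_on UNIV f"
  unfolding smooth_def using Ck.simps(1) by blast

text \<open>Properness leaves only finitely many group elements that can move a neighbourhood of \<open>x\<close> to a
  neighbourhood of \<open>y\<close>; each of them is excluded by shrinking the neighbourhoods, unless it maps
  \<open>x\<close> to \<open>y\<close>. The case \<open>x = y\<close> gives proper discontinuity and the other case the Hausdorff
  property.\<close>

lemma deck_group_of_proper:
  fixes \<Gamma> :: "('a::euclidean_space \<Rightarrow> 'a) set"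
  assumes "id \<in> \<Gamma>" "\<And>g h. g \<in> \<Gamma> \<Longrightarrow> h \<in> \<Gamma> \<Longrightarrow> g \<circ> h \<in> \<Gamma>"
    and "\<And>g. g \<in> \<Gamma> \<Longrightarrow> bij g \<and> smooth g \<and> inv g \<in> \<Gamma>"
    and free: "\<And>g x. g \<in> \<Gamma> \<Longrightarrow> g x = x \<Longrightarrow> g = id"
    and proper: "\<And>R. finite {g \<in> \<Gamma>. \<exists>x. norm x \<le> R \<and> norm (g x) \<le> R}"
  shows "deck_group \<Gamma>"
proof -
  have sep: "\<exists>U V. open U \<and> open V \<and> x \<in> U \<and> y \<in> V \<and> (\<forall>g\<in>\<Gamma>. g x \<noteq> y \<longrightarrow> g ` U \<inter> V = {})" for x y
  proof -
    (* an element that maps a point of the unit ball about x into the unit ball about y lies in F *)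
    define R where "R = max (norm x) (norm y) + 1"
    define F where "F = {g \<in> \<Gamma>. \<exists>x. norm x \<le> R \<and> norm (g x) \<le> R}"
    have "\<exists>U V. open U \<and> open V \<and> x \<in> U \<and> y \<in> V \<and> g ` U \<inter> V = {}" if g: "g \<in> \<Gamma>" "g x \<noteq> y" for g
    proof -
      obtain W V where WV: "open W" "open V" "g x \<in> W" "y \<in> V" "W \<inter> V = {}"
        using hausdorff[OF g(2)] by blast
      have "open (g -` W)"
        using assms(3)[OF g(1)] smooth_continuous WV(1) by (metis continuous_on_open_vimage open_UNIV Int_UNIV_right)
      then show ?thesis using WV by (intro exI[of _ "g -` W"] exI[of _ V]) auto
    qed
    then obtain U V where UV: "\<And>g. g \<in> \<Gamma> \<Longrightarrow> g x \<noteq> y \<Longrightarrow>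
        open (U g) \<and> open (V g) \<and> x \<in> U g \<and> y \<in> V g \<and> g ` U g \<inter> V g = {}"
      by metis
    let ?F = "{g \<in> F. g x \<noteq> y}"
    have fin: "finite ?F" using proper[of R] by (auto simp: F_def intro: finite_subset[rotated])
    define U' V' where "U' = ball x 1 \<inter> (\<Inter>g\<in>?F. U g)" and "V' = ball y 1 \<inter> (\<Inter>g\<in>?F. V g)"
    have "g ` U' \<inter> V' = {}" if g: "g \<in> \<Gamma>" "g x \<noteq> y" for g
    proof (rule ccontr)
      assume "g ` U' \<inter> V' \<noteq> {}"
      then obtain u where u: "u \<in> U'" "g u \<in> V'" by blast
      have "norm u \<le> R" "norm (g u) \<le> R"
        using u norm_triangle_sub[of u x] norm_triangle_sub[of "g u" y]
        by (auto simp: U'_def V'_def R_def dist_norm norm_minus_commute)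
      then have "g \<in> ?F" using g by (auto simp: F_def)
      then have "u \<in> U g" "g u \<in> V g" using u by (auto simp: U'_def V'_def)
      then show False using UV[OF g] by blast
    qed
    moreover have "open U'" "open V'" "x \<in> U'" "y \<in> V'"
      using fin UV by (auto simp: U'_def V'_def F_def intro!: open_Int open_INT)
    ultimately show ?thesis by blast
  qed
  have "\<exists>U. open U \<and> x \<in> U \<and> (\<forall>g\<in>\<Gamma>. g \<noteq> id \<longrightarrow> g ` U \<inter> U = {})" for x
  proof -
    obtain U V where UV: "open U \<and> open V \<and> x \<in> U \<and> x \<in> V \<and> (\<forall>g\<in>\<Gamma>. g x \<noteq> x \<longrightarrow> g ` U \<inter> V = {})"
      using sep[of x x] by (elim exE)
    have "g ` (U \<inter> V) \<inter> (U \<inter> V) = {}" if "g \<in> \<Gamma>" "g \<noteq> id" for g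
    proof -
      have "g ` U \<inter> V = {}" using UV free[OF that(1), of x] that by metis
      then show ?thesis by blast
    qed
    moreover have "open (U \<inter> V)" "x \<in> U \<inter> V" using UV by auto
    ultimately show ?thesis by (intro exI[of _ "U \<inter> V"] conjI ballI impI)
  qed
  moreover have "\<exists>U V. open U \<and> open V \<and> x \<in> U \<and> y \<in> V \<and> (\<forall>g\<in>\<Gamma>. g ` U \<inter> V = {})"
    if "y \<notin> orbit \<Gamma> x" for x y
  proof -
    obtain U V where UV: "open U \<and> open V \<and> x \<in> U \<and> y \<in> V \<and> (\<forall>g\<in>\<Gamma>. g x \<noteq> y \<longrightarrow> g ` U \<inter> V = {})"
      using sep[of x y] by (elim exE)
    moreover have "\<forall>g\<in>\<Gamma>. g x \<noteq> y" using that by (auto simp: orbit_def)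
    ultimately show ?thesis by (intro exI[of _ U] exI[of _ V]) simp
  qed
  ultimately show ?thesis
    unfolding deck_group_def using assms(1-3) by (intro conjI ballI allI impI) simp_all
qed

definition cdil :: "real \<Rightarrow> complex^2 \<Rightarrow> complex^2" where
  "cdil c v = vector [complex_of_real (exp c) * v $ 1, complex_of_real (exp (- c)) * v $ 2]"

lemma cdil_simps [simp]: "cdil c v $ 1 = complex_of_real (exp c) * v $ 1"
  "cdil c v $ 2 = complex_of_real (exp (- c)) * v $ 2"
  by (simp_all add: cdil_def)

text \<open>The normal form of the elements of both groups, with \<open>n\<close> and \<open>m\<close> the exponents of the two affine
  generators and \<open>w\<close> the translation that is applied last.\<close>

definition act :: "real \<Rightarrow> real \<Rightarrow> int \<Rightarrow> int \<Rightarrow> complex^2 \<Rightarrow> C3 \<Rightarrow> C3" where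
  "act lam tau n m w z = vector [z $ 1 + Complex (of_int n * lam) (of_int m * tau),
     complex_of_real (exp (of_int n * lam)) * z $ 2 + w $ 1,
     complex_of_real (exp (- (of_int n * lam))) * z $ 3 + w $ 2]"

lemma act_simps [simp]:
  "act lam tau n m w z $ 1 = z $ 1 + Complex (of_int n * lam) (of_int m * tau)"
  "act lam tau n m w z $ 2 = complex_of_real (exp (of_int n * lam)) * z $ 2 + w $ 1"
  "act lam tau n m w z $ 3 = complex_of_real (exp (- (of_int n * lam))) * z $ 3 + w $ 2"
  by (simp_all add: act_def)

lemma act_id: "act lam tau 0 0 0 = id"
  by (simp add: fun_eq_iff vec_eq_iff forall_3 complex_eq_iff)

lemma act_comp:
  "act lam tau n m w \<circ> act lam tau n' m' w' = act lam tau (n + n') (m + m') (cdil (of_int n * lam) w' + w)"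
proof -
  have e: "exp (of_int (n + n') * lam) = exp (of_int n * lam) * exp (of_int n' * lam)"
    "exp (- (of_int (n + n') * lam)) = exp (- (of_int n * lam)) * exp (- (of_int n' * lam))"
    by (simp_all add: algebra_simps flip: exp_add)
  show ?thesis
    by (simp add: fun_eq_iff vec_eq_iff forall_3 complex_eq_iff e del: of_int_add)
      (simp add: algebra_simps)
qed

lemma act_eqI: "n = n' \<Longrightarrow> m = m' \<Longrightarrow> w = w' \<Longrightarrow> act lam tau n m w = act lam tau n' m' w'"
  by simp

lemma act_inv:
  defines "w' w n lam \<equiv> - cdil (of_int (- n) * lam) w"
  shows "bij (act lam tau n m w)" "inv (act lam tau n m w) = act lam tau (- n) (- m) (w' w n lam)"
proof -
  have "act lam tau n m w \<circ> act lam tau (- n) (- m) (w' w n lam) = id"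
    "act lam tau (- n) (- m) (w' w n lam) \<circ> act lam tau n m w = id"
    unfolding act_comp w'_def act_id[of lam tau, symmetric]
    by (rule act_eqI; simp add: vec_eq_iff forall_2 flip: mult.assoc of_real_mult exp_add)+
  then show "bij (act lam tau n m w)" "inv (act lam tau n m w) = act lam tau (- n) (- m) (w' w n lam)"
    by (auto intro: o_bij inv_unique_comp)
qed

definition act_linear :: "real \<Rightarrow> C3 \<Rightarrow> C3" where
  "act_linear c z = vector [z $ 1, complex_of_real (exp c) * z $ 2, complex_of_real (exp (- c)) * z $ 3]"

lemma linear_act_linear: "linear (act_linear c)"
  by (rule linearI) (auto simp: act_linear_def vec_eq_iff forall_3 algebra_simps)

lemma act_affine: "act lam tau n m w = (\<lambda>z. act_linear (of_int n * lam) z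
    + vector [Complex (of_int n * lam) (of_int m * tau), w $ 1, w $ 2])"
  by (simp add: fun_eq_iff vec_eq_iff forall_3 act_linear_def)

lemma smooth_act: "smooth (act lam tau n m w)"
  unfolding act_affine by (rule smooth_affine[OF linear_act_linear])

lemma frechet_act: "frechet_derivative (act lam tau n m w) (at z) = act_linear (of_int n * lam)"
  unfolding act_affine by (rule frechet_derivative_affine[OF linear_act_linear])

lemma complex_lattice_closed:
  assumes "stable_lattice lam K" "stable_lattice lam K'"
  shows "0 \<in> complex_lattice K K'"
    and "w \<in> complex_lattice K K' \<Longrightarrow> v \<in> complex_lattice K K' \<Longrightarrow> w + v \<in> complex_lattice K K'"
    and "w \<in> complex_lattice K K' \<Longrightarrow> - w \<in> complex_lattice K K'"
    and "w \<in> complex_lattice K K' \<Longrightarrow> cdil (of_int n * lam) w \<in> complex_lattice K K'"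
    and "finite {w \<in> complex_lattice K K'. norm w \<le> R}"
proof -
  have mem: "w \<in> complex_lattice K K' \<longleftrightarrow> (\<chi> j. Re (w $ j)) \<in> K \<and> (\<chi> j. Im (w $ j)) \<in> K'" for w
  proof
    assume "w \<in> complex_lattice K K'"
    then show "(\<chi> j. Re (w $ j)) \<in> K \<and> (\<chi> j. Im (w $ j)) \<in> K'"
      by (auto simp: complex_lattice_def)
  next
    assume *: "(\<chi> j. Re (w $ j)) \<in> K \<and> (\<chi> j. Im (w $ j)) \<in> K'"
    have "w = (\<chi> j. Complex ((\<chi> j. Re (w $ j)) $ j) ((\<chi> j. Im (w $ j)) $ j))"
      by (simp add: vec_eq_iff)
    then show "w \<in> complex_lattice K K'" unfolding complex_lattice_def using * by blast
  qed
  have e: "(\<chi> j. Re ((0 :: complex^2) $ j)) = 0" "(\<chi> j. Im ((0 :: complex^2) $ j)) = 0"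
    "(\<chi> j. Re ((w + v) $ j)) = (\<chi> j. Re (w $ j)) + (\<chi> j. Re (v $ j))"
    "(\<chi> j. Im ((w + v) $ j)) = (\<chi> j. Im (w $ j)) + (\<chi> j. Im (v $ j))"
    "(\<chi> j. Re ((- w) $ j)) = - (\<chi> j. Re (w $ j))"
    "(\<chi> j. Im ((- w) $ j)) = - (\<chi> j. Im (w $ j))"
    "(\<chi> j. Re (cdil c w $ j)) = dil c (\<chi> j. Re (w $ j))"
    "(\<chi> j. Im (cdil c w $ j)) = dil c (\<chi> j. Im (w $ j))" for w v :: "complex^2" and c
    by (simp_all add: vec_eq_iff forall_2)
  show "0 \<in> complex_lattice K K'"
    "w \<in> complex_lattice K K' \<Longrightarrow> v \<in> complex_lattice K K' \<Longrightarrow> w + v \<in> complex_lattice K K'"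
    "w \<in> complex_lattice K K' \<Longrightarrow> - w \<in> complex_lattice K K'"
    "w \<in> complex_lattice K K' \<Longrightarrow> cdil (of_int n * lam) w \<in> complex_lattice K K'"
    using assms unfolding mem e stable_lattice_def by blast+
  have "{w \<in> complex_lattice K K'. norm w \<le> R} \<subseteq>
     (\<lambda>(a, b). \<chi> j. Complex (a $ j) (b $ j)) ` ({u \<in> K. norm u \<le> R} \<times> {u \<in> K'. norm u \<le> R})"
  proof
    fix w assume w: "w \<in> {w \<in> complex_lattice K K'. norm w \<le> R}"
    have "norm (\<chi> j. Re (w $ j)) \<le> norm w" "norm (\<chi> j. Im (w $ j)) \<le> norm w"
      by (rule norm_le_componentwise_cart, simp add: abs_Re_le_cmod abs_Im_le_cmod)+
    then show "w \<in> (\<lambda>(a, b). \<chi> j. Complex (a $ j) (b $ j)) ` ({u \<in> K. norm u \<le> R} \<times> {u \<in> K'. norm u \<le> R})"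
      using w mem[of w] by (intro image_eqI[of _ _ "(\<chi> j. Re (w $ j), \<chi> j. Im (w $ j))"]) (auto simp: vec_eq_iff)
  qed
  then show "finite {w \<in> complex_lattice K K'. norm w \<le> R}"
    by (rule finite_subset) (use assms in \<open>auto simp: stable_lattice_def\<close>)
qed

text \<open>The normal forms are closed under composition because conjugation by the first generator
  preserves the lattice, and the second generator is central.\<close>

lemma nak_type_group_eq:
  assumes "stable_lattice lam K" "stable_lattice lam K'"
  shows "nak_type_group lam tau (complex_lattice K K') = {act lam tau n m w |n m w. w \<in> complex_lattice K K'}"
    (is "?G = ?N")
proof -
  let ?L = "complex_lattice K K'"
  note L = complex_lattice_closed[OF assms]
  have gen: "nak_T1 lam = act lam tau 1 0 0" "nak_T2 tau = act lam tau 0 1 0"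
    "translation23 w = act lam tau 0 0 w" for w
    by (simp_all add: fun_eq_iff vec_eq_iff forall_3 nak_T1_def nak_T2_def translation23_def complex_eq_iff)
  let ?S = "{nak_T1 lam, nak_T2 tau} \<union> translation23 ` ?L"
  have comp: "g \<circ> h \<in> ?N" if gh: "g \<in> ?N" "h \<in> ?N" for g h
  proof -
    obtain n m w n' m' w' where "g = act lam tau n m w" "h = act lam tau n' m' w'" "w \<in> ?L" "w' \<in> ?L"
      using gh by blast
    then show ?thesis using L(2)[OF L(4)[of w' n], of w] by (auto simp: act_comp)
  qed
  have inv: "inv g \<in> ?N" if g: "g \<in> ?N" for g
  proof -
    obtain n m w where "g = act lam tau n m w" "w \<in> ?L" using g by blast
    then show ?thesis using L(3)[OF L(4)[of w "- n"]] by (auto simp: act_inv)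
  qed
  have S: "?S \<subseteq> ?N" using L(1) by (auto simp: gen)
  have "g \<in> ?N" if "g \<in> generated_group ?S" for g
    using that
  proof induction
    case 1
    then show ?case using L(1) by (auto simp flip: act_id[of lam tau])
  next
    case (2 s g)
    show ?case by (rule comp[OF subsetD[OF S 2(1)] 2(3)])
  next
    case (3 s g)
    show ?case by (rule comp[OF inv[OF subsetD[OF S 3(1)]] 3(3)])
  qed
  moreover have "act lam tau n m w \<in> generated_group ?S" if w: "w \<in> ?L" for n m w
  proof -
    have step: "act lam tau 0 (i + 1) 0 = nak_T2 tau \<circ> act lam tau 0 i 0"
      "act lam tau 0 (i - 1) 0 = inv (nak_T2 tau) \<circ> act lam tau 0 i 0"
      "act lam tau (i + 1) m 0 = nak_T1 lam \<circ> act lam tau i m 0"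
      "act lam tau (i - 1) m 0 = inv (nak_T1 lam) \<circ> act lam tau i m 0"
      "act lam tau n m w = translation23 w \<circ> act lam tau n m 0" for i n m
      unfolding gen act_inv act_comp by (rule act_eqI; simp add: vec_eq_iff forall_2)+
    have T2: "act lam tau 0 m 0 \<in> generated_group ?S"
    proof (induction m rule: int_induct[where k = 0])
      case base
      show ?case unfolding act_id by (rule generated_group.intros(1))
    next
      case (step1 i)
      show ?case unfolding step by (rule generated_group.intros(2)) (use step1 in auto)
    next
      case (step2 i)
      show ?case unfolding step by (rule generated_group.intros(3)) (use step2 in auto)
    qed
    have T1: "act lam tau n m 0 \<in> generated_group ?S"
    proof (induction n rule: int_induct[where k = 0])
      case base
      then show ?case by (rule T2)
    next
      case (step1 i)
      show ?case unfolding step(3) by (rule generated_group.intros(2)) (use step1 in auto)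
    next
      case (step2 i)
      show ?case unfolding step(4) by (rule generated_group.intros(3)) (use step2 in auto)
    qed
    show ?thesis unfolding step(5)[of n m]
      by (rule generated_group.intros(2)) (use w T1 in auto)
  qed
  ultimately show ?thesis unfolding nak_type_group_def by blast
qed

text \<open>If \<open>act lam tau n m w\<close> moves a point of a ball into the same ball, then the first coordinate
  bounds \<open>n\<close> and \<open>m\<close>. This bounds the dilation factor, and then the other coordinates bound \<open>w\<close>.\<close>

lemma deck_group_nak_type:
  assumes "stable_lattice lam K" "stable_lattice lam K'" and lam: "lam \<noteq> 0" and tau: "tau \<noteq> 0"
  shows "deck_group (nak_type_group lam tau (complex_lattice K K'))"
    and "\<And>g z. g \<in> nak_type_group lam tau (complex_lattice K K') \<Longrightarrow> g z = z \<Longrightarrow> g = id"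
    and "finite {g \<in> nak_type_group lam tau (complex_lattice K K'). \<exists>z. norm z \<le> R \<and> norm (g z) \<le> R}"
proof -
  let ?L = "complex_lattice K K'" let ?G = "nak_type_group lam tau ?L"
  note L = complex_lattice_closed[OF assms(1,2)]
  note G = nak_type_group_eq[OF assms(1,2), of tau]
  show free: "g = id" if gz: "g \<in> ?G" "g z = z" for g z
  proof -
    obtain n m w where g: "g = act lam tau n m w" using gz unfolding G by blast
    have e: "act lam tau n m w z $ i = z $ i" for i using gz g by simp
    have "n = 0" "m = 0" using e[of 1] lam tau by (auto simp: complex_eq_iff)
    moreover from this have "w = 0" using e[of 2] e[of 3] by (simp add: vec_eq_iff forall_2)
    ultimately show ?thesis by (simp add: g act_id)
  qed
  show proper: "finite {g \<in> ?G. \<exists>z. norm z \<le> R \<and> norm (g z) \<le> R}" for R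
  proof -
    let ?n = "{n::int. \<bar>real_of_int n\<bar> \<le> 2 * R / \<bar>lam\<bar>}" and ?m = "{m::int. \<bar>real_of_int m\<bar> \<le> 2 * R / \<bar>tau\<bar>}"
    let ?R = "2 * (R + exp (2 * R) * R)"
    have fin: "finite {n::int. \<bar>real_of_int n\<bar> \<le> c}" for c
    proof -
      have "{n::int. \<bar>real_of_int n\<bar> \<le> c} \<subseteq> {\<lfloor>- c\<rfloor>..\<lceil>c\<rceil>}"
        by (auto simp: abs_le_iff) linarith+
      then show ?thesis by (rule finite_subset) simp
    qed
    have "{g \<in> ?G. \<exists>z. norm z \<le> R \<and> norm (g z) \<le> R} \<subseteq>
        (\<lambda>(n, m, w). act lam tau n m w) ` (?n \<times> ?m \<times> {w \<in> ?L. norm w \<le> ?R})"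
    proof
      fix g assume "g \<in> {g \<in> ?G. \<exists>z. norm z \<le> R \<and> norm (g z) \<le> R}"
      then obtain n m w z where g: "g = act lam tau n m w" "w \<in> ?L" and z: "norm z \<le> R" "norm (g z) \<le> R"
        unfolding G by blast
      have c: "cmod (z $ i) \<le> R" "cmod (g z $ i) \<le> R" for i
        using Finite_Cartesian_Product.norm_nth_le[of z i] Finite_Cartesian_Product.norm_nth_le[of "g z" i] z
        by linarith+
      have "cmod (Complex (of_int n * lam) (of_int m * tau)) \<le> 2 * R"
        using norm_triangle_ineq4[of "g z $ 1" "z $ 1"] c[of 1] by (simp add: g(1))
      then have nl: "\<bar>of_int n * lam\<bar> \<le> 2 * R" and ml: "\<bar>of_int m * tau\<bar> \<le> 2 * R"
        using abs_Re_le_cmod[of "Complex (of_int n * lam) (of_int m * tau)"]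
          abs_Im_le_cmod[of "Complex (of_int n * lam) (of_int m * tau)"] by simp_all
      have R: "0 \<le> R" using z(1) norm_ge_zero[of z] by linarith
      have b: "cmod (complex_of_real (exp x) * u) \<le> exp (2 * R) * R" if "\<bar>x\<bar> \<le> 2 * R" "cmod u \<le> R" for x u
        using that R by (auto simp: norm_mult intro!: mult_mono)
      have w1: "cmod (w $ 1) \<le> R + exp (2 * R) * R"
        using norm_triangle_ineq4[of "g z $ 2" "complex_of_real (exp (of_int n * lam)) * z $ 2"]
          c(2)[of 2] b[OF nl c(1)[of 2]] by (simp add: g(1))
      have w2: "cmod (w $ 2) \<le> R + exp (2 * R) * R"
        using norm_triangle_ineq4[of "g z $ 3" "complex_of_real (exp (- (of_int n * lam))) * z $ 3"]
          c(2)[of 3] b[of "- (of_int n * lam)" "z $ 3"] nl c(1)[of 3] by (simp add: g(1))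
      have nw: "norm w \<le> cmod (w $ 1) + cmod (w $ 2)"
        using L2_set_le_sum[of UNIV "\<lambda>i. cmod (w $ i)"] by (simp add: norm_vec_def sum_2)
      have "norm w \<le> ?R" using order_trans[OF nw add_mono[OF w1 w2]] by (simp only: mult_2)
      moreover have "n \<in> ?n" "m \<in> ?m"
        using nl ml lam tau by (simp_all add: abs_mult field_simps)
      ultimately show "g \<in> (\<lambda>(n, m, w). act lam tau n m w) ` (?n \<times> ?m \<times> {w \<in> ?L. norm w \<le> ?R})"
        using g by (intro image_eqI[of _ _ "(n, m, w)"]) simp_all
    qed
    then show ?thesis
      by (rule finite_subset) (intro finite_imageI finite_cartesian_product fin L(5))
  qed
  show "deck_group ?G"
  proof (rule deck_group_of_proper)
    show "id \<in> ?G" unfolding G using L(1) by (auto simp flip: act_id[of lam tau])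
    show "g \<circ> h \<in> ?G" if gh: "g \<in> ?G" "h \<in> ?G" for g h
    proof -
      obtain n m w n' m' w' where "g = act lam tau n m w" "h = act lam tau n' m' w'" "w \<in> ?L" "w' \<in> ?L"
        using gh unfolding G by blast
      then show ?thesis unfolding G using L(2)[OF L(4)[of w' n], of w] by (auto simp: act_comp)
    qed
    show "bij g \<and> smooth g \<and> inv g \<in> ?G" if g: "g \<in> ?G" for g
    proof -
      obtain n m w where "g = act lam tau n m w" "w \<in> ?L" using g unfolding G by blast
      then show ?thesis unfolding G using L(3)[OF L(4)[of w "- n"]] by (auto simp: act_inv smooth_act)
    qed
  qed (use free proper in auto)
qed

section \<open>Invariant forms and special Lagrangians\<close>

lemma exp_square:
  "exp (complex_of_real x) * exp (of_real x) = of_real (exp (2 * x))"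
  "exp (complex_of_real (- x)) * exp (of_real (- x)) = of_real (exp (- 2 * x))"
  by (simp_all only: exp_of_real of_real_mult[symmetric] exp_add[symmetric]) simp_all

text \<open>The shift of \<open>Re z\<^sub>1\<close> multiplies the exponentials by factors that the linear part of the action
  has to compensate on the constant forms.\<close>

lemma form_on_quotient_expo:
  assumes "\<Gamma> \<subseteq> {act lam tau n m w |n m w. True}"
    and "alt_form k a" "alt_form k b" "alt_form k c"
    and "\<And>x. (\<lambda>vs. a (map (act_linear x) vs)) = a"
    and "\<And>x. (\<lambda>vs. b (map (act_linear x) vs)) = smul (exp (of_real x) * exp (of_real x)) b"
    and "\<And>x. (\<lambda>vs. c (map (act_linear x) vs)) = smul (exp (of_real (- x)) * exp (of_real (- x))) c"
  shows "form_on_quotient \<Gamma> k (expo_form a b c)"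
  unfolding form_on_quotient_def
proof (intro conjI ballI ext)
  show "diff_form k (expo_form a b c)" by (rule diff_form_expo_form[OF assms(2-4)])
  fix g z vs assume "g \<in> \<Gamma>"
  then obtain n m w where g: "g = act lam tau n m w" using assms(1) by blast
  let ?c = "of_int n * lam"
  have s: "a (map (act_linear ?c) vs) = a vs"
    "b (map (act_linear ?c) vs) = complex_of_real (exp (2 * ?c)) * b vs"
    "c (map (act_linear ?c) vs) = complex_of_real (exp (- 2 * ?c)) * c vs"
    using fun_cong[OF assms(5), of ?c vs] fun_cong[OF assms(6), of ?c vs] fun_cong[OF assms(7), of ?c vs]
    by (simp_all only: smul_def exp_square) simp
  have e: "complex_of_real (exp (- 2 * Re (g z $ 1))) * complex_of_real (exp (2 * ?c)) = complex_of_real (exp (- 2 * Re (z $ 1)))"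
    "complex_of_real (exp (2 * Re (g z $ 1))) * complex_of_real (exp (- 2 * ?c)) = complex_of_real (exp (2 * Re (z $ 1)))"
    by (simp_all add: g flip: of_real_mult exp_add)
  show "pullback g (expo_form a b c) z vs = expo_form a b c z vs"
    unfolding pullback_def expo_form_apply g frechet_act s
    using e by (simp only: g mult.assoc[symmetric])
qed

lemma cov_act_linear:
  "(\<lambda>v. dz 1 (act_linear x v)) = dz 1" "(\<lambda>v. dzbar 1 (act_linear x v)) = dzbar 1"
  "(\<lambda>v. dz 2 (act_linear x v)) = (\<lambda>v. exp (of_real x) * dz 2 v)"
  "(\<lambda>v. dzbar 2 (act_linear x v)) = (\<lambda>v. exp (of_real x) * dzbar 2 v)"
  "(\<lambda>v. dz 3 (act_linear x v)) = (\<lambda>v. exp (of_real (- x)) * dz 3 v)"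
  "(\<lambda>v. dzbar 3 (act_linear x v)) = (\<lambda>v. exp (of_real (- x)) * dzbar 3 v)"
  "(\<lambda>v. dx 1 (act_linear x v)) = dx 1" "(\<lambda>v. dy 1 (act_linear x v)) = dy 1"
  "(\<lambda>v. dx 2 (act_linear x v)) = (\<lambda>v. exp (of_real x) * dx 2 v)"
  "(\<lambda>v. dy 2 (act_linear x v)) = (\<lambda>v. exp (of_real x) * dy 2 v)"
  "(\<lambda>v. dx 3 (act_linear x v)) = (\<lambda>v. exp (of_real (- x)) * dx 3 v)"
  "(\<lambda>v. dy 3 (act_linear x v)) = (\<lambda>v. exp (of_real (- x)) * dy 3 v)"
  unfolding exp_of_real by (simp_all add: fun_eq_iff dz_def dzbar_def dx_def dy_def act_linear_def)

lemma exp_cancel: "exp (of_real x) * exp (of_real (- x)) = (1::complex)" "exp (of_real (- x)) * exp (of_real x) = (1::complex)"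
  by (simp_all flip: exp_add)

lemmas act_linear_simps = alt_wedge_map cov_map cov_act_linear cov_smul wedge_linear smul_smul exp_cancel smul_1

lemma nakamura_omega_on_quotient:
  assumes "\<Gamma> \<subseteq> {act lam tau n m w |n m w. True}"
  shows "form_on_quotient \<Gamma> 2 nakamura_omega"
proof -
  have s: "(\<lambda>vs. smul d a (map f vs)) = smul d (\<lambda>vs. a (map f vs))" for d a and f :: "C3 \<Rightarrow> C3"
    by (simp add: smul_def)
  show ?thesis
    unfolding nakamura_omega_eq
    by (rule form_on_quotient_expo[OF assms], (intro alt_form_smul alt_form_kform)+)
      (simp_all only: s kform_def act_linear_simps mult.commute)
qed

lemma nakamura_Omega_on_quotient:
  assumes "\<Gamma> \<subseteq> {act lam tau n m w |n m w. True}"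
  shows "form_on_quotient \<Gamma> 3 nakamura_Omega"
  unfolding nakamura_Omega_eq
proof (rule form_on_quotient_expo[OF assms])
  show "alt_form 3 (alt_wedge (cov (dz 1)) (alt_wedge (cov (dz 2)) (cov (dz 3))))"
    by (intro alt_form_cov3 linear_coordinates)
  show "(\<lambda>vs. alt_wedge (cov (dz 1)) (alt_wedge (cov (dz 2)) (cov (dz 3))) (map (act_linear x) vs)) =
     alt_wedge (cov (dz 1)) (alt_wedge (cov (dz 2)) (cov (dz 3)))" for x
    by (simp only: act_linear_simps)
qed (auto simp: alt_form_0 smul_def fun_eq_iff simp del: zero_fun_def)

lemma mirror_omega_on_quotient:
  assumes "\<Gamma> \<subseteq> {act lam tau n m w |n m w. True}"
  shows "form_on_quotient \<Gamma> 2 mirror_omega"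
  unfolding mirror_omega_eq
proof (rule form_on_quotient_expo[OF assms])
  let ?a = "alt_wedge (cov (dx 1)) (cov (dy 1)) + alt_wedge (cov (dx 3)) (cov (dy 2)) - alt_wedge (cov (dx 2)) (cov (dy 3))"
  show "alt_form 2 ?a"
    by (intro alt_form_add alt_form_diff alt_form_cov2 linear_coordinates)
  have s: "(\<lambda>vs. (a + b) (map f vs)) = (\<lambda>vs. a (map f vs)) + (\<lambda>vs. b (map f vs))"
    "(\<lambda>vs. (a - b) (map f vs)) = (\<lambda>vs. a (map f vs)) - (\<lambda>vs. b (map f vs))"
    for a b :: "C3 list \<Rightarrow> complex" and f :: "C3 \<Rightarrow> C3"
    by (simp_all add: fun_eq_iff)
  show "(\<lambda>vs. ?a (map (act_linear x) vs)) = ?a" for x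
    by (simp only: s act_linear_simps)
qed (auto simp: alt_form_0 smul_def fun_eq_iff)

text \<open>Products of real forms are real. The special Lagrangian conditions and the computation of the
  real part of the mirror 3-form come down to this.\<close>

lemma real_wedge:
  assumes "\<And>vs. Im (a vs) = 0" "\<And>vs. Im (b vs) = 0"
  shows "Im (alt_wedge a b vs) = 0"
  using assms
proof (induction vs arbitrary: a b)
  case (Cons v vs)
  have "Im ((-1) ^ length ws * a ws) = 0" for ws
    using Cons.prems(1)[of ws] by (cases "even (length ws)") simp_all
  then show ?case using Cons.prems by (simp add: Cons.IH)
qed simp

lemma real_cov: "(\<And>v. Im (f v) = 0) \<Longrightarrow> Im (cov f vs) = 0"
  by (simp add: cov_def split: list.splits)

lemma cov_wedge_cov3:
  "alt_wedge (cov f) (alt_wedge (cov g) (cov h)) [u, v, w] =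
     f u * (g v * h w - g w * h v) - f v * (g u * h w - g w * h u) + f w * (g u * h v - g v * h u)"
  by (subst cov_wedge) (simp add: cov_wedge_cov lessThan_Suc)

lemma sum3_pos:
  fixes a b c :: real
  shows "0 \<le> a \<Longrightarrow> 0 \<le> b \<Longrightarrow> 0 \<le> c \<Longrightarrow> a \<noteq> 0 \<or> b \<noteq> 0 \<or> c \<noteq> 0 \<Longrightarrow> 0 < a + b + c"
  by linarith

text \<open>Nondegeneracy is shown by a compatible complex structure: the vector \<open>w\<close> in the proof is the
  image of \<open>v\<close>, so that the pairing is the squared Euclidean norm of \<open>v\<close>.\<close>

lemma symplectic_mirror:
  assumes "deck_group \<Gamma>" "\<Gamma> \<subseteq> {act lam tau n m w |n m w. True}"
  shows "symplectic_manifold \<Gamma> mirror_omega"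
  unfolding symplectic_manifold_def
proof (intro conjI allI impI)
  show "deck_group \<Gamma>" by fact
  show "form_on_quotient \<Gamma> 2 mirror_omega" by (rule mirror_omega_on_quotient[OF assms(2)])
  show "closed_form mirror_omega" by (rule closed_mirror_omega)
  show "real_form mirror_omega"
    unfolding real_form_def mirror_omega_eq expo_form_apply
    by (auto simp: real_wedge real_cov dx_def dy_def)
  fix z v :: C3
  assume "v \<noteq> 0"
  define w :: C3 where "w = vector [Complex (- Im (v $ 1)) (Re (v $ 1)), Complex (Im (v $ 3)) (Re (v $ 3)),
      Complex (- Im (v $ 2)) (- Re (v $ 2))]"
  define N where "N = (cmod (v $ 1))\<^sup>2 + (cmod (v $ 2))\<^sup>2 + (cmod (v $ 3))\<^sup>2"
  have "mirror_omega z [v, w] = complex_of_real N"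
    by (simp add: N_def mirror_omega_eq expo_form_apply cov_wedge_cov dx_def dy_def w_def cmod_power2)
      (simp add: power2_eq_square)
  moreover have "N > 0"
  proof -
    obtain i where "v $ i \<noteq> 0" using \<open>v \<noteq> 0\<close> by (auto simp: vec_eq_iff)
    then have "v $ 1 \<noteq> 0 \<or> v $ 2 \<noteq> 0 \<or> v $ 3 \<noteq> 0" using exhaust_3[of i] by auto
    then show ?thesis unfolding N_def by (intro sum3_pos) simp_all
  qed
  ultimately have "mirror_omega z [v, w] \<noteq> 0" by simp
  then show "\<exists>w. mirror_omega z [v, w] \<noteq> 0" ..
qed

lemma hermitian_nakamura:
  assumes "deck_group \<Gamma>" "\<Gamma> \<subseteq> {act lam tau n m w |n m w. True}"
  shows "hermitian_cy_manifold \<Gamma> nakamura_omega nakamura_Omega"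
  unfolding hermitian_cy_manifold_def
proof (intro conjI allI impI ballI)
  show "deck_group \<Gamma>" by fact
  show "form_on_quotient \<Gamma> 2 nakamura_omega" by (rule nakamura_omega_on_quotient[OF assms(2)])
  show "form_on_quotient \<Gamma> 3 nakamura_Omega" by (rule nakamura_Omega_on_quotient[OF assms(2)])
  show "closed_form nakamura_Omega" by (rule closed_nakamura_Omega)
  show "frechet_derivative g (at z) (\<i> *s v) = \<i> *s frechet_derivative g (at z) v" if "g \<in> \<Gamma>" for g z v
  proof -
    obtain n m w where "g = act lam tau n m w" using \<open>g \<in> \<Gamma>\<close> assms(2) by blast
    then show ?thesis by (simp add: frechet_act act_linear_def vec_eq_iff forall_3)
  qed
  have k: "Im (\<i> * kform j vs) = 0" for j vs
    by (auto simp: kform_apply complex_eq_iff split: list.splits)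
  have k': "Re (kform j vs) = 0" for j vs
    using k[of j vs] by simp
  show "real_form nakamura_omega"
    unfolding real_form_def nakamura_omega_eq expo_form_apply smul_def by (simp add: k')
  show "nakamura_omega z [\<i> *s v, \<i> *s w] = nakamura_omega z [v, w]" for z v w
  proof -
    have "kform j [\<i> *s v, \<i> *s w] = kform j [v, w]" for j
      by (simp add: kform_apply complex_eq_iff algebra_simps)
    then show ?thesis unfolding nakamura_omega_eq expo_form_apply smul_def by simp
  qed
  show "0 < Re (nakamura_omega z [v, \<i> *s v])" if "v \<noteq> 0" for z v
  proof -
    have kv: "\<i> / 2 * kform j [v, \<i> *s v] = complex_of_real ((cmod (v $ j))\<^sup>2)" for j
      unfolding complex_norm_square by (simp add: kform_apply algebra_simps)
    have "Re (nakamura_omega z [v, \<i> *s v]) = (cmod (v $ 1))\<^sup>2 + exp (- 2 * Re (z $ 1)) * (cmod (v $ 2))\<^sup>2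
        + exp (2 * Re (z $ 1)) * (cmod (v $ 3))\<^sup>2"
      unfolding nakamura_omega_eq expo_form_apply smul_def kv by (simp flip: of_real_mult)
    moreover obtain i where "v $ i \<noteq> 0" using \<open>v \<noteq> 0\<close> by (auto simp: vec_eq_iff)
    then have "v $ 1 \<noteq> 0 \<or> v $ 2 \<noteq> 0 \<or> v $ 3 \<noteq> 0" using exhaust_3[of i] by auto
    then have "0 < (cmod (v $ 1))\<^sup>2 + exp (- 2 * Re (z $ 1)) * (cmod (v $ 2))\<^sup>2
        + exp (2 * Re (z $ 1)) * (cmod (v $ 3))\<^sup>2" by (intro sum3_pos) simp_all
    ultimately show ?thesis by simp
  qed
  have O: "nakamura_Omega z [u, v, w] =
      u $ 1 * (v $ 2 * w $ 3 - w $ 2 * v $ 3) - v $ 1 * (u $ 2 * w $ 3 - w $ 2 * u $ 3)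
      + w $ 1 * (u $ 2 * v $ 3 - v $ 2 * u $ 3)" for z u v w
    unfolding nakamura_Omega_eq expo_form_apply cov_wedge_cov3 by (simp add: dz_def)
  show "nakamura_Omega z [\<i> *s u, v, w] = \<i> * nakamura_Omega z [u, v, w]" for z u v w
    unfolding O by (simp add: algebra_simps)
  show "\<exists>vs. nakamura_Omega z vs \<noteq> 0" for z
    by (rule exI[of _ "[axis 1 1, axis 2 1, axis 3 1]"]) (simp add: O axis_def)
qed

lemma dz_slice_chart:
  "(d_fibre j + fscale \<i> (d_base j)) p = cov (\<lambda>v. \<i> * dz j (slice_chart v))"
  by (auto simp: fun_eq_iff d_fibre_eq d_base_eq fscale_def cov_def slice_chart_def dz_def
      complex_eq_iff split: list.splits)

text \<open>The chart satisfies \<open>s\<^sub>j + \<i> r\<^sub>j = \<i> z\<^sub>j\<close>, so the semi-flat volume form is \<open>\<i>\<^sup>3 = - \<i>\<close> times the pullback of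
  the volume form, and the constant phase is \<open>\<i>\<close>.\<close>

lemma nakamura_semiflat_complex:
  assumes "quotient_diffeo (tangent_group G A) \<Gamma> slice_chart"
  shows "semiflat_complex_side G A \<Gamma> nakamura_Omega slice_chart"
  unfolding semiflat_complex_side_def
proof (intro conjI allI exI[of _ \<i>])
  show "frechet_derivative slice_chart (at p) (semiflat_J v) = \<i> *s frechet_derivative slice_chart (at p) v" for p v
    unfolding frechet_derivative_linear[OF linear_slice_chart]
    by (cases v) (simp add: slice_chart_def semiflat_J_def vec_eq_iff complex_eq_iff)
  show "pullback slice_chart nakamura_Omega = fscale \<i> semiflat_volume"
    by (intro ext) (simp add: pullback_def frechet_derivative_linear[OF linear_slice_chart] nakamura_Omega_eq
        expo_form_apply semiflat_volume_def fscale_def[of \<i> semiflat_volume] fscale_def[of _ "_ \<and>\<^sub>d _"] wedge_def dz_slice_chart alt_wedge_map cov_map cov_smul wedge_linear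
        del: plus_fun_apply, simp add: smul_def)
qed (use assms in auto)

lemma slice_special_lagrangian: "special_lagrangian 1 cvec nakamura_omega nakamura_Omega"
proof -
  have lin: "linear cvec" by (rule linearI) (auto simp: cvec_def vec_eq_iff complex_eq_iff)
  have k: "kform j (map cvec vs) = 0" for j vs
    by (auto simp: kform_apply cvec_def mult.commute split: list.splits)
  have "Im (alt_wedge (cov (dz 1)) (alt_wedge (cov (dz 2)) (cov (dz 3))) (map cvec vs)) = 0" for vs
    unfolding alt_wedge_map cov_map by (intro real_wedge real_cov) (simp_all add: dz_def cvec_def)
  then show ?thesis
    unfolding special_lagrangian_def pullback_def nakamura_omega_eq nakamura_Omega_eq
      frechet_derivative_linear[OF lin]
    by (auto simp: fun_eq_iff expo_form_apply smul_def k Im_form_def fscale_def)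
qed

text \<open>On the fibres \<open>dz\<^sub>j = - \<i> ds\<^sub>j\<close>, which turns the volume form into \<open>(- \<i>)\<^sup>3 = \<i>\<close> times a real form; a
  further factor \<open>\<i>\<close> makes it real.\<close>

lemma fibre_special_lagrangian: "special_lagrangian \<i> (\<lambda>s. slice_chart (r, s)) nakamura_omega nakamura_Omega"
proof -
  let ?L = "\<lambda>s. slice_chart (0, s)"
  have lin: "linear ?L" by (rule linearI) (auto simp: slice_chart_def vec_eq_iff complex_eq_iff)
  have e: "(\<lambda>s. slice_chart (r, s)) = (\<lambda>s. ?L s + slice_chart (r, 0))"
    by (auto simp: slice_chart_def vec_eq_iff complex_eq_iff)
  have d: "frechet_derivative (\<lambda>s. slice_chart (r, s)) (at s) = ?L" for s
    unfolding e by (rule frechet_derivative_affine[OF lin])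
  have k: "kform j (map ?L vs) = 0" for j vs
    by (auto simp: kform_apply slice_chart_def complex_eq_iff mult.commute split: list.splits)
  have c: "cov (\<lambda>v. dz j (?L v)) = smul (- \<i>) (cov (\<lambda>v. complex_of_real (v $ j)))" for j
    unfolding cov_smul[symmetric] by (rule arg_cong[of _ _ cov]) (auto simp: fun_eq_iff dz_def slice_chart_def complex_eq_iff)
  have "Im (alt_wedge (cov (\<lambda>v::R3. complex_of_real (v $ 1))) (alt_wedge (cov (\<lambda>v. complex_of_real (v $ 2))) (cov (\<lambda>v. complex_of_real (v $ 3)))) vs) = 0" for vs
    by (intro real_wedge real_cov) simp_all
  then have "Im (\<i> * alt_wedge (cov (dz 1)) (alt_wedge (cov (dz 2)) (cov (dz 3))) (map ?L vs)) = 0" for vs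
    unfolding alt_wedge_map cov_map c wedge_linear by (simp add: smul_def)
  then show ?thesis
    unfolding special_lagrangian_def pullback_def nakamura_omega_eq nakamura_Omega_eq d
    by (auto simp: fun_eq_iff expo_form_apply smul_def k Im_form_def fscale_def simp del: mult_cancel_left)
qed

section \<open>The mirror three-form\<close>

text \<open>\<open>\<kappa>\<close> times the product of the one-forms \<open>\<i> h\<^sub>j dr\<^sub>j + dt\<^sub>j\<close>, \<open>j = 1, 2, 3\<close>, with \<open>t = (- y\<^sub>1, y\<^sub>3, - y\<^sub>2)\<close>, expanded by powers of the
  exponential with the help of \<open>h\<^sub>2 h\<^sub>3 = 1\<close>; here \<open>\<theta>\<close> is the factor with \<open>j = 1\<close>.\<close>

definition mirror_Omega :: "real \<Rightarrow> C3 form" where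
  "mirror_Omega \<kappa> = (let \<theta> = smul \<i> (cov (dx 1)) - cov (dy 1) in expo_form
     (smul \<kappa> (alt_wedge (cov (dx 3)) (alt_wedge (cov (dx 2)) \<theta>) + alt_wedge (cov (dy 2)) (alt_wedge (cov (dy 3)) \<theta>)))
     (smul (\<i> * \<kappa>) (alt_wedge (cov (dy 2)) (alt_wedge (cov (dx 2)) \<theta>)))
     (smul (- \<i> * \<kappa>) (alt_wedge (cov (dx 3)) (alt_wedge (cov (dy 3)) \<theta>))))"

lemma mirror_Omega_on_quotient:
  assumes "\<Gamma> \<subseteq> {act lam tau n m w |n m w. True}"
  shows "form_on_quotient \<Gamma> 3 (mirror_Omega \<kappa>)"
proof -
  have s: "(\<lambda>vs. smul d a (map f vs)) = smul d (\<lambda>vs. a (map f vs))"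
    "(\<lambda>vs. (a + b) (map f vs)) = (\<lambda>vs. a (map f vs)) + (\<lambda>vs. b (map f vs))"
    "(\<lambda>vs. (a - b) (map f vs)) = (\<lambda>vs. a (map f vs)) - (\<lambda>vs. b (map f vs))"
    for d and a b :: "C3 list \<Rightarrow> complex" and f :: "C3 \<Rightarrow> C3"
    by (simp_all add: fun_eq_iff smul_def)
  show ?thesis
    unfolding mirror_Omega_def Let_def
  proof (rule form_on_quotient_expo[OF assms], goal_cases)
    case 1 show ?case unfolding wedge_linear
      by (intro alt_form_smul alt_form_add alt_form_diff alt_form_cov3 linear_coordinates)
  next
    case 2 show ?case unfolding wedge_linear
      by (intro alt_form_smul alt_form_add alt_form_diff alt_form_cov3 linear_coordinates)
  next
    case 3 show ?case unfolding wedge_linear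
      by (intro alt_form_smul alt_form_add alt_form_diff alt_form_cov3 linear_coordinates)
  next
    case (4 x) show ?case by (simp only: s act_linear_simps)
  next
    case (5 x) show ?case by (simp only: s act_linear_simps) (simp add: smul_def fun_eq_iff algebra_simps)
  next
    case (6 x) show ?case by (simp only: s act_linear_simps) (simp add: smul_def fun_eq_iff algebra_simps)
  qed
qed

text \<open>In the real part, the imaginary coefficients of the two exponentials select the imaginary
  summand \<open>\<i> dx\<^sub>1\<close> of the factor \<open>\<theta>\<close>, so both terms contain \<open>dx\<^sub>1\<close>.\<close>

lemma closed_Re_mirror_Omega: "closed_form (Re_form (mirror_Omega \<kappa>))"
proof -
  have real: "Im (alt_wedge (cov f) (alt_wedge (cov g) (cov h)) vs) = 0"
    if "f \<in> range dx \<union> range dy" "g \<in> range dx \<union> range dy" "h \<in> range dx \<union> range dy"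
    for f g h and vs :: "C3 list"
    using that by (intro real_wedge real_cov) (auto simp: dx_def dy_def)
  have eq: "Re_form (mirror_Omega \<kappa>) = expo_form
     (\<lambda>vs. Re (\<kappa> * (alt_wedge (cov (dx 3)) (alt_wedge (cov (dx 2)) (smul \<i> (cov (dx 1)) - cov (dy 1))) vs
        + alt_wedge (cov (dy 2)) (alt_wedge (cov (dy 3)) (smul \<i> (cov (dx 1)) - cov (dy 1))) vs)))
     (smul (- \<kappa>) (alt_wedge (cov (dy 2)) (alt_wedge (cov (dx 2)) (cov (dx 1)))))
     (smul \<kappa> (alt_wedge (cov (dx 3)) (alt_wedge (cov (dy 3)) (cov (dx 1)))))"
    unfolding mirror_Omega_def Let_def wedge_linear
    by (intro ext) (simp add: Re_form_def expo_form_apply smul_def real complex_eq_iff algebra_simps)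
  show ?thesis
    unfolding eq by (rule closed_expo_form; simp only: wedge_linear cov_absorb; simp add: smul_def fun_eq_iff)
qed

text \<open>The identification of \<open>T\<^sup>*B\<close> with the cover of the mirror, obtained by solving
  \<open>t = (- Im z\<^sub>1, Im z\<^sub>3, - Im z\<^sub>2)\<close> for \<open>z\<close>.\<close>

definition mirror_chart :: "R3 \<times> R3 \<Rightarrow> C3" where
  "mirror_chart = (\<lambda>(r, t). vector [Complex (r $ 1) (- t $ 1), Complex (r $ 2) (- t $ 3), Complex (r $ 3) (t $ 2)])"

lemma mirror_chart_simps [simp]:
  "mirror_chart v $ 1 = Complex (fst v $ 1) (- snd v $ 1)"
  "mirror_chart v $ 2 = Complex (fst v $ 2) (- snd v $ 3)"
  "mirror_chart v $ 3 = Complex (fst v $ 3) (snd v $ 2)"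
  by (simp_all add: mirror_chart_def case_prod_unfold)

lemma linear_mirror_chart: "linear mirror_chart"
  by (rule linearI) (auto simp: vec_eq_iff forall_3 complex_eq_iff)

lemma mirror_chart_cov:
  "(\<lambda>v. dx 1 (mirror_chart v)) = (\<lambda>v. complex_of_real (fst v $ 1))"
  "(\<lambda>v. dx 2 (mirror_chart v)) = (\<lambda>v. complex_of_real (fst v $ 2))"
  "(\<lambda>v. dx 3 (mirror_chart v)) = (\<lambda>v. complex_of_real (fst v $ 3))"
  "(\<lambda>v. dy 1 (mirror_chart v)) = (\<lambda>v. - complex_of_real (snd v $ 1))"
  "(\<lambda>v. dy 2 (mirror_chart v)) = (\<lambda>v. - complex_of_real (snd v $ 3))"
  "(\<lambda>v. dy 3 (mirror_chart v)) = (\<lambda>v. complex_of_real (snd v $ 2))"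
  by (simp_all add: fun_eq_iff dx_def dy_def)

lemma pullback_mirror_omega: "pullback mirror_chart mirror_omega = canonical_symplectic"
proof (intro ext)
  fix p :: "R3 \<times> R3" and vs
  have c: "d_fibre j p = cov (\<lambda>v. complex_of_real (snd v $ j))" "d_base j p = cov (\<lambda>v. complex_of_real (fst v $ j))" for j
    by (auto simp: fun_eq_iff d_fibre_eq d_base_eq cov_def split: list.splits)
  show "pullback mirror_chart mirror_omega p vs = canonical_symplectic p vs"
    unfolding pullback_def frechet_derivative_linear[OF linear_mirror_chart] mirror_omega_eq expo_form_apply
      canonical_symplectic_def sum_3 plus_fun_apply wedge_def c
    by (simp add: alt_wedge_map cov_map mirror_chart_cov cov_wedge_cov dx_def dy_def split: list.splits)
qed

text \<open>Both sides are the expansion of the same product. The product of the exponential factors of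
  the second and third one-form is one, which produces the constant term.\<close>

lemma pullback_mirror_Omega:
  "pullback mirror_chart (mirror_Omega (fibre_volume A)) =
     FT A (pullback slice_chart (fexp (fscale 2 nakamura_omega)))"
proof (intro ext)
  fix p :: "R3 \<times> R3" and vs
  obtain r t where p: "p = (r, t)" by (cases p)
  let ?r = "\<lambda>j. cov (\<lambda>v::R3\<times>R3. complex_of_real (fst v $ j))" and ?t = "\<lambda>j. cov (\<lambda>v::R3\<times>R3. complex_of_real (snd v $ j))"
  define h k where "h = complex_of_real (exp (- 2 * r $ 1))" and "k = complex_of_real (exp (2 * r $ 1))"
  have e: "h * k = 1"
    by (simp add: h_def k_def flip: of_real_mult exp_add)
  define \<theta> where "\<theta> = smul \<i> (?r 1) + ?t 1"
  have ht: "complex_of_real (height r 1) = 1" "complex_of_real (height r 2) = h" "complex_of_real (height r 3) = k"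
    by (simp_all add: height_def h_def k_def)
  have c: "cov (\<lambda>v. - (\<i> * complex_of_real (height r j) * complex_of_real (fst v $ j) + complex_of_real (snd v $ j)))
      = - (smul (\<i> * complex_of_real (height r j)) (?r j) + ?t j)" for j
    by (simp only: cov_uminus cov_add cov_smul)
  have s: "(\<lambda>vs. (a - b) (map f vs)) = (\<lambda>vs. a (map f vs)) - (\<lambda>vs. b (map f vs))"
    "(\<lambda>vs. smul d a (map f vs)) = smul d (\<lambda>vs. a (map f vs))"
    for d and a b :: "C3 list \<Rightarrow> complex" and f :: "R3 \<times> R3 \<Rightarrow> C3"
    by (simp_all add: fun_eq_iff smul_def)
  have "FT A (pullback slice_chart (fexp (fscale 2 nakamura_omega))) p vs =
    smul (fibre_volume A) (- alt_wedge (smul (\<i> * k) (?r 3) + ?t 3) (alt_wedge (smul (\<i> * h) (?r 2) + ?t 2) \<theta>)) vs"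
    unfolding p FT_nakamura c unfolding ht \<theta>_def
    by (simp only: wedge_uminus_left wedge_uminus_right mult_1_right minus_minus)
  also have "\<dots> = fibre_volume A * (alt_wedge (?r 3) (alt_wedge (?r 2) \<theta>) vs - alt_wedge (?t 3) (alt_wedge (?t 2) \<theta>) vs)
     - \<i> * fibre_volume A * h * alt_wedge (?t 3) (alt_wedge (?r 2) \<theta>) vs
     - \<i> * fibre_volume A * k * alt_wedge (?r 3) (alt_wedge (?t 2) \<theta>) vs"
  proof -
    have gen: "K * - (\<i> * k * (\<i> * h * x + y) + (\<i> * h * z + w)) = K * (x - w) - \<i> * K * h * z - \<i> * K * k * y"
      for K x y z w :: complex
    proof -
      have "K * - (\<i> * k * (\<i> * h * x + y) + (\<i> * h * z + w)) = K * - (\<i> * \<i> * (h * k) * x + \<i> * k * y + (\<i> * h * z + w))"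
        by (simp only: distrib_left mult_ac)
      then show ?thesis unfolding e by (simp add: algebra_simps)
    qed
    show ?thesis
      unfolding gen[symmetric] by (simp only: wedge_linear) (simp add: smul_def algebra_simps)
  qed
  also have "\<dots> = pullback mirror_chart (mirror_Omega (fibre_volume A)) p vs"
  proof -
    define \<Theta> where "\<Theta> = smul \<i> (cov (dx 1)) - cov (dy 1)"
    have \<Theta>: "(\<lambda>vs. \<Theta> (map mirror_chart vs)) = \<theta>"
      unfolding \<Theta>_def \<theta>_def s cov_map mirror_chart_cov cov_uminus by simp
    have ap: "smul d a us = d * a us" for d us and a :: "'z list \<Rightarrow> complex"
      by (simp add: smul_def)
    have z: "complex_of_real (exp (- 2 * Re (mirror_chart (r, t) $ 1))) = h"
      "complex_of_real (exp (2 * Re (mirror_chart (r, t) $ 1))) = k"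
      by (simp_all add: h_def k_def)
    show ?thesis
      unfolding pullback_def frechet_derivative_linear[OF linear_mirror_chart] mirror_Omega_def Let_def
        expo_form_apply p z \<Theta>_def[symmetric]
      by (simp only: ap plus_fun_apply alt_wedge_map cov_map mirror_chart_cov \<Theta> cov_uminus wedge_uminus_left
          wedge_uminus_right uminus_apply) (simp add: algebra_simps)
  qed
  finally show "pullback mirror_chart (mirror_Omega (fibre_volume A)) p vs =
     FT A (pullback slice_chart (fexp (fscale 2 nakamura_omega))) p vs" ..
qed

section \<open>The base and the two torus bundles\<close>

text \<open>The restriction of \<open>act\<close> to the real slice.\<close>

definition slice_act :: "real \<Rightarrow> int \<Rightarrow> real^2 \<Rightarrow> R3 \<Rightarrow> R3" where
  "slice_act lam n a r = vector [r $ 1 + of_int n * lam, exp (of_int n * lam) * r $ 2 + a $ 1,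
     exp (- (of_int n * lam)) * r $ 3 + a $ 2]"

definition rdil :: "real \<Rightarrow> R3 \<Rightarrow> R3" where
  "rdil c v = vector [v $ 1, exp c * v $ 2, exp (- c) * v $ 3]"

lemma slice_act_simps [simp]:
  "slice_act lam n a r $ 1 = r $ 1 + of_int n * lam"
  "slice_act lam n a r $ 2 = exp (of_int n * lam) * r $ 2 + a $ 1"
  "slice_act lam n a r $ 3 = exp (- (of_int n * lam)) * r $ 3 + a $ 2"
  by (simp_all add: slice_act_def)

lemma rdil_simps [simp]: "rdil c v $ 1 = v $ 1" "rdil c v $ 2 = exp c * v $ 2"
  "rdil c v $ 3 = exp (- c) * v $ 3"
  by (simp_all add: rdil_def)

lemma linear_rdil: "linear (rdil c)"
  by (rule linearI) (auto simp: vec_eq_iff forall_3 algebra_simps)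

lemma rdil_rdil: "rdil c (rdil d v) = rdil (c + d) v" "rdil 0 v = v"
  by (simp_all add: vec_eq_iff forall_3 mult.assoc[symmetric] exp_add[symmetric] add.commute)

lemma slice_act_affine: "slice_act lam n a =
    (\<lambda>r. rdil (of_int n * lam) r + vector [of_int n * lam, a $ 1, a $ 2])"
  by (simp add: fun_eq_iff vec_eq_iff forall_3)

lemma smooth_slice_act: "smooth (slice_act lam n a)"
  unfolding slice_act_affine by (rule smooth_affine[OF linear_rdil])

lemma frechet_slice_act: "frechet_derivative (slice_act lam n a) (at r) = rdil (of_int n * lam)"
  unfolding slice_act_affine by (rule frechet_derivative_affine[OF linear_rdil])

lemma slice_act_inv:
  "bij (slice_act lam n a)"
  "inv (slice_act lam n a) = slice_act lam (- n) (- dil (of_int (- n) * lam) a)"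
proof -
  have "slice_act lam n a \<circ> slice_act lam (- n) (- dil (of_int (- n) * lam) a) = id"
    "slice_act lam (- n) (- dil (of_int (- n) * lam) a) \<circ> slice_act lam n a = id"
    by (simp_all add: fun_eq_iff vec_eq_iff forall_3 right_diff_distrib distrib_left
        flip: mult.assoc exp_add)
  then show "bij (slice_act lam n a)"
    "inv (slice_act lam n a) = slice_act lam (- n) (- dil (of_int (- n) * lam) a)"
    by (auto intro: o_bij inv_unique_comp)
qed

text \<open>An element preserves the real slice only if its translations are real; conversely every real
  translation vector extends by zero imaginary part.\<close>

lemma real_slice_group_eq:
  assumes st: "stable_lattice lam K" "stable_lattice lam K'" and tau: "tau \<noteq> 0"
  shows "real_slice_group (nak_type_group lam tau (complex_lattice K K')) =
    {slice_act lam n a |n a. a \<in> K}"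
proof (intro set_eqI iffI)
  fix g assume "g \<in> real_slice_group (nak_type_group lam tau (complex_lattice K K'))"
  then obtain n m w where w: "w \<in> complex_lattice K K'" and "\<forall>r. act lam tau n m w (cvec r) = cvec (g r)"
    unfolding real_slice_group_def nak_type_group_eq[OF st] by blast
  moreover from w obtain a b where a: "a \<in> K" and "w = (\<chi> j. Complex (a $ j) (b $ j))"
    unfolding complex_lattice_def by blast
  ultimately have g: "act lam tau n m (\<chi> j. Complex (a $ j) (b $ j)) (cvec r) = cvec (g r)" for r
    by simp
  have "g r $ i = Re (act lam tau n m (\<chi> j. Complex (a $ j) (b $ j)) (cvec r) $ i)" for r i
    unfolding g by (simp add: cvec_def)
  then have "g r = slice_act lam n a r" for r
    by (simp add: vec_eq_iff forall_3 cvec_def)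
  then show "g \<in> {slice_act lam n a |n a. a \<in> K}" using a by blast
next
  fix g assume "g \<in> {slice_act lam n a |n a. a \<in> K}"
  then obtain n a where g: "g = slice_act lam n a" "a \<in> K" by blast
  have "0 \<in> K'" using st by (simp add: stable_lattice_def)
  then have "(\<chi> j. Complex (a $ j) (0 $ j)) \<in> complex_lattice K K'"
    unfolding complex_lattice_def using g(2) by blast
  moreover have "act lam tau n 0 (\<chi> j. Complex (a $ j) (0 $ j)) (cvec r) = cvec (g r)" for r
    by (simp add: vec_eq_iff forall_3 cvec_def g complex_eq_iff)
  ultimately show "g \<in> real_slice_group (nak_type_group lam tau (complex_lattice K K'))"
    unfolding real_slice_group_def nak_type_group_eq[OF st] by blast
qed

lemma norm_cvec: "norm (cvec r) = norm r"
  by (simp add: norm_vec_def cvec_def)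

lemma cvec_inj: "cvec r = cvec r' \<longleftrightarrow> r = r'"
  by (auto simp: cvec_def vec_eq_iff)

text \<open>Freeness and properness are inherited from the ambient group, since the slice is embedded
  isometrically.\<close>

lemma deck_group_real_slice:
  assumes st: "stable_lattice lam K" "stable_lattice lam K'" and lam: "lam \<noteq> 0" and tau: "tau \<noteq> 0"
  shows "deck_group (real_slice_group (nak_type_group lam tau (complex_lattice K K')))"
proof -
  let ?\<Gamma> = "nak_type_group lam tau (complex_lattice K K')" let ?G = "real_slice_group ?\<Gamma>"
  note G = real_slice_group_eq[OF st tau]
  have deck: "deck_group ?\<Gamma>" by (rule deck_group_nak_type(1)[OF assms])
  show ?thesis
  proof (rule deck_group_of_proper)
    have "id \<in> ?\<Gamma>" using deck unfolding deck_group_def by (elim conjE)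
    then show "id \<in> ?G" unfolding real_slice_group_def by (auto intro: bexI[of _ id])
    show "g \<circ> h \<in> ?G" if gh: "g \<in> ?G" "h \<in> ?G" for g h
    proof -
      obtain \<gamma> \<delta> where "\<gamma> \<in> ?\<Gamma>" "\<delta> \<in> ?\<Gamma>" "\<And>r. \<gamma> (cvec r) = cvec (g r)" "\<And>r. \<delta> (cvec r) = cvec (h r)"
        using gh unfolding real_slice_group_def by blast
      moreover from this have "\<gamma> \<circ> \<delta> \<in> ?\<Gamma>" using deck unfolding deck_group_def by (elim conjE) simp
      ultimately show ?thesis unfolding real_slice_group_def by (auto intro!: bexI[of _ "\<gamma> \<circ> \<delta>"])
    qed
    show "bij g \<and> smooth g \<and> inv g \<in> ?G" if g: "g \<in> ?G" for g
    proof -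
      obtain n a where g: "g = slice_act lam n a" "a \<in> K" using g unfolding G by blast
      have "- dil (of_int (- n) * lam) a \<in> K" using st(1) g(2) unfolding stable_lattice_def by blast
      then show ?thesis unfolding G g(1) using slice_act_inv smooth_slice_act by blast
    qed
    show "g = id" if g: "g \<in> ?G" "g r = r" for g r
    proof -
      obtain \<gamma> where \<gamma>: "\<gamma> \<in> ?\<Gamma>" "\<And>r. \<gamma> (cvec r) = cvec (g r)"
        using g(1) unfolding real_slice_group_def by blast
      have "\<gamma> = id" using deck_group_nak_type(2)[OF assms \<gamma>(1), of "cvec r"] \<gamma>(2)[of r] g(2) by simp
      then show ?thesis using \<gamma>(2) by (auto simp: cvec_inj fun_eq_iff)
    qed
    show "finite {g \<in> ?G. \<exists>r. norm r \<le> R \<and> norm (g r) \<le> R}" for R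
    proof -
      have "{g \<in> ?G. \<exists>r. norm r \<le> R \<and> norm (g r) \<le> R} \<subseteq>
         (\<lambda>\<gamma> r. \<chi> j. Re (\<gamma> (cvec r) $ j)) ` {g \<in> ?\<Gamma>. \<exists>z. norm z \<le> R \<and> norm (g z) \<le> R}"
      proof
        fix g assume g: "g \<in> {g \<in> ?G. \<exists>r. norm r \<le> R \<and> norm (g r) \<le> R}"
        then obtain \<gamma> r where \<gamma>: "\<gamma> \<in> ?\<Gamma>" "\<And>r. \<gamma> (cvec r) = cvec (g r)" and r: "norm r \<le> R" "norm (g r) \<le> R"
          unfolding real_slice_group_def by blast
        have "g = (\<lambda>r. \<chi> j. Re (\<gamma> (cvec r) $ j))" unfolding \<gamma>(2) by (simp add: cvec_def)
        moreover have "norm (cvec r) \<le> R" "norm (\<gamma> (cvec r)) \<le> R" using r by (simp_all add: \<gamma>(2) norm_cvec)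
        ultimately show "g \<in> (\<lambda>\<gamma> r. \<chi> j. Re (\<gamma> (cvec r) $ j)) ` {g \<in> ?\<Gamma>. \<exists>z. norm z \<le> R \<and> norm (g z) \<le> R}"
          using \<gamma>(1) by blast
      qed
      then show ?thesis by (rule finite_subset) (intro finite_imageI deck_group_nak_type(3)[OF assms])
    qed
  qed
qed

lemma nak_type_orbit:
  assumes "stable_lattice lam K" "stable_lattice lam K'"
  shows "y \<in> orbit (nak_type_group lam tau (complex_lattice K K')) z \<longleftrightarrow>
    (\<exists>n m a b. a \<in> K \<and> b \<in> K' \<and> y = act lam tau n m (\<chi> j. Complex (a $ j) (b $ j)) z)"
proof
  assume "y \<in> orbit (nak_type_group lam tau (complex_lattice K K')) z"
  then obtain n m w where "w \<in> complex_lattice K K'" "y = act lam tau n m w z"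
    unfolding orbit_def nak_type_group_eq[OF assms] by blast
  then show "\<exists>n m a b. a \<in> K \<and> b \<in> K' \<and> y = act lam tau n m (\<chi> j. Complex (a $ j) (b $ j)) z"
    unfolding complex_lattice_def by blast
next
  assume "\<exists>n m a b. a \<in> K \<and> b \<in> K' \<and> y = act lam tau n m (\<chi> j. Complex (a $ j) (b $ j)) z"
  then obtain n m a b where *: "a \<in> K" "b \<in> K'" "y = act lam tau n m (\<chi> j. Complex (a $ j) (b $ j)) z"
    by blast
  then have "(\<chi> j. Complex (a $ j) (b $ j)) \<in> complex_lattice K K'" unfolding complex_lattice_def by blast
  then show "y \<in> orbit (nak_type_group lam tau (complex_lattice K K')) z"
    unfolding orbit_def nak_type_group_eq[OF assms] *(3) by blast
qed

lemma real_slice_orbit: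
  assumes st: "stable_lattice lam K" "stable_lattice lam K'" and tau: "tau \<noteq> 0"
  shows "r' \<in> orbit (real_slice_group (nak_type_group lam tau (complex_lattice K K'))) r \<longleftrightarrow>
     cvec r' \<in> orbit (nak_type_group lam tau (complex_lattice K K')) (cvec r)"
proof
  assume "r' \<in> orbit (real_slice_group (nak_type_group lam tau (complex_lattice K K'))) r"
  then show "cvec r' \<in> orbit (nak_type_group lam tau (complex_lattice K K')) (cvec r)"
    unfolding orbit_def real_slice_group_def by (auto intro: rev_image_eqI)
next
  assume "cvec r' \<in> orbit (nak_type_group lam tau (complex_lattice K K')) (cvec r)"
  then obtain n m a b where a: "a \<in> K" and
    e: "cvec r' = act lam tau n m (\<chi> j. Complex (a $ j) (b $ j)) (cvec r)"
    unfolding nak_type_orbit[OF st] by blast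
  have "r' $ i = Re (cvec r' $ i)" for i by (simp add: cvec_def)
  then have "r' = slice_act lam n a r"
    unfolding e by (simp add: vec_eq_iff forall_3 cvec_def)
  then show "r' \<in> orbit (real_slice_group (nak_type_group lam tau (complex_lattice K K'))) r"
    unfolding orbit_def real_slice_group_eq[OF st tau] using a by blast
qed

text \<open>The components that are acted on by the hyperbolic matrix.\<close>

definition tail :: "real^3 \<Rightarrow> real^2" where "tail v = vector [v $ 2, v $ 3]"

lemma tail_simps [simp]: "tail v $ 1 = v $ 2" "tail v $ 2 = v $ 3"
  by (simp_all add: tail_def)

lemma fibre_lattice_vector:
  "fibre_lattice_basis tau P *v u = vector [tau * u $ 1, (P *v tail u) $ 1, (P *v tail u) $ 2]"
  by (simp add: vec_eq_iff forall_3 matrix_vector_mult_def sum_3 sum_2 fibre_lattice_basis_def)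

lemma mem_fibre_lattice:
  "v \<in> lattice (fibre_lattice_basis tau P) \<longleftrightarrow> (\<exists>m::int. v $ 1 = of_int m * tau) \<and> tail v \<in> lattice P"
proof
  assume "v \<in> lattice (fibre_lattice_basis tau P)"
  then obtain u where u: "u \<in> integer_vectors" "v = fibre_lattice_basis tau P *v u"
    unfolding lattice_def by blast
  obtain m where "u $ 1 = of_int m" using u(1) by (auto simp: integer_vectors_def elim: Ints_cases)
  moreover have "tail v = P *v tail u" by (simp add: u(2) fibre_lattice_vector vec_eq_iff forall_2)
  moreover have "tail u \<in> integer_vectors" using u(1) by (simp add: integer_vectors_def forall_2)
  ultimately show "(\<exists>m::int. v $ 1 = of_int m * tau) \<and> tail v \<in> lattice P"
    by (auto simp: u(2) fibre_lattice_vector lattice_def)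
next
  assume "(\<exists>m::int. v $ 1 = of_int m * tau) \<and> tail v \<in> lattice P"
  then obtain m u where u: "v $ 1 = of_int m * tau" "tail v = P *v u" "u \<in> integer_vectors"
    unfolding lattice_def by blast
  define w :: R3 where "w = vector [of_int m, u $ 1, u $ 2]"
  have "w \<in> integer_vectors" using u(3) by (simp add: integer_vectors_def forall_3 w_def)
  moreover have "tail w = u" by (simp add: w_def vec_eq_iff forall_2)
  then have "P *v tail w = P *v u" by simp
  then have "v = fibre_lattice_basis tau P *v w"
    using u(1) arg_cong[OF u(2), of "\<lambda>x. x $ 1"] arg_cong[OF u(2), of "\<lambda>x. x $ 2"]
    by (simp add: fibre_lattice_vector vec_eq_iff forall_3) (simp add: w_def)
  ultimately show "v \<in> lattice (fibre_lattice_basis tau P)" unfolding lattice_def by blast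
qed

lemma mem_dual_fibre_lattice:
  assumes "tau \<noteq> 0"
  shows "w \<in> dual_lattice (lattice (fibre_lattice_basis tau P)) \<longleftrightarrow>
    (\<exists>m::int. w $ 1 = of_int m * inverse tau) \<and> tail w \<in> dual_lattice (lattice P)"
proof -
  have "w \<in> dual_lattice (lattice (fibre_lattice_basis tau P)) \<longleftrightarrow>
      tau * w $ 1 \<in> \<int> \<and> tail w \<in> dual_lattice (lattice P)"
    unfolding mem_dual_lattice_iff integer_vectors_def mem_Collect_eq forall_3 forall_2
    by (simp add: matrix_vector_mult_def transpose_def sum_3 sum_2 fibre_lattice_basis_def del: transpose_matrix_vector)
  moreover have "tau * w $ 1 \<in> \<int> \<longleftrightarrow> (\<exists>m::int. w $ 1 = of_int m * inverse tau)"
  proof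
    assume "tau * w $ 1 \<in> \<int>"
    then obtain m where "tau * w $ 1 = of_int m" by (auto elim: Ints_cases)
    then have "w $ 1 = of_int m * inverse tau" using assms by (simp add: field_simps)
    then show "\<exists>m::int. w $ 1 = of_int m * inverse tau" ..
  qed (use assms in \<open>auto simp: field_simps\<close>)
  ultimately show ?thesis by simp
qed

lemma affine_lattice_base_nakamura:
  assumes P: "invertible P" and st: "stable_lattice lam (lattice P)" and tau: "tau \<noteq> 0"
    and G: "G = {slice_act lam n a |n a. a \<in> lattice P}" "deck_group G"
  shows "affine_lattice_base G (fibre_lattice_basis tau P)"
  unfolding affine_lattice_base_def
proof (intro conjI ballI)
  show "deck_group G" by fact
  have "det (fibre_lattice_basis tau P) = tau * det P"
    by (simp add: det_3 det_2 fibre_lattice_basis_def algebra_simps)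
  then show "invertible (fibre_lattice_basis tau P)"
    using P tau by (simp add: invertible_det_nz)
  fix g assume "g \<in> G"
  then obtain n a where g: "g = slice_act lam n a" unfolding G by blast
  let ?A = "lattice (fibre_lattice_basis tau P)"
  have mem: "rdil (of_int n * lam) v \<in> ?A" if "v \<in> ?A" for v n
  proof -
    have "tail (rdil (of_int n * lam) v) = dil (of_int n * lam) (tail v)"
      by (simp add: vec_eq_iff forall_2)
    then show ?thesis using that st by (simp add: mem_fibre_lattice stable_lattice_def)
  qed
  have "v \<in> rdil (of_int n * lam) ` ?A" if "v \<in> ?A" for v
    using mem[OF that, of "- n"] by (intro image_eqI[of _ _ "rdil (of_int (- n) * lam) v"]) (simp_all add: rdil_rdil)
  then have "rdil (of_int n * lam) ` ?A = ?A" using mem by blast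
  then show "\<exists>L b. linear L \<and> g = (\<lambda>r. L r + b) \<and> L ` ?A = ?A"
    unfolding g slice_act_affine using linear_rdil by blast
qed

text \<open>A fundamental domain: the first coordinate is reduced modulo \<open>lam\<close> by the hyperbolic generator,
  and afterwards the other two are reduced modulo the lattice by subtracting integer parts.\<close>

lemma compact_base:
  assumes P: "invertible P" and lam: "lam \<noteq> 0"
    and G: "G = {slice_act lam n a |n a. a \<in> lattice P}"
  shows "compact_quotient G"
  unfolding compact_quotient_def
proof (intro exI conjI allI)
  let ?B = "\<lambda>v. fibre_lattice_basis lam P *v v"
  let ?C = "?B ` cbox 0 (\<chi> i. 1)"
  show "compact ?C"
    by (intro compact_continuous_image linear_continuous_on compact_cbox) (simp add: matrix_vector_mul_bounded_linear)
  fix r :: R3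
  (* n reduces the first coordinate; u are the coordinates of the dilated remainder in the lattice basis *)
  define n where "n = - \<lfloor>r $ 1 / lam\<rfloor>"
  define u where "u = matrix_inv P *v dil (of_int n * lam) (tail r)"
  define a where "a = P *v (\<chi> i. - of_int \<lfloor>u $ i\<rfloor>)"
  define x :: R3 where "x = vector [frac (r $ 1 / lam), frac (u $ 1), frac (u $ 2)]"
  have "a \<in> lattice P" unfolding a_def lattice_def by (auto simp: integer_vectors_def)
  moreover have "slice_act lam n a r = ?B x"
  proof -
    have Pu: "P *v u = dil (of_int n * lam) (tail r)"
      unfolding u_def by (rule matrix_inv_vector(2)[OF P])
    have "tail x = u + (\<chi> i. - of_int \<lfloor>u $ i\<rfloor>)"
      by (simp add: vec_eq_iff forall_2 x_def frac_def)
    then have "P *v tail x = dil (of_int n * lam) (tail r) + a"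
      by (simp add: matrix_vector_right_distrib Pu a_def)
    then show ?thesis
      using lam by (simp add: fibre_lattice_vector vec_eq_iff forall_3) (simp add: x_def n_def frac_def field_simps)
  qed
  moreover have "x \<in> cbox 0 (\<chi> i. 1)"
    by (auto simp: mem_box_cart forall_3 x_def frac_lt_1[THEN less_imp_le])
  ultimately show "orbit G r \<inter> ?C \<noteq> {}"
    unfolding orbit_def G by blast
qed

lemma tangent_orbit:
  assumes G: "G = {slice_act lam n a |n a. a \<in> K}"
  shows "(r', s') \<in> orbit (tangent_group G A) (r, s) \<longleftrightarrow>
    (\<exists>n a c. a \<in> K \<and> c \<in> lattice A \<and> r' = slice_act lam n a r \<and> s' = rdil (of_int n * lam) s + c)"
proof -
  have T: "tangent_group G A = {fibre_translation c \<circ> tangent_lift (slice_act lam n a) |c n a. c \<in> lattice A \<and> a \<in> K}"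
    unfolding tangent_group_def G by blast
  have e: "(fibre_translation c \<circ> tangent_lift (slice_act lam n a)) (r, s) = (slice_act lam n a r, rdil (of_int n * lam) s + c)" for c n a
    by (simp add: fibre_translation_def tangent_lift_def frechet_slice_act)
  show ?thesis
  proof
    assume "(r', s') \<in> orbit (tangent_group G A) (r, s)"
    then obtain g where "g \<in> tangent_group G A" "(r', s') = g (r, s)" unfolding orbit_def by blast
    then obtain c n a where "c \<in> lattice A" "a \<in> K" "(r', s') = (fibre_translation c \<circ> tangent_lift (slice_act lam n a)) (r, s)"
      unfolding T by blast
    then show "\<exists>n a c. a \<in> K \<and> c \<in> lattice A \<and> r' = slice_act lam n a r \<and> s' = rdil (of_int n * lam) s + c"
      unfolding e by blast
  next
    assume "\<exists>n a c. a \<in> K \<and> c \<in> lattice A \<and> r' = slice_act lam n a r \<and> s' = rdil (of_int n * lam) s + c"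
    then obtain n a c where *: "a \<in> K" "c \<in> lattice A" "(r', s') = (fibre_translation c \<circ> tangent_lift (slice_act lam n a)) (r, s)"
      unfolding e by blast
    then have "fibre_translation c \<circ> tangent_lift (slice_act lam n a) \<in> tangent_group G A"
      unfolding T by blast
    then show "(r', s') \<in> orbit (tangent_group G A) (r, s)" unfolding orbit_def *(3) by (rule imageI)
  qed
qed

lemma adjoint_rdil: "adjoint (rdil c) = rdil c"
  by (rule adjoint_unique) (simp add: inner_vec_def sum_3 algebra_simps)

text \<open>The cotangent lift is the inverse transpose of a symmetric matrix, hence dilates by the
  inverse.\<close>

lemma cotangent_orbit:
  assumes G: "G = {slice_act lam n a |n a. a \<in> K}"
  shows "(r', t') \<in> orbit (cotangent_group G A) (r, t) \<longleftrightarrow>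
    (\<exists>n a c. a \<in> K \<and> c \<in> dual_lattice (lattice A) \<and> r' = slice_act lam n a r
      \<and> t' = rdil (- (of_int n * lam)) t + c)"
proof -
  have T: "cotangent_group G A = {fibre_translation c \<circ> cotangent_lift (slice_act lam n a) |c n a. c \<in> dual_lattice (lattice A) \<and> a \<in> K}"
    unfolding cotangent_group_def G by blast
  have e: "(fibre_translation c \<circ> cotangent_lift (slice_act lam n a)) (r, t) = (slice_act lam n a r, rdil (- (of_int n * lam)) t + c)" for c n a
    by (simp add: fibre_translation_def cotangent_lift_def frechet_slice_act slice_act_inv adjoint_rdil)
  show ?thesis
  proof
    assume "(r', t') \<in> orbit (cotangent_group G A) (r, t)"
    then obtain g where "g \<in> cotangent_group G A" "(r', t') = g (r, t)" unfolding orbit_def by blast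
    then obtain c n a where "c \<in> dual_lattice (lattice A)" "a \<in> K" "(r', t') = (fibre_translation c \<circ> cotangent_lift (slice_act lam n a)) (r, t)"
      unfolding T by blast
    then show "\<exists>n a c. a \<in> K \<and> c \<in> dual_lattice (lattice A) \<and> r' = slice_act lam n a r \<and> t' = rdil (- (of_int n * lam)) t + c"
      unfolding e by blast
  next
    assume "\<exists>n a c. a \<in> K \<and> c \<in> dual_lattice (lattice A) \<and> r' = slice_act lam n a r \<and> t' = rdil (- (of_int n * lam)) t + c"
    then obtain n a c where *: "a \<in> K" "c \<in> dual_lattice (lattice A)" "(r', t') = (fibre_translation c \<circ> cotangent_lift (slice_act lam n a)) (r, t)"
      unfolding e by blast
    then have "fibre_translation c \<circ> cotangent_lift (slice_act lam n a) \<in> cotangent_group G A"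
      unfolding T by blast
    then show "(r', t') \<in> orbit (cotangent_group G A) (r, t)" unfolding orbit_def *(3) by (rule imageI)
  qed
qed

lemma quotient_diffeo_linear:
  fixes F :: "'a::euclidean_space \<Rightarrow> 'b::euclidean_space"
  assumes "linear F" "linear F'" "\<And>x. F' (F x) = x" "\<And>y. F (F' y) = y"
    and "\<And>x y. y \<in> orbit \<Gamma> x \<longleftrightarrow> F y \<in> orbit \<Gamma>' (F x)"
  shows "quotient_diffeo \<Gamma> \<Gamma>' F"
proof -
  have "bij F" using assms(3,4) by (metis bijI')
  moreover have "inv F = F'" using assms(3,4) by (metis \<open>bij F\<close> bij_inv_eq_iff ext)
  ultimately show ?thesis unfolding quotient_diffeo_def using assms smooth_linear by metis
qed

text \<open>The fibre coordinate is \<open>- Im z\<close>, so imaginary translations enter with a minus sign; the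
  lattices are symmetric.\<close>

lemma slice_chart_diffeo:
  assumes st: "stable_lattice lam (lattice P)"
    and G: "G = {slice_act lam n a |n a. a \<in> lattice P}"
  shows "quotient_diffeo (tangent_group G (fibre_lattice_basis tau P)) (nakamura_group lam tau P) slice_chart"
proof (rule quotient_diffeo_linear[where F' = "\<lambda>z. (\<chi> j. Re (z $ j), \<chi> j. - Im (z $ j))"])
  show "linear slice_chart" by (rule linear_slice_chart)
  show "linear (\<lambda>z::C3. (\<chi> j. Re (z $ j), \<chi> j. - Im (z $ j)) :: R3 \<times> R3)"
    by (rule linearI) (auto simp: vec_eq_iff)
  show "slice_chart ((\<chi> j. Re (y $ j), \<chi> j. - Im (y $ j))) = y" for y
    by (simp add: slice_chart_def vec_eq_iff)
  show "(\<chi> j. Re (slice_chart x $ j), \<chi> j. - Im (slice_chart x $ j)) = x" for x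
    by (cases x) (simp add: slice_chart_def vec_eq_iff)
  fix x y :: "R3 \<times> R3"
  obtain r s r' s' where xy: "x = (r, s)" "y = (r', s')" by (cases x, cases y)
  have neg: "- b \<in> lattice P" if "b \<in> lattice P" for b using st that by (simp add: stable_lattice_def)
  show "y \<in> orbit (tangent_group G (fibre_lattice_basis tau P)) x \<longleftrightarrow>
    slice_chart y \<in> orbit (nakamura_group lam tau P) (slice_chart x)"
  proof
    assume "y \<in> orbit (tangent_group G (fibre_lattice_basis tau P)) x"
    then obtain n a c m where a: "a \<in> lattice P" and c: "tail c \<in> lattice P" "c $ 1 = of_int m * tau"
      and e: "r' = slice_act lam n a r" "s' = rdil (of_int n * lam) s + c"
      unfolding xy tangent_orbit[OF G] mem_fibre_lattice by blast
    have "slice_chart y = act lam tau n (- m) (\<chi> j. Complex (a $ j) ((- tail c) $ j)) (slice_chart x)"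
      by (simp add: xy e slice_chart_def vec_eq_iff forall_3 complex_eq_iff c)
    then show "slice_chart y \<in> orbit (nakamura_group lam tau P) (slice_chart x)"
      unfolding nakamura_group_def nak_type_orbit[OF st st] using a neg[OF c(1)] by blast
  next
    assume "slice_chart y \<in> orbit (nakamura_group lam tau P) (slice_chart x)"
    then obtain n m a b where ab: "a \<in> lattice P" "b \<in> lattice P" and
      e: "slice_chart y = act lam tau n m (\<chi> j. Complex (a $ j) (b $ j)) (slice_chart x)"
      unfolding nakamura_group_def nak_type_orbit[OF st st] by blast
    have e': "slice_chart y $ i = act lam tau n m (\<chi> j. Complex (a $ j) (b $ j)) (slice_chart x) $ i" for i
      by (simp only: e)
    define c :: R3 where "c = vector [- of_int m * tau, - b $ 1, - b $ 2]"
    have "tail c = - b" by (simp add: c_def vec_eq_iff forall_2)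
    then have "c \<in> lattice (fibre_lattice_basis tau P)"
      using neg[OF ab(2)] unfolding mem_fibre_lattice by (auto simp: c_def intro: exI[of _ "- m"])
    moreover have "r' = slice_act lam n a r" "s' = rdil (of_int n * lam) s + c"
      using e'[of 1] e'[of 2] e'[of 3]
      by (simp_all add: vec_eq_iff forall_3 xy slice_chart_def complex_eq_iff c_def)
    ultimately show "y \<in> orbit (tangent_group G (fibre_lattice_basis tau P)) x"
      unfolding xy tangent_orbit[OF G] using ab by blast
  qed
qed

text \<open>In the coordinates \<open>t = (- y\<^sub>1, y\<^sub>3, - y\<^sub>2)\<close> the hyperbolic generator acts by the inverse of its
  action on the base, because the second and third coordinates are exchanged. The imaginary
  lattice of the mirror becomes the dual lattice, again because of this exchange.\<close>

lemma mirror_chart_diffeo: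
  assumes P: "invertible P" and st: "stable_lattice lam (lattice P)" and tau: "tau \<noteq> 0"
    and G: "G = {slice_act lam n a |n a. a \<in> lattice P}"
  shows "quotient_diffeo (cotangent_group G (fibre_lattice_basis tau P)) (mirror_group lam tau P) mirror_chart"
proof (rule quotient_diffeo_linear[where F' = "\<lambda>z. (\<chi> j. Re (z $ j), vector [- Im (z $ 1), Im (z $ 3), - Im (z $ 2)])"])
  let ?K' = "imag_of_dual ` lattice (transpose (matrix_inv P))"
  let ?D = "dual_lattice (lattice P)"
  note st' = stable_lattice_mirror[OF P st]
  show "linear mirror_chart" by (rule linear_mirror_chart)
  show "linear (\<lambda>z::C3. (\<chi> j. Re (z $ j), vector [- Im (z $ 1), Im (z $ 3), - Im (z $ 2)]) :: R3 \<times> R3)"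
    by (rule linearI) (auto simp: vec_eq_iff forall_3)
  show "mirror_chart ((\<chi> j. Re (y $ j), vector [- Im (y $ 1), Im (y $ 3), - Im (y $ 2)])) = y" for y
    by (simp add: vec_eq_iff forall_3)
  show "(\<chi> j. Re (mirror_chart x $ j), vector [- Im (mirror_chart x $ 1), Im (mirror_chart x $ 3), - Im (mirror_chart x $ 2)]) = x" for x
    by (cases x) (simp add: vec_eq_iff forall_3)
  fix x y :: "R3 \<times> R3"
  obtain r t r' t' where xy: "x = (r, t)" "y = (r', t')" by (cases x, cases y)
  show "y \<in> orbit (cotangent_group G (fibre_lattice_basis tau P)) x \<longleftrightarrow>
    mirror_chart y \<in> orbit (mirror_group lam tau P) (mirror_chart x)"
  proof
    assume "y \<in> orbit (cotangent_group G (fibre_lattice_basis tau P)) x"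
    then obtain n a c m where a: "a \<in> lattice P" and c: "tail c \<in> ?D" "c $ 1 = of_int m * inverse tau"
      and e: "r' = slice_act lam n a r" "t' = rdil (- (of_int n * lam)) t + c"
      unfolding xy cotangent_orbit[OF G] mem_dual_fibre_lattice[OF tau] by blast
    have "mirror_chart y = act lam (inverse tau) n (- m) (\<chi> j. Complex (a $ j) (imag_of_dual (tail c) $ j))
        (mirror_chart x)"
      by (simp add: xy e vec_eq_iff forall_3 complex_eq_iff c imag_of_dual_def)
    moreover have "imag_of_dual (tail c) \<in> ?K'" unfolding lattice_transpose_inv[OF P] using c(1) by blast
    ultimately show "mirror_chart y \<in> orbit (mirror_group lam tau P) (mirror_chart x)"
      unfolding mirror_group_def nak_type_orbit[OF st st'] using a by blast
  next
    assume "mirror_chart y \<in> orbit (mirror_group lam tau P) (mirror_chart x)"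
    then obtain n m a b where ab: "a \<in> lattice P" "b \<in> ?D" and
      e: "mirror_chart y = act lam (inverse tau) n m (\<chi> j. Complex (a $ j) (imag_of_dual b $ j)) (mirror_chart x)"
      unfolding mirror_group_def nak_type_orbit[OF st st'] unfolding lattice_transpose_inv[OF P] by blast
    have e': "mirror_chart y $ i = act lam (inverse tau) n m (\<chi> j. Complex (a $ j) (imag_of_dual b $ j)) (mirror_chart x) $ i" for i
      by (simp only: e)
    define c :: R3 where "c = vector [of_int (- m) * inverse tau, b $ 1, b $ 2]"
    have "tail c = b" by (simp add: c_def vec_eq_iff forall_2)
    then have "c \<in> dual_lattice (lattice (fibre_lattice_basis tau P))"
      using ab(2) unfolding mem_dual_fibre_lattice[OF tau] by (auto simp: c_def intro: exI[of _ "- m"])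
    moreover have "r' = slice_act lam n a r" "t' = rdil (- (of_int n * lam)) t + c"
      using e'[of 1] e'[of 2] e'[of 3]
      by (simp_all add: vec_eq_iff forall_3 xy complex_eq_iff c_def imag_of_dual_def)
    ultimately show "y \<in> orbit (cotangent_group G (fibre_lattice_basis tau P)) x"
      unfolding xy cotangent_orbit[OF G] using ab by blast
  qed
qed

section \<open>The mirror pair\<close>

theorem theorem7p1:
  fixes M0 :: "int^2^2" and P :: "real^2^2" and lam tau :: real
  assumes "det M0 = 1"
    and "invertible P"
    and "lam \<noteq> 0"
    and "P ** map_matrix real_of_int M0 ** matrix_inv P = diag2 (exp lam) (exp (- lam))"
    and "tau \<noteq> 0"
  shows "\<exists>Omega. semiflat_susy_mirror_pair
           (nakamura_group lam tau P) nakamura_omega nakamura_Omega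
           (fibre_lattice_basis tau P)
           (mirror_group lam tau P) mirror_omega Omega"
proof
  let ?A = "fibre_lattice_basis tau P"
  let ?\<Gamma> = "nakamura_group lam tau P" let ?\<Gamma>' = "mirror_group lam tau P"
  let ?G = "real_slice_group ?\<Gamma>"
  let ?\<Omega> = "mirror_Omega (fibre_volume ?A)"
  have st: "stable_lattice lam (lattice P)"
    by (rule hyperbolic_lattice_stable[OF assms(1,2,4)])
  have st': "stable_lattice lam (imag_of_dual ` lattice (transpose (matrix_inv P)))"
    by (rule stable_lattice_mirror[OF assms(2) st])
  have deck: "deck_group ?\<Gamma>" "deck_group ?G"
    unfolding nakamura_group_def
    by (rule deck_group_nak_type(1)[OF st st assms(3,5)], rule deck_group_real_slice[OF st st assms(3,5)])
  have deck': "deck_group ?\<Gamma>'"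
    unfolding mirror_group_def using assms(5) by (intro deck_group_nak_type(1)[OF st st' assms(3)]) simp
  have sub: "?\<Gamma> \<subseteq> {act lam tau n m w |n m w. True}" "?\<Gamma>' \<subseteq> {act lam (inverse tau) n m w |n m w. True}"
    unfolding nakamura_group_def mirror_group_def nak_type_group_eq[OF st st] nak_type_group_eq[OF st st'] by blast+
  have G: "?G = {slice_act lam n a |n a. a \<in> lattice P}"
    unfolding nakamura_group_def by (rule real_slice_group_eq[OF st st assms(5)])
  have diffeo: "quotient_diffeo (tangent_group ?G ?A) ?\<Gamma> slice_chart"
    by (rule slice_chart_diffeo[OF st G])
  have "special_lagrangian_slice_fibration ?\<Gamma> nakamura_omega nakamura_Omega ?A"
    unfolding special_lagrangian_slice_fibration_def
  proof (intro conjI allI exI[of _ \<i>])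
    show "affine_lattice_base ?G ?A"
      by (rule affine_lattice_base_nakamura[OF assms(2) st assms(5) G deck(2)])
    show "compact_quotient ?G" by (rule compact_base[OF assms(2,3) G])
    show "r' \<in> orbit ?G r \<longleftrightarrow> cvec r' \<in> orbit ?\<Gamma> (cvec r)" for r r'
      unfolding nakamura_group_def by (rule real_slice_orbit[OF st st assms(5)])
  qed (use diffeo slice_special_lagrangian fibre_special_lagrangian in auto)
  moreover have "semiflat_symplectic_side ?G ?A ?\<Gamma>' mirror_omega mirror_chart"
    unfolding semiflat_symplectic_side_def
    using mirror_chart_diffeo[OF assms(2) st assms(5) G] pullback_mirror_omega by blast
  ultimately show "semiflat_susy_mirror_pair ?\<Gamma> nakamura_omega nakamura_Omega ?A ?\<Gamma>' mirror_omega ?\<Omega>"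
    unfolding semiflat_susy_mirror_pair_def
    using hermitian_nakamura[OF deck(1) sub(1)] nakamura_omega_not_closed
      nakamura_semiflat_complex[OF diffeo] symplectic_mirror[OF deck' sub(2)]
      mirror_Omega_on_quotient[OF sub(2)] pullback_mirror_Omega closed_nakamura_Omega
      nakamura_omega_balanced closed_mirror_omega closed_Re_mirror_Omega by blast
qed

end
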